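(* Let $p$ be an odd prime and $x\in\mathbb Z_p$ with $x\not\equiv0\pmod p$. Then $$G_{\frac{p-1}2}(x)\equiv\begin{cases}\binom{\langle x\rangle_p}{\langle x\rangle_p/2}^2\dfrac1{4^{\langle x\rangle_p}}\pmod p&\text{if }\langle x\rangle_p\text{ is even},\\ 0\pmod p&\text{if }\langle x\rangle_p\text{ is odd}.\end{cases}$$ Moreover, writing $a=\langle x\rangle_p$, $$G_{\frac{p-1}2}(x)\equiv\begin{cases}\displaystyle\sum_{k=0}^{(p-1)/2}\binom xk\binom{-1-x}k\frac{\binom{2k}k}{4^k}\pmod{p^2}&\text{if }a\text{ is even},\\ \displaystyle-\sum_{k=(p+1)/2}^{a}\binom ak\binom{a+k}k\frac{\binom{2k}k}{(-4)^k}-p\sum_{k=0}^{a}\binom ak\binom{a+k}k\frac{\binom{2k}k}{(-4)^k}H_k\pmod{p^2}&\text{if }a\text{ is odd}.\end{cases}$$ Consequently, for every prime $p>3$: $G_{\frac{p-1}2}^{(3)}\equiv27^{\frac{p-1}2}(4u^2-2p)\pmod{p^2}$ if $p\equiv1\pmod3$ and $p=u^2+3v^2$ with integers $u,v$, and $G_{\frac{p-1}2}^{(3)}\equiv0\pmod p$ if $p\equiv2\pmod3$; $G_{\frac{p-1}2}^{(4)}\equiv8^{p-1}\cdot4u^2-2p\pmod{p^2}$ if $p\equiv1,3\pmod8$ and $p=u^2+2v^2$, and $G_{\frac{p-1}2}^{(4)}\equiv0\pmod p$ if $p\equiv5,7\pmod8$; $G_{\frac{p-1}2}^{(6)}\equiv432^{\frac{p-1}2}\left(\frac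 p3\right)\cdot4u^2-2p\pmod{p^2}$ if $p\equiv1\pmod4$ and $p=u^2+4v^2$, and $G_{\frac{p-1}2}^{(6)}\equiv0\pmod p$ if $p\equiv3\pmod4$.
   Context: For real $x$ and integer $k\ge0$, $\binom xk=x(x-1)\cdots(x-k+1)/k!$; $G_n(x)=\sum_{k=0}^n\binom nk(-1)^k\binom xk\binom{-1-x}k$. For a prime $p$, $\mathbb Z_p$ is the set of rationals with denominator prime to $p$; congruences modulo powers of $p$ are in $\mathbb Z_p$; for $x\in\mathbb Z_p$, $\langle x\rangle_p\in\{0,\ldots,p-1\}$ with $x\equiv\langle x\rangle_p\pmod p$. $H_k=\sum_{i=1}^k1/i$, $H_0=0$. $\left(\frac{\cdot}{p}\right)$ is the Legendre symbol. $G_n^{(3)}=27^nG_n(-\tfrac13)$, $G_n^{(4)}=64^nG_n(-\tfrac14)$, $G_n^{(6)}=432^nG_n(-\tfrac16)$. *)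

theory Defs
  imports "HOL-Number_Theory.Number_Theory"
begin

definition G :: "nat \<Rightarrow> 'a::field_char_0 \<Rightarrow> 'a" where
  "G n x = (\<Sum>k=0..n. of_nat (n choose k) * (-1) ^ k * (x gchoose k) * ((-1 - x) gchoose k))"

definition G3 :: "nat \<Rightarrow> rat" where
  "G3 n = 27 ^ n * G n (- (1 / 3))"

definition G4 :: "nat \<Rightarrow> rat" where
  "G4 n = 64 ^ n * G n (- (1 / 4))"

definition G6 :: "nat \<Rightarrow> rat" where
  "G6 n = 432 ^ n * G n (- (1 / 6))"

text \<open>Rational harmonic numbers; \<open>harm\<close> from \<open>HOL-Analysis\<close> requires a real normed field,
  which \<open>rat\<close> is not.\<close>
definition H :: "nat \<Rightarrow> rat" where
  "H k = (\<Sum>i=1..k. 1 / of_nat i)"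

text \<open>The ring of \<open>p\<close>-integral rationals, i.e. the integers localised at \<open>p\<close> (not the
  \<open>p\<close>-adic completion); \<open>quotient_of\<close> yields the fraction in lowest terms.\<close>
definition Zp :: "nat \<Rightarrow> rat set" where
  "Zp p = {x. coprime (snd (quotient_of x)) (int p)}"

text \<open>Congruence modulo \<open>p ^ m\<close> in \<open>Zp p\<close>; it includes the assertion that both sides
  are \<open>p\<close>-integral.\<close>
definition zp_cong :: "nat \<Rightarrow> nat \<Rightarrow> rat \<Rightarrow> rat \<Rightarrow> bool" where
  "zp_cong p m x y \<longleftrightarrow> x \<in> Zp p \<and> y \<in> Zp p \<and> (\<exists>z\<in>Zp p. x - y = of_nat p ^ m * z)"

definition zp_residue :: "nat \<Rightarrow> rat \<Rightarrow> nat" where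
  "zp_residue p x = (THE a. a < p \<and> zp_cong p 1 x (of_nat a))"

end

theory Submission
  imports Defs
begin

text \<open>Write \<open>h = (p - 1) div 2\<close> and \<open>x = a + p t\<close> with \<open>0 \<le> a < p\<close>. Modulo \<open>p\<^sup>2\<close>, \<open>(-1)^k binom(h, k)\<close> is
  \<open>binom(2k, k) / 4^k\<close> times \<open>1 - p (1 + 1/3 + \<dots> + 1/(2k - 1))\<close>, and sums of products \<open>binom(x, k) binom(-1 - x, k)\<close>
  are affine in \<open>t\<close>. What remains are sums over \<open>binom(a, k) binom(a + k, k) binom(2k, k) / (-4)^k\<close>, possibly
  weighted by harmonic numbers, which telescoping evaluates or kills according to the parity of \<open>a\<close>.

  For \<open>x = -1/3, -1/4, -1/6\<close>, after replacing \<open>x\<close> by \<open>-1 - x\<close> if necessary, the residue is \<open>a = 2e\<close> and \<open>G h x\<close> is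
  \<open>binom(h, e)\<^sup>2\<close> times \<open>1 + p\<close> times a combination of harmonic numbers. Such a binomial coefficient is read off a sum
  \<open>T\<close> of Legendre symbols: since \<open>z^(p h)\<close> is the Legendre symbol of \<open>z\<close> modulo \<open>p\<^sup>2\<close>, expanding \<open>(1 + z^n)^(p h)\<close> and
  summing over roots of unity modulo \<open>p\<^sup>2\<close> leaves few terms. Orthogonality gives an exact identity such as
  \<open>p = t\<^sup>2 + n w\<^sup>2\<close> with \<open>T\<close> a fixed multiple of \<open>t\<close>, and \<open>t = \<plusminus>u\<close> because the representation of a prime is unique.
  If \<open>p \<equiv> 3 (mod 8)\<close> the roots of unity are the norm-one elements of the Gaussian integers modulo \<open>p\<^sup>2\<close>. The
  parameter \<open>-1/6\<close> is reduced to the quartic sum by splitting factorials into residue classes modulo 3.\<close>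

section \<open>Congruences of \<open>p\<close>-integral rationals\<close>

lemma Zp_iff: "x \<in> Zp p \<longleftrightarrow> (\<exists>a b::int. b \<noteq> 0 \<and> coprime b (int p) \<and> x = of_int a / of_int b)"
proof
  assume "x \<in> Zp p"
  moreover obtain a b where ab: "quotient_of x = (a, b)" by fastforce
  ultimately show "\<exists>a b::int. b \<noteq> 0 \<and> coprime b (int p) \<and> x = of_int a / of_int b"
    using quotient_of_div[OF ab] quotient_of_denom_pos[OF ab]
    by (intro exI[of _ a] exI[of _ b]) (auto simp: Zp_def)
next
  assume "\<exists>a b::int. b \<noteq> 0 \<and> coprime b (int p) \<and> x = of_int a / of_int b"
  then obtain a b :: int where b: "b \<noteq> 0" "coprime b (int p)" "x = of_int a / of_int b" by blast
  obtain c d where cd: "quotient_of x = (c, d)" by fastforce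
  have d: "d > 0" "coprime c d" "x = of_int c / of_int d"
    using quotient_of_denom_pos[OF cd] quotient_of_coprime[OF cd] quotient_of_div[OF cd] by auto
  have "of_int (c * b) = (of_int (a * d) :: rat)"
    using b d by (simp add: field_simps)
  then have "c * b = a * d" by linarith
  then have "d dvd b * c" by (simp add: mult.commute)
  then have "d dvd b" using d(2) by (simp add: coprime_commute coprime_dvd_mult_left_iff)
  then have "coprime d (int p)" using b(2) by (meson coprime_divisors dvd_refl)
  then show "x \<in> Zp p" using cd by (simp add: Zp_def)
qed

locale odd_prime =
  fixes p :: nat
  assumes prime_p: "prime p" and odd_p: "odd p"
begin

abbreviation cg :: "nat \<Rightarrow> rat \<Rightarrow> rat \<Rightarrow> bool" where "cg \<equiv> zp_cong p"
abbreviation P :: rat where "P \<equiv> of_nat p"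

definition h :: nat where "h = (p - 1) div 2"

lemma p_gt_2: "p > 2"
  using prime_p odd_p by (metis dvd_refl linorder_not_less order_le_less prime_ge_2_nat)

lemma p_eq: "p = 2 * h + 1"
  using odd_p by (auto simp: h_def elim: oddE)

lemma p_nz [simp]: "p \<noteq> 0"
  using p_gt_2 by simp

lemma Zp_of_int [simp, intro]: "of_int a \<in> Zp p"
  unfolding Zp_iff by (rule exI[of _ a], rule exI[of _ 1]) simp

lemma Zp_of_nat [simp, intro]: "of_nat a \<in> Zp p"
  using Zp_of_int[of "int a"] by simp

lemma Zp_numeral [simp, intro]: "numeral a \<in> Zp p"
  using Zp_of_int[of "numeral a"] by simp

lemma Zp_0 [simp, intro]: "0 \<in> Zp p" and Zp_1 [simp, intro]: "1 \<in> Zp p"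
  using Zp_of_int[of 0] Zp_of_int[of 1] by simp_all

lemma Zp_mult [intro]: assumes "x \<in> Zp p" "y \<in> Zp p" shows "x * y \<in> Zp p"
proof -
  from assms obtain a b c d :: int where
    "b \<noteq> 0" "coprime b (int p)" "x = of_int a / of_int b"
    "d \<noteq> 0" "coprime d (int p)" "y = of_int c / of_int d" by (auto simp: Zp_iff)
  then show ?thesis unfolding Zp_iff
    by (intro exI[of _ "a * c"] exI[of _ "b * d"]) auto
qed

lemma Zp_add [intro]: assumes "x \<in> Zp p" "y \<in> Zp p" shows "x + y \<in> Zp p"
proof -
  from assms obtain a b c d :: int where
    "b \<noteq> 0" "coprime b (int p)" "x = of_int a / of_int b"
    "d \<noteq> 0" "coprime d (int p)" "y = of_int c / of_int d" by (auto simp: Zp_iff)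
  then show ?thesis unfolding Zp_iff
    by (intro exI[of _ "a * d + c * b"] exI[of _ "b * d"]) (auto simp: field_simps)
qed

lemma Zp_minus [intro]: assumes "x \<in> Zp p" shows "- x \<in> Zp p"
  using Zp_mult[OF Zp_of_int[of "-1"] assms] by simp

lemma Zp_diff [intro]: assumes "x \<in> Zp p" "y \<in> Zp p" shows "x - y \<in> Zp p"
  using Zp_add[OF assms(1) Zp_minus[OF assms(2)]] by simp

lemma Zp_power [intro]: "x \<in> Zp p \<Longrightarrow> x ^ n \<in> Zp p"
  by (induction n) auto

lemma Zp_sum [intro]: "(\<And>i. i \<in> A \<Longrightarrow> f i \<in> Zp p) \<Longrightarrow> sum f A \<in> Zp p"
  by (induction A rule: infinite_finite_induct) auto

lemma Zp_prod [intro]: "(\<And>i. i \<in> A \<Longrightarrow> f i \<in> Zp p) \<Longrightarrow> prod f A \<in> Zp p"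
  by (induction A rule: infinite_finite_induct) auto

text \<open>Division is total, so dividing by a zero integer would give \<open>0\<close>; the hypothesis excludes it anyway.\<close>
lemma Zp_divide_int: assumes "x \<in> Zp p" "\<not> int p dvd b" shows "x / of_int b \<in> Zp p"
proof -
  have "coprime b (int p)"
    using assms(2) prime_p by (metis coprime_commute prime_imp_coprime prime_nat_int_transfer)
  then have "1 / of_int b \<in> Zp p" using assms(2)
    unfolding Zp_iff by (intro exI[of _ 1] exI[of _ b]) auto
  from Zp_mult[OF assms(1) this] show ?thesis by simp
qed

lemma Zp_divide_nat: assumes "x \<in> Zp p" "\<not> p dvd b" shows "x / of_nat b \<in> Zp p"
  using Zp_divide_int[of x "int b"] assms by simp

lemma Zp_divide_small: assumes "x \<in> Zp p" "0 < b" "b < p" shows "x / of_nat b \<in> Zp p"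
  using assms by (intro Zp_divide_nat) (auto dest: dvd_imp_le)

lemma Zp_divide_2: assumes "x \<in> Zp p" shows "x / 2 \<in> Zp p"
  using Zp_divide_small[OF assms, of 2] p_gt_2 by simp

lemma not_dvd_pow2: "\<not> p dvd 2 ^ k"
  using prime_p p_gt_2 by (metis dvd_imp_le le_less_trans less_irrefl pos2 prime_dvd_power)

lemma not_dvd_pow4: "\<not> p dvd 4 ^ k"
  using not_dvd_pow2[of "2 * k"] by (simp add: power_mult)

lemma Zp_divide_pow4: "x \<in> Zp p \<Longrightarrow> x / 4 ^ k \<in> Zp p"
  using Zp_divide_nat[OF _ not_dvd_pow4] by simp

lemma Zp_divide_pow4': assumes "x \<in> Zp p" shows "x / (-4) ^ k \<in> Zp p"
proof -
  have "x / (-4) ^ k = (if even k then x / 4 ^ k else - (x / 4 ^ k))" by simp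
  then show ?thesis using Zp_divide_pow4[OF assms] by (auto intro: Zp_minus)
qed

definition unit :: "rat \<Rightarrow> bool" where
  "unit u \<longleftrightarrow> u \<noteq> 0 \<and> u \<in> Zp p \<and> 1 / u \<in> Zp p"

lemma unit_Zp: "unit u \<Longrightarrow> u \<in> Zp p" by (simp add: unit_def)

lemma unit_divide: "unit u \<Longrightarrow> x \<in> Zp p \<Longrightarrow> x / u \<in> Zp p"
  unfolding unit_def using Zp_mult[of x "1/u"] by simp

lemma unit_mult: "unit u \<Longrightarrow> unit v \<Longrightarrow> unit (u * v)"
  unfolding unit_def using Zp_mult[of u v] Zp_mult[of "1/u" "1/v"] by simp

lemma unit_int: "\<not> int p dvd a \<Longrightarrow> unit (of_int a)"
  unfolding unit_def using Zp_divide_int[of 1 a] by auto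

lemma unit_nat: "\<not> p dvd a \<Longrightarrow> unit (of_nat a)"
  using unit_int[of "int a"] by simp

lemma unit_fact: "n < p \<Longrightarrow> unit (fact n)"
  using unit_nat[of "fact n"] prime_p by (simp add: prime_dvd_fact_iff)

lemma cg_iff: "cg m x y \<longleftrightarrow> x \<in> Zp p \<and> y \<in> Zp p \<and> (x - y) / P ^ m \<in> Zp p"
proof -
  have "(\<exists>z\<in>Zp p. x - y = P ^ m * z) \<longleftrightarrow> (x - y) / P ^ m \<in> Zp p"
  proof
    assume "(x - y) / P ^ m \<in> Zp p"
    then show "\<exists>z\<in>Zp p. x - y = P ^ m * z" by (rule rev_bexI) simp
  qed auto
  then show ?thesis unfolding zp_cong_def by simp
qed

lemma cg_Zp: "cg m x y \<Longrightarrow> x \<in> Zp p" "cg m x y \<Longrightarrow> y \<in> Zp p"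
  by (auto simp: cg_iff)

lemma cgI: "\<lbrakk>y \<in> Zp p; z \<in> Zp p; x = y + P ^ m * z\<rbrakk> \<Longrightarrow> cg m x y"
  unfolding zp_cong_def by (auto intro!: Zp_add Zp_mult Zp_power)

lemma cgE: assumes "cg m x y" obtains z where "z \<in> Zp p" "x = y + P ^ m * z"
  using assms unfolding zp_cong_def by (metis add.commute diff_add_cancel)

lemma cg_refl [intro]: "x \<in> Zp p \<Longrightarrow> cg m x x" by (auto simp: cg_iff)

lemma cg_sym: assumes "cg m x y" shows "cg m y x"
proof -
  obtain z where "z \<in> Zp p" "x = y + P ^ m * z" using assms by (rule cgE)
  then show ?thesis using cg_Zp[OF assms] by (intro cgI[of _ "-z"]) (auto intro: Zp_minus)
qed

lemma cg_trans [trans]: assumes "cg m x y" "cg m y z" shows "cg m x z"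
proof -
  obtain u where "u \<in> Zp p" "x = y + P ^ m * u" using assms(1) by (rule cgE)
  moreover obtain v where "v \<in> Zp p" "y = z + P ^ m * v" using assms(2) by (rule cgE)
  ultimately show ?thesis using cg_Zp[OF assms(2)]
    by (intro cgI[of _ "u + v"]) (auto simp: algebra_simps)
qed

lemma cg_add: assumes "cg m x y" "cg m u v" shows "cg m (x + u) (y + v)"
proof -
  obtain a where "a \<in> Zp p" "x = y + P ^ m * a" using assms(1) by (rule cgE)
  moreover obtain b where "b \<in> Zp p" "u = v + P ^ m * b" using assms(2) by (rule cgE)
  ultimately show ?thesis using cg_Zp[OF assms(1)] cg_Zp[OF assms(2)]
    by (intro cgI[of _ "a + b"]) (auto simp: algebra_simps)
qed

lemma cg_mult_left: assumes "cg m x y" "u \<in> Zp p" shows "cg m (u * x) (u * y)"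
proof -
  obtain a where "a \<in> Zp p" "x = y + P ^ m * a" using assms(1) by (rule cgE)
  then show ?thesis using cg_Zp[OF assms(1)] assms(2)
    by (intro cgI[of _ "u * a"]) (auto simp: algebra_simps)
qed

lemma cg_minus: "cg m x y \<Longrightarrow> cg m (-x) (-y)"
  using cg_mult_left[of m x y "of_int (-1)", OF _ Zp_of_int] by simp

lemma cg_diff: "cg m x y \<Longrightarrow> cg m u v \<Longrightarrow> cg m (x - u) (y - v)"
  using cg_add[OF _ cg_minus, of m x y u v] by simp

lemma cg_mult: assumes "cg m x y" "cg m u v" shows "cg m (x * u) (y * v)"
proof -
  have "cg m (u * x) (u * y)" using assms by (intro cg_mult_left) (auto dest: cg_Zp)
  moreover have "cg m (y * u) (y * v)" using assms by (intro cg_mult_left) (auto dest: cg_Zp)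
  ultimately have "cg m (u * x) (y * v)" by (metis cg_trans mult.commute)
  then show ?thesis by (simp add: mult.commute)
qed

lemma cg_power: "cg m x y \<Longrightarrow> cg m (x ^ n) (y ^ n)"
  by (induction n) (auto intro: cg_mult)

lemma cg_sum: "(\<And>i. i \<in> A \<Longrightarrow> cg m (f i) (g i)) \<Longrightarrow> cg m (sum f A) (sum g A)"
  by (induction A rule: infinite_finite_induct) (auto intro: cg_add)

lemma cg_unit_cancel: "unit u \<Longrightarrow> cg m (u * x) (u * y) \<Longrightarrow> x \<in> Zp p \<Longrightarrow> y \<in> Zp p \<Longrightarrow> cg m x y"
  using cg_mult_left[of m "u * x" "u * y" "1 / u"] by (simp add: unit_def)

lemma cg_divide_unit: "unit u \<Longrightarrow> cg m x y \<Longrightarrow> cg m (x / u) (y / u)"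
  using cg_mult_left[of m x y "1 / u"] by (simp add: unit_def)

lemma cg_mono: assumes "cg m x y" "n \<le> m" shows "cg n x y"
proof -
  obtain z where z: "z \<in> Zp p" "x = y + P ^ m * z" using assms(1) by (rule cgE)
  have "x = y + P ^ n * (P ^ (m - n) * z)" using assms(2) z by (simp flip: mult.assoc power_add)
  then show ?thesis using z assms(1) by (intro cgI[of y "P ^ (m - n) * z"]) (auto dest: cg_Zp)
qed

lemma cg_P_mult: assumes "cg m x y" shows "cg (Suc m) (P * x) (P * y)"
proof -
  obtain z where "z \<in> Zp p" "x = y + P ^ m * z" using assms by (rule cgE)
  then show ?thesis using cg_Zp[OF assms] by (intro cgI[of _ z]) (auto simp: algebra_simps)
qed

lemma cg_P_mult2: "cg 1 x y \<Longrightarrow> cg 2 (P * x) (P * y)"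
  using cg_P_mult[of 1 x y] by (simp add: numeral_2_eq_2)

lemma cg_P_0: "z \<in> Zp p \<Longrightarrow> cg 1 (P * z) 0"
  by (rule cgI[of _ z]) auto

lemma unit_cg: assumes "unit u" "cg 1 u v" shows "unit v"
proof -
  obtain a b c d :: int where ab: "b \<noteq> 0" "coprime b (int p)" "u = of_int a / of_int b" 
    and cd: "d \<noteq> 0" "coprime d (int p)" "v = of_int c / of_int d"
    using cg_Zp[OF assms(2)] unfolding Zp_iff by blast
  have "\<not> int p dvd c"
  proof
    assume "int p dvd c"
    then obtain k where "c = int p * k" ..
    then have v: "v = P * (of_int k / of_int d)" using cd by simp
    have "of_int k / of_int d \<in> Zp p" using cd unfolding Zp_iff by blast
    then have "cg 1 v 0" unfolding v by (rule cg_P_0)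
    with assms(2) have "cg 1 u 0" by (rule cg_trans)
    then have "cg 1 1 0" using cg_divide_unit[OF assms(1)] assms(1) by (fastforce simp: unit_def)
    then obtain z where "z \<in> Zp p" "1 = P * z" by (auto elim: cgE)
    then obtain e f :: int where ef: "f \<noteq> 0" "coprime f (int p)" "1 = P * (of_int e / of_int f)"
      unfolding Zp_iff by blast
    then have "of_int f = (of_int (int p * e) :: rat)" by (simp add: field_simps)
    then have "f = int p * e" by linarith
    then show False using ef(2) prime_p by (auto simp: coprime_commute)
  qed
  then have c: "coprime c (int p)" "c \<noteq> 0" using prime_p by (auto simp: coprime_commute[of c] intro!: prime_imp_coprime)
  then have "1 / v \<in> Zp p" unfolding Zp_iff using cd by (intro exI[of _ d] exI[of _ c]) auto
  then show ?thesis using cg_Zp[OF assms(2)] c cd by (simp add: unit_def)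
qed

lemma cg_of_int_iff: "cg m (of_int a) (of_int b) \<longleftrightarrow> [a = b] (mod int p ^ m)"
proof
  assume "[a = b] (mod int p ^ m)"
  then obtain k where "a = b + int p ^ m * k" by (metis cong_iff_lin cong_sym)
  then show "cg m (of_int a) (of_int b)" by (intro cgI[of _ "of_int k"]) auto
next
  assume "cg m (of_int a) (of_int b)"
  then obtain z where "z \<in> Zp p" and z: "of_int a = of_int b + P ^ m * z" by (rule cgE)
  then obtain e f :: int where ef: "f \<noteq> 0" "coprime f (int p)" "z = of_int e / of_int f"
    unfolding Zp_iff by blast
  have "of_int ((a - b) * f) = (of_int (int p ^ m * e) :: rat)" using z ef by (simp add: field_simps)
  then have "(a - b) * f = int p ^ m * e" by linarith
  then have "int p ^ m dvd (a - b) * f" by simp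
  moreover have "coprime (int p ^ m) f" using ef(2) by (simp add: coprime_commute)
  ultimately show "[a = b] (mod int p ^ m)" by (simp add: coprime_dvd_mult_left_iff cong_iff_dvd_diff)
qed

lemmas Zp_rules = Zp_add Zp_diff Zp_mult Zp_minus Zp_power Zp_sum Zp_prod Zp_divide_2 Zp_divide_pow4 Zp_divide_pow4'

end

section \<open>Telescoping identities\<close>

definition tau :: "nat \<Rightarrow> nat \<Rightarrow> rat" where
  "tau a k = of_nat (a choose k) * of_nat ((a + k) choose k) * (of_nat ((2 * k) choose k) / (-4) ^ k)"

definition tsum :: "nat \<Rightarrow> (nat \<Rightarrow> rat) \<Rightarrow> rat" where
  "tsum a u = (\<Sum>k=0..a. tau a k * u k)"

definition odd_harm :: "nat \<Rightarrow> rat" where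
  "odd_harm k = (\<Sum>i=1..k. 1 / of_nat (2 * i - 1))"

lemma odd_harm_0 [simp]: "odd_harm 0 = 0" by (simp add: odd_harm_def)

lemma odd_harm_Suc: "odd_harm (Suc k) = odd_harm k + 1 / (2 * of_nat k + 1)"
  by (simp add: odd_harm_def add.commute)

lemma H_0 [simp]: "H 0 = 0" by (simp add: H_def)

lemma H_Suc: "H (Suc k) = H k + 1 / (of_nat k + 1)"
  by (simp add: H_def add.commute)

lemma tau_0 [simp]: "tau a 0 = 1" by (simp add: tau_def)

lemma tau_eq_0: "a < k \<Longrightarrow> tau a k = 0" by (simp add: tau_def)

lemma central_binomial_Suc:
  "of_nat (Suc k) * of_nat ((2 * Suc k) choose Suc k) = 2 * (2 * of_nat k + 1) * (of_nat ((2 * k) choose k) :: 'a::field_char_0)"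
proof -
  have f: "of_nat ((2 * n) choose n) = fact (2 * n) / (fact n * fact n :: 'a)" for n
    by (subst binomial_fact) (auto simp: mult_2)
  have "(1 + of_nat k :: 'a) \<noteq> 0" using of_nat_neq_0[of k, where ?'a = 'a] by simp
  then show ?thesis unfolding f by (simp add: divide_simps) (simp add: algebra_simps)
qed

lemma choose_choose_Suc_right:
  "(of_nat k + 1) ^ 2 * (of_nat (n choose Suc k) * of_nat ((n + Suc k) choose Suc k))
     = (of_nat n - of_nat k) * (of_nat n + of_nat k + 1) * (of_nat (n choose k) * of_nat ((n + k) choose k) :: rat)"
proof -
  have "of_nat (Suc k) * of_nat (n choose Suc k) = (of_nat n - of_nat k) * (of_nat (n choose k) :: rat)"
  proof (cases "k \<le> n")
    case True
    have "Suc k * (n choose Suc k) = (n - k) * (n choose k)"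
      by (metis binomial_absorb_comp binomial_absorption mult.commute)
    then show ?thesis using True by (metis of_nat_mult of_nat_diff)
  qed (simp add: not_le binomial_eq_0)
  moreover have "of_nat (Suc k) * of_nat ((n + Suc k) choose Suc k) = of_nat (n + k + 1) * (of_nat ((n + k) choose k) :: rat)"
    using Suc_times_binomial_eq[of "n + k" k] by (metis Suc_eq_plus1 add_Suc_right mult.commute of_nat_mult)
  ultimately have "(of_nat (Suc k) * of_nat (n choose Suc k)) * (of_nat (Suc k) * of_nat ((n + Suc k) choose Suc k))
      = ((of_nat n - of_nat k) * of_nat (n choose k)) * (of_nat (n + k + 1) * (of_nat ((n + k) choose k) :: rat))"
    by simp
  then show ?thesis by (simp add: power2_eq_square algebra_simps)
qed

lemma tau_Suc_left: "(of_nat n + 1 - of_nat k) * tau (Suc n) k = (of_nat n + 1 + of_nat k) * tau n k"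
proof (cases "k \<le> Suc n")
  case True
  have "(Suc n - k) * (Suc n choose k) = Suc n * (n choose k)"
    using binomial_absorb_comp[of "Suc n" k] by simp
  then have 1: "(of_nat n + 1 - of_nat k) * of_nat (Suc n choose k) = (of_nat n + 1) * (of_nat (n choose k) :: rat)"
    using True by (metis add.commute of_nat_Suc of_nat_diff of_nat_mult)
  have "Suc n * ((Suc n + k) choose k) = (Suc n + k) * ((n + k) choose k)"
    using binomial_absorb_comp[of "Suc n + k" k] by simp
  then have 2: "(of_nat n + 1) * of_nat ((Suc n + k) choose k) = (of_nat n + 1 + of_nat k) * (of_nat ((n + k) choose k) :: rat)"
    by (metis add.commute of_nat_Suc of_nat_add of_nat_mult)
  have "(of_nat n + 1 - of_nat k) * (of_nat (Suc n choose k) * of_nat ((Suc n + k) choose k))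
     = of_nat (n choose k) * ((of_nat n + 1) * (of_nat ((Suc n + k) choose k) :: rat))"
    unfolding mult.assoc[symmetric] 1 by (simp only: mult_ac)
  also have "\<dots> = (of_nat n + 1 + of_nat k) * (of_nat (n choose k) * of_nat ((n + k) choose k))"
    unfolding 2 by (simp only: mult_ac)
  finally have "(of_nat n + 1 - of_nat k) * (of_nat (Suc n choose k) * of_nat ((Suc n + k) choose k)) = \<dots>" .
  then show ?thesis unfolding tau_def by (metis (no_types, opaque_lifting) mult.assoc)
qed (simp add: tau_eq_0)

lemma tau_Suc_right:
  "2 * (of_nat k + 1) ^ 3 * tau n (Suc k) = - (2 * of_nat k + 1) * (of_nat n - of_nat k) * (of_nat n + of_nat k + 1) * tau n k"
proof -
  let ?c = "of_nat ((2 * k) choose k) :: rat" and ?C = "of_nat ((2 * Suc k) choose Suc k) :: rat"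
  have c: "(of_nat k + 1) * ?C = 2 * (2 * of_nat k + 1) * ?c"
    using central_binomial_Suc[of k] by (simp add: add.commute)
  have "2 * (of_nat k + 1) ^ 3 * tau n (Suc k) =
    ((of_nat k + 1) ^ 2 * (of_nat (n choose Suc k) * of_nat ((n + Suc k) choose Suc k))) * (2 * ((of_nat k + 1) * ?C) / (-4) ^ Suc k)"
    unfolding tau_def by (simp add: power3_eq_cube power2_eq_square)
  also have "\<dots> = - (2 * of_nat k + 1) * (of_nat n - of_nat k) * (of_nat n + of_nat k + 1) * tau n k"
    unfolding choose_choose_Suc_right c tau_def by (simp add: field_simps)
  finally show ?thesis .
qed

lemma tau_Suc_Suc:
  "2 * (of_nat k + 1) ^ 3 * tau (Suc n) (Suc k) = - (2 * of_nat k + 1) * (of_nat n + of_nat k + 2) * (of_nat n + of_nat k + 1) * tau n k"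
proof -
  have "2 * (of_nat k + 1) ^ 3 * tau (Suc n) (Suc k) = - (2 * of_nat k + 1) * (of_nat n + of_nat k + 2) * ((of_nat n + 1 - of_nat k) * tau (Suc n) k)"
    unfolding tau_Suc_right by (simp add: algebra_simps)
  then show ?thesis unfolding tau_Suc_left by (simp add: algebra_simps)
qed

lemma tau_pred_Suc:
  "2 * (of_nat k + 1) ^ 3 * tau n (Suc k) = - (2 * of_nat k + 1) * (of_nat n - of_nat k) * (of_nat n + 1 - of_nat k) * tau (Suc n) k"
proof -
  have "2 * (of_nat k + 1) ^ 3 * tau n (Suc k) = - (2 * of_nat k + 1) * (of_nat n - of_nat k) * ((of_nat n + 1 + of_nat k) * tau n k)"
    unfolding tau_Suc_right by (simp add: algebra_simps)
  then show ?thesis unfolding tau_Suc_left[symmetric] by (simp add: algebra_simps)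
qed

lemma tau_telescope:
  "(of_nat n + 2) ^ 2 * tau (Suc (Suc n)) (Suc k) - (of_nat n + 1) ^ 2 * tau n (Suc k)
     = (2 * of_nat n + 3) * ((2 * of_nat k + 3) * tau (Suc n) (Suc k) - (2 * of_nat k + 1) * tau (Suc n) k)"
  (is "?l = ?r")
proof -
  let ?K = "2 * (of_nat k + 1) ^ 3 :: rat"
  note r = tau_Suc_Suc[of k "Suc n"] tau_Suc_right[of k "Suc n"] tau_pred_Suc[of k n]
  have "?K * ?l = (of_nat n + 2) ^ 2 * (?K * tau (Suc (Suc n)) (Suc k)) - (of_nat n + 1) ^ 2 * (?K * tau n (Suc k))"
    by (simp only: right_diff_distrib mult_ac)
  also have "\<dots> = (2 * of_nat n + 3) * ((2 * of_nat k + 3) * (?K * tau (Suc n) (Suc k)) - (2 * of_nat k + 1) * (?K * tau (Suc n) k))"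
    unfolding r by (simp add: power2_eq_square power3_eq_cube algebra_simps)
  also have "\<dots> = ?K * ?r" by (simp only: right_diff_distrib mult_ac)
  finally show ?thesis by (simp del: of_nat_Suc add: add_eq_0_iff)
qed

lemma tau_telescope':
  "(of_nat k + 1) / (of_nat k + 2) * ((of_nat n + 1) * (of_nat n + 3) * tau (Suc (Suc n)) (Suc k) - of_nat n * (of_nat n + 2) * tau n (Suc k))
     = (2 * of_nat n + 3) * ((of_nat k + 1) * (2 * of_nat k + 3) / (of_nat k + 2) * tau (Suc n) (Suc k)
         - of_nat k * (2 * of_nat k + 1) / (of_nat k + 1) * tau (Suc n) k)"
  (is "?v * ?l = (2 * of_nat n + 3) * (?x * _ - ?y * _)")
proof -
  let ?K = "2 * (of_nat k + 1) ^ 3 :: rat" and ?N = "of_nat n :: rat" and ?k = "of_nat k :: rat"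
  note r = tau_Suc_Suc[of k "Suc n"] tau_Suc_right[of k "Suc n"] tau_pred_Suc[of k n]
  have nz: "?k + 1 \<noteq> 0" "?k + 2 \<noteq> 0" by (simp_all add: add_eq_0_iff)
  let ?M = "(?k + 1) * (?k + 2) :: rat"
  have M: "?M * ?v = (?k + 1)^2" "?M * ?x = (?k+1)^2 * (2 * ?k + 3)" "?M * ?y = (?k + 2) * ?k * (2 * ?k + 1)"
    using nz by (simp_all add: power2_eq_square)
  have "(?M * ?K) * (?v * ?l) = (?M * ?v) * ((?N + 1) * (?N + 3) * (?K * tau (Suc (Suc n)) (Suc k)) - ?N * (?N + 2) * (?K * tau n (Suc k)))"
    by (simp only: right_diff_distrib mult_ac)
  also have "\<dots> = (2 * ?N + 3) * ((?M * ?x) * (?K * tau (Suc n) (Suc k)) - (?M * ?y) * (?K * tau (Suc n) k))"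
    unfolding r M by (simp add: power2_eq_square power3_eq_cube algebra_simps)
  also have "\<dots> = (?M * ?K) * ((2 * ?N + 3) * (?x * tau (Suc n) (Suc k) - ?y * tau (Suc n) k))"
    by (simp only: right_diff_distrib mult_ac)
  finally show ?thesis using nz by simp
qed

lemma tsum_extend: "a \<le> N \<Longrightarrow> tsum a u = (\<Sum>k=0..N. tau a k * u k)"
  unfolding tsum_def by (rule sum.mono_neutral_left) (auto simp: tau_eq_0)

lemma tsum_diff: "tsum a (\<lambda>k. u k - v k) = tsum a u - tsum a v"
  by (simp add: tsum_def sum_subtractf right_diff_distrib)

lemma tsum_recurrence:
  "(of_nat n + 2) ^ 2 * tsum (Suc (Suc n)) u - (of_nat n + 1) ^ 2 * tsum n u
     = (2 * of_nat n + 3) * tsum (Suc n) (\<lambda>k. (2 * of_nat k + 1) * (u k - u (Suc k)))"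
proof -
  have "(\<Sum>k=0..N. ((of_nat n + 2) ^ 2 * tau (Suc (Suc n)) k - (of_nat n + 1) ^ 2 * tau n k) * u k)
     = (2 * of_nat n + 3) * ((\<Sum>k=0..N. tau (Suc n) k * ((2 * of_nat k + 1) * (u k - u (Suc k))))
         + (2 * of_nat N + 1) * tau (Suc n) N * u (Suc N))" for N
  proof (induction N)
    case 0
    then show ?case by (simp add: power2_eq_square algebra_simps)
  next
    case (Suc N)
    then show ?case
      by (subst sum.atLeast0_atMost_Suc, subst sum.atLeast0_atMost_Suc, subst tau_telescope)
         (simp add: algebra_simps)
  qed
  note eq = this
  obtain N where N: "N \<ge> Suc (Suc n)" by blast
  have "tau (Suc n) N = 0" using N by (intro tau_eq_0) simp
  then show ?thesis using eq[of N] N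
    by (simp add: tsum_extend[of _ N] sum_distrib_left sum_subtractf left_diff_distrib mult.assoc)
qed

lemma tsum_one_rec: "(of_nat n + 2) ^ 2 * tsum (Suc (Suc n)) (\<lambda>_. 1) = (of_nat n + 1) ^ 2 * tsum n (\<lambda>_. 1)"
  using tsum_recurrence[of n "\<lambda>_. 1"] by (simp add: tsum_def)

lemma tsum_one_odd: "odd a \<Longrightarrow> tsum a (\<lambda>_. 1) = 0"
proof (induction a rule: nat_less_induct)
  case (1 a)
  show ?case
  proof (cases "a = 1")
    case True
    then show ?thesis by (simp add: tsum_def tau_def)
  next
    case False
    then obtain n where n: "a = Suc (Suc n)" using 1(2) by (metis One_nat_def even_zero not0_implies_Suc)
    then have "tsum n (\<lambda>_. 1) = 0" using 1 by auto
    then show ?thesis using tsum_one_rec[of n] n by (simp add: add_eq_0_iff)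
  qed
qed

lemma tsum_one_even: "tsum (2 * m) (\<lambda>_. 1) = (of_nat ((2 * m) choose m) / 4 ^ m) ^ 2"
proof (induction m)
  case 0
  then show ?case by (simp add: tsum_def)
next
  case (Suc m)
  have nz: "(of_nat m + 1 :: rat) \<noteq> 0" by (simp add: add_eq_0_iff)
  have c: "(of_nat m + 1) * (of_nat ((2 * Suc m) choose Suc m) :: rat) = 2 * (2 * of_nat m + 1) * of_nat ((2 * m) choose m)"
    using central_binomial_Suc[of m] by (simp add: add.commute)
  have "4 * (of_nat m + 1) ^ 2 * tsum (2 * Suc m) (\<lambda>_. 1) = (2 * of_nat m + 1) ^ 2 * tsum (2 * m) (\<lambda>_. 1)"
    using tsum_one_rec[of "2 * m"] by (simp add: power2_eq_square algebra_simps)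
  also have "\<dots> = ((of_nat m + 1) * (of_nat ((2 * Suc m) choose Suc m) :: rat)) ^ 2 / (4 * (4 ^ m) ^ 2)"
    unfolding Suc c by (simp add: power2_eq_square field_simps)
  also have "\<dots> = 4 * (of_nat m + 1) ^ 2 * (of_nat ((2 * Suc m) choose Suc m) / 4 ^ Suc m) ^ 2"
    by (simp add: power2_eq_square field_simps del: binomial_Suc_Suc)
  finally show ?case using nz by simp
qed

lemma tsum_odd_harm_even: "even a \<Longrightarrow> tsum a odd_harm = 0"
proof (induction a rule: nat_less_induct)
  case (1 a)
  show ?case
  proof (cases "a = 0")
    case True
    then show ?thesis by (simp add: tsum_def)
  next
    case False
    then obtain n where n: "a = Suc (Suc n)" using 1(2) by (metis One_nat_def even_Suc even_zero not0_implies_Suc)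
    then have z: "tsum n odd_harm = 0" using 1 by auto
    have e: "(2 * of_nat k + 1) * (odd_harm k - odd_harm (Suc k)) = -1" for k
      by (simp add: odd_harm_Suc add_eq_0_iff)
    have "tsum (Suc n) (\<lambda>k. (2 * of_nat k + 1) * (odd_harm k - odd_harm (Suc k))) = - tsum (Suc n) (\<lambda>_. 1)"
      unfolding e by (simp add: tsum_def sum_negf)
    also have "\<dots> = 0" using tsum_one_odd[of "Suc n"] 1(2) n by auto
    finally show ?thesis using tsum_recurrence[of n odd_harm] n z by (simp add: add_eq_0_iff)
  qed
qed

lemma tsum_aux_even: "even a \<Longrightarrow> tsum a (\<lambda>k. of_nat k / (of_nat k + 1)) = 0"
proof (induction a rule: nat_less_induct)
  case (1 a)
  let ?v = "\<lambda>k. of_nat k / (of_nat k + 1) :: rat"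
  show ?case
  proof (cases "a = 0")
    case True
    then show ?thesis by (simp add: tsum_def)
  next
    case False
    then obtain n where n: "a = Suc (Suc n)" using 1(2) by (metis One_nat_def even_Suc even_zero not0_implies_Suc)
    then have z: "tsum n ?v = 0" using 1 by auto
    have "(\<Sum>k=0..N. ?v k * ((of_nat n + 1) * (of_nat n + 3) * tau (Suc (Suc n)) k - of_nat n * (of_nat n + 2) * tau n k))
       = (2 * of_nat n + 3) * (of_nat N * (2 * of_nat N + 1) / (of_nat N + 1) * tau (Suc n) N)" for N
    proof (induction N)
      case 0
      then show ?case by simp
    next
      case (Suc N)
      then show ?case using tau_telescope'[of N n]
        by (simp add: algebra_simps)
    qed
    note eq = this
    obtain N where N: "N \<ge> Suc (Suc n)" by blast
    have "tau (Suc n) N = 0" using N by (intro tau_eq_0) simp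
    then have "(of_nat n + 1) * (of_nat n + 3) * tsum (Suc (Suc n)) ?v = of_nat n * (of_nat n + 2) * tsum n ?v"
      using eq[of N] N
      by (simp add: tsum_extend[of _ N] sum_distrib_left sum_subtractf right_diff_distrib mult_ac)
    then show ?thesis using n z by (simp add: add_eq_0_iff)
  qed
qed

lemma tsum_harm_odd: "odd a \<Longrightarrow> tsum a odd_harm = tsum a H"
proof (induction a rule: nat_less_induct)
  case (1 a)
  let ?u = "\<lambda>k. odd_harm k - H k"
  have "tsum a ?u = 0"
  proof (cases "a = 1")
    case True
    then show ?thesis by (simp add: tsum_def tau_def odd_harm_def H_def)
  next
    case False
    then obtain n where n: "a = Suc (Suc n)" using 1(2) by (metis One_nat_def even_zero not0_implies_Suc)
    then have z: "tsum n ?u = 0" using 1 by (auto simp: tsum_diff)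
    have e: "(2 * of_nat k + 1) * (?u k - ?u (Suc k)) = of_nat k / (of_nat k + 1)" for k
      by (simp add: odd_harm_Suc H_Suc add_eq_0_iff divide_simps) (simp add: algebra_simps)
    have "tsum (Suc n) (\<lambda>k. (2 * of_nat k + 1) * (?u k - ?u (Suc k))) = 0"
      unfolding e using tsum_aux_even[of "Suc n"] 1(2) n by auto
    then show ?thesis using tsum_recurrence[of n ?u] n z by (simp add: add_eq_0_iff)
  qed
  then show ?case by (simp add: tsum_diff)
qed

section \<open>The values of \<open>G\<close> by residue class\<close>

lemma gbinomial_neg_upper_nat: "((-1 - of_nat a) gchoose k) = (-1) ^ k * (of_nat ((a + k) choose k) :: 'a::field_char_0)"
  by (subst gbinomial_negated_upper) (simp add: binomial_gbinomial add.commute)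

definition gprod :: "rat \<Rightarrow> nat \<Rightarrow> rat" where
  "gprod x k = (x gchoose k) * ((-1 - x) gchoose k)"

lemma gprod_reflect: "gprod (-1 - x) k = gprod x k"
  by (simp add: gprod_def)

lemma gprod_of_nat: "gprod (of_nat a) k = (-1) ^ k * (of_nat (a choose k) * of_nat ((a + k) choose k))"
  by (simp add: gprod_def gbinomial_neg_upper_nat binomial_gbinomial)

lemma G_gprod: "G n x = (\<Sum>k=0..n. of_nat (n choose k) * (-1) ^ k * gprod x k)"
  by (simp add: G_def gprod_def mult.assoc)

lemma G_reflect: "G n (-1 - x :: rat) = G n x"
  by (simp add: G_gprod gprod_reflect)

definition cbin :: "nat \<Rightarrow> rat" where
  "cbin k = of_nat ((2 * k) choose k) / 4 ^ k"

lemma tau_eq_gprod: "tau a k = gprod (of_nat a) k * cbin k"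
  by (simp add: tau_def gprod_of_nat cbin_def power_minus[of 4] field_simps)

lemma cbin_0 [simp]: "cbin 0 = 1" by (simp add: cbin_def)

lemma cbin_Suc: "2 * (of_nat k + 1) * cbin (Suc k) = (2 * of_nat k + 1) * cbin k"
proof -
  have "(of_nat k + 1) * (of_nat ((2 * Suc k) choose Suc k) :: rat) = 2 * (2 * of_nat k + 1) * of_nat ((2 * k) choose k)"
    using central_binomial_Suc[of k, where ?'a = rat] by (simp add: add.commute)
  then have "2 * (of_nat k + 1) * cbin (Suc k) = 2 * (2 * (2 * of_nat k + 1) * of_nat ((2 * k) choose k)) / 4 ^ Suc k"
    unfolding cbin_def by (metis (no_types, lifting) mult.assoc times_divide_eq_right)
  also have "\<dots> = (2 * of_nat k + 1) * cbin k" by (simp add: cbin_def field_simps)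
  finally show ?thesis .
qed

definition ssum :: "nat \<Rightarrow> rat \<Rightarrow> rat" where
  "ssum n x = (\<Sum>k=0..n. gprod x k * cbin k)"

lemma ssum_reflect: "ssum n (-1 - x) = ssum n x"
  by (simp add: ssum_def gprod_reflect)

context odd_prime
begin

lemma P_eq: "P = 2 * of_nat h + 1"
  by (subst p_eq) simp

lemma h_less_p: "h < p" using p_eq by linarith

lemma two_h_less_p: "2 * h < p" using p_eq by linarith

lemma cbin_Zp: "cbin k \<in> Zp p"
  unfolding cbin_def by (intro Zp_divide_pow4) simp

lemma Zp_odd_recip: "i < h \<Longrightarrow> 1 / (2 * of_nat i + 1) \<in> Zp p"
  using Zp_divide_small[of 1 "2 * i + 1"] two_h_less_p by (simp add: add.commute)

lemma odd_harm_Zp: "k \<le> h \<Longrightarrow> odd_harm k \<in> Zp p"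
  by (induction k) (auto simp: odd_harm_Suc intro!: Zp_odd_recip)

lemma Zp_recip: "i < p - 1 \<Longrightarrow> 1 / (of_nat i + 1) \<in> Zp p"
  using Zp_divide_small[of 1 "i + 1"] by (simp add: add.commute)

lemma H_Zp: "k < p \<Longrightarrow> H k \<in> Zp p"
  by (induction k) (auto simp: H_Suc intro!: Zp_recip)

lemma choose_h_cong: "k \<le> h \<Longrightarrow> cg 2 (of_nat (h choose k) * (-1) ^ k) (cbin k * (1 - P * odd_harm k))"
proof (induction k)
  case 0
  then show ?case by auto
next
  case (Suc k)
  let ?k = "of_nat k :: rat"
  have u: "1 / (2 * (?k + 1)) \<in> Zp p" using Zp_divide_2[OF Zp_recip[of k]] Suc.prems p_eq by (simp add: mult.commute)
  have k: "2 * ?k + 1 \<noteq> 0" "?k + 1 \<noteq> 0" using of_nat_neq_0[of "2 * k", where ?'a = rat] of_nat_neq_0[of k, where ?'a = rat] by (simp_all add: add.commute)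
  have ab: "Suc k * (h choose Suc k) = (h - k) * (h choose k)"
    by (metis binomial_absorb_comp binomial_absorption mult.commute)
  then have "of_nat (Suc k) * of_nat (h choose Suc k) = of_nat (h - k) * (of_nat (h choose k) :: rat)"
    by (metis of_nat_mult)
  then have "(?k + 1) * of_nat (h choose Suc k) = (of_nat h - ?k) * of_nat (h choose k)"
    using Suc.prems by (simp add: of_nat_diff add.commute)
  then have "of_nat (h choose Suc k) = (of_nat h - ?k) * of_nat (h choose k) / (?k + 1)"
    using k by (simp add: field_simps)
  also have "of_nat h = (P - 1) / 2" using P_eq by simp
  finally have Y: "of_nat (h choose Suc k) = ((P - 1) / 2 - ?k) * of_nat (h choose k) / (?k + 1)" .
  have 1: "of_nat (h choose Suc k) * (-1) ^ Suc k = (2 * ?k + 1 - P) * (1 / (2 * (?k + 1))) * (of_nat (h choose k) * (-1) ^ k)"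
    unfolding Y using k by (simp add: field_simps)
  have 2: "cbin (Suc k) = (2 * ?k + 1) * (1 / (2 * (?k + 1))) * cbin k"
    using cbin_Suc[of k] k by (simp add: field_simps)
  have "cg 2 (of_nat (h choose Suc k) * (-1) ^ Suc k) ((2 * ?k + 1 - P) * (1 / (2 * (?k + 1))) * (cbin k * (1 - P * odd_harm k)))"
    unfolding 1 using Suc.prems by (intro cg_mult_left Suc.IH Zp_mult[OF _ u] Zp_rules) auto
  also have "cg 2 \<dots> (cbin (Suc k) * (1 - P * odd_harm (Suc k)))"
  proof (rule cgI[of _ "cbin k * (1 / (2 * (?k + 1))) * odd_harm k"])
    show "cbin (Suc k) * (1 - P * odd_harm (Suc k)) \<in> Zp p"
      using Suc.prems by (intro Zp_rules cbin_Zp odd_harm_Zp) auto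
    show "cbin k * (1 / (2 * (?k + 1))) * odd_harm k \<in> Zp p"
      using Suc.prems by (intro Zp_rules cbin_Zp odd_harm_Zp u) auto
    show "(2 * ?k + 1 - P) * (1 / (2 * (?k + 1))) * (cbin k * (1 - P * odd_harm k)) =
      cbin (Suc k) * (1 - P * odd_harm (Suc k)) + P ^ 2 * (cbin k * (1 / (2 * (?k + 1))) * odd_harm k)"
      unfolding 2 odd_harm_Suc using k by (simp add: divide_simps) (simp add: power2_eq_square algebra_simps)
  qed
  finally show ?case .
qed

lemma gchoose_Zp: assumes "x \<in> Zp p" "k < p" shows "(x gchoose k) \<in> Zp p"
  unfolding gbinomial_prod_rev
  using assms unit_fact[of k] by (intro unit_divide Zp_prod) auto

lemma gprod_Zp: "x \<in> Zp p \<Longrightarrow> k < p \<Longrightarrow> gprod x k \<in> Zp p"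
  unfolding gprod_def by (intro Zp_mult gchoose_Zp Zp_diff Zp_minus) auto

definition aff :: "(rat \<Rightarrow> rat) \<Rightarrow> bool" where
  "aff f \<longleftrightarrow> (\<exists>c\<in>Zp p. \<exists>d\<in>Zp p. \<forall>t\<in>Zp p. cg 2 (f t) (c + P * t * d))"

lemma aff_linear: "c \<in> Zp p \<Longrightarrow> d \<in> Zp p \<Longrightarrow> aff (\<lambda>t. c + P * t * d)"
  unfolding aff_def by (rule bexI[of _ c], rule bexI[of _ d]) (auto intro!: cg_refl)

lemma aff_const: "c \<in> Zp p \<Longrightarrow> aff (\<lambda>t. c)"
  using aff_linear[of c 0] by simp

lemma aff_mult: assumes "aff f" "aff g" shows "aff (\<lambda>t. f t * g t)"
proof -
  obtain c d where c: "c \<in> Zp p" "d \<in> Zp p" "\<And>t. t \<in> Zp p \<Longrightarrow> cg 2 (f t) (c + P * t * d)"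
    using assms(1) unfolding aff_def by blast
  obtain c' d' where c': "c' \<in> Zp p" "d' \<in> Zp p" "\<And>t. t \<in> Zp p \<Longrightarrow> cg 2 (g t) (c' + P * t * d')"
    using assms(2) unfolding aff_def by blast
  have "cg 2 (f t * g t) (c * c' + P * t * (c * d' + d * c'))" if t: "t \<in> Zp p" for t
  proof -
    have "cg 2 (f t * g t) ((c + P * t * d) * (c' + P * t * d'))"
      by (intro cg_mult c c' t)
    also have "cg 2 \<dots> (c * c' + P * t * (c * d' + d * c'))"
      by (rule cgI[of _ "t * t * d * d'"]; (intro Zp_rules c c' t)?)
        (simp_all add: power2_eq_square algebra_simps)
    finally show ?thesis .
  qed
  moreover have "c * c' \<in> Zp p" "c * d' + d * c' \<in> Zp p" using c c' by auto
  ultimately show ?thesis unfolding aff_def by blast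
qed

lemma aff_add: assumes "aff f" "aff g" shows "aff (\<lambda>t. f t + g t)"
proof -
  obtain c d where c: "c \<in> Zp p" "d \<in> Zp p" "\<And>t. t \<in> Zp p \<Longrightarrow> cg 2 (f t) (c + P * t * d)"
    using assms(1) unfolding aff_def by blast
  obtain c' d' where c': "c' \<in> Zp p" "d' \<in> Zp p" "\<And>t. t \<in> Zp p \<Longrightarrow> cg 2 (g t) (c' + P * t * d')"
    using assms(2) unfolding aff_def by blast
  have "cg 2 (f t + g t) (c + c' + P * t * (d + d'))" if t: "t \<in> Zp p" for t
    using cg_add[OF c(3)[OF t] c'(3)[OF t]] by (simp add: algebra_simps)
  moreover have "c + c' \<in> Zp p" "d + d' \<in> Zp p" using c c' by auto
  ultimately show ?thesis unfolding aff_def by blast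
qed

lemma aff_sum: "(\<And>i. i \<in> A \<Longrightarrow> aff (f i)) \<Longrightarrow> aff (\<lambda>t. \<Sum>i\<in>A. f i t)"
  by (induction A rule: infinite_finite_induct) (auto intro: aff_const aff_add)

lemma aff_prod: "(\<And>i. i \<in> A \<Longrightarrow> aff (f i)) \<Longrightarrow> aff (\<lambda>t. \<Prod>i\<in>A. f i t)"
  by (induction A rule: infinite_finite_induct) (auto intro: aff_const aff_mult)

lemma aff_gchoose: assumes "u \<in> Zp p" "v \<in> Zp p" "k < p" shows "aff (\<lambda>t. (u + P * t * v) gchoose k)"
proof -
  have "aff (\<lambda>t. (1 / fact k) * (\<Prod>i = 0..<k. (u - of_nat i) + P * t * v))"
    using assms unit_fact[of k] by (intro aff_mult aff_prod aff_linear aff_const) (auto simp: unit_def)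
  then show ?thesis by (simp add: gbinomial_prod_rev algebra_simps)
qed

lemma aff_gprod: assumes "u \<in> Zp p" "k < p" shows "aff (\<lambda>t. gprod (u + P * t) k)"
proof -
  have "aff (\<lambda>t. ((u + P * t * 1) gchoose k) * ((-1 - u + P * t * (-1)) gchoose k))"
    using assms by (intro aff_mult aff_gchoose) auto
  then show ?thesis by (simp add: gprod_def algebra_simps)
qed

lemma aff_ssum: "u \<in> Zp p \<Longrightarrow> aff (\<lambda>t. ssum h (u + P * t))"
  unfolding ssum_def using h_less_p
  by (intro aff_sum aff_mult aff_gprod aff_const cbin_Zp) auto

lemma aff_cong: assumes "aff f" "t \<in> Zp p" shows "cg 1 (f t) (f 0)"
proof -
  obtain c d where c: "c \<in> Zp p" "d \<in> Zp p" "\<And>t. t \<in> Zp p \<Longrightarrow> cg 2 (f t) (c + P * t * d)"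
    using assms(1) unfolding aff_def by blast
  have "cg 1 (f t) (c + P * t * d)" using c(3)[OF assms(2)] by (rule cg_mono) simp
  also have "cg 1 \<dots> c" using c assms by (intro cgI[of _ "t * d"]) auto
  also have "cg 1 c (f 0)" using cg_mono[OF cg_sym[OF c(3)[of 0]], of 1] by simp
  finally show ?thesis .
qed

lemma aff_interpolate: assumes "aff f" "t \<in> Zp p"
  shows "cg 2 (f t) ((1 + t) * f 0 - t * f (-1))"
proof -
  obtain c d where c: "c \<in> Zp p" "d \<in> Zp p" "\<And>t. t \<in> Zp p \<Longrightarrow> cg 2 (f t) (c + P * t * d)"
    using assms(1) unfolding aff_def by blast
  have "cg 2 ((1 + t) * f 0 - t * f (-1)) ((1 + t) * (c + P * 0 * d) - t * (c + P * (-1) * d))"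
    by (intro cg_diff cg_mult_left c(3) Zp_rules assms Zp_0 Zp_1)
  also have "\<dots> = c + P * t * d" by (simp add: algebra_simps)
  finally have "cg 2 ((1 + t) * f 0 - t * f (-1)) (c + P * t * d)" .
  from cg_trans[OF c(3)[OF assms(2)] cg_sym[OF this]] show ?thesis .
qed

lemma prime_dvd_choose_carry: assumes "a < p" "k < p" "a + k \<ge> p" shows "p dvd ((a + k) choose k)"
proof -
  have "fact k * fact a * ((a + k) choose k) = (fact (a + k) :: nat)"
    using binomial_fact_lemma[of k "a + k"] by simp
  moreover have "p dvd fact (a + k)" using assms prime_p by (simp add: prime_dvd_fact_iff)
  ultimately have "p dvd fact k * fact a * ((a + k) choose k)" by simp
  then show ?thesis using assms prime_p by (auto simp: prime_dvd_mult_iff prime_dvd_fact_iff)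
qed

lemma tau_tail: assumes "h < k" "k \<le> a" "a < p" obtains z where "z \<in> Zp p" "tau a k = P ^ 2 * z"
proof -
  have hp: "2 * k \<ge> p" using assms(1) p_eq by linarith
  obtain u where u: "(a + k) choose k = p * u"
    using prime_dvd_choose_carry[of a k] assms hp by (auto simp: dvd_def)
  obtain v where v: "(2 * k) choose k = p * v"
    using prime_dvd_choose_carry[of k k] assms hp by (auto simp: dvd_def mult_2)
  have "tau a k = P ^ 2 * (of_nat (a choose k) * of_nat u * (of_nat v / (-4) ^ k))"
    unfolding tau_def u v by (simp add: power2_eq_square)
  then show ?thesis by (intro that[of "of_nat (a choose k) * of_nat u * (of_nat v / (-4) ^ k)"] Zp_rules) auto
qed

lemma P_odd_harm_Zp: assumes "k < p" shows "P * odd_harm k \<in> Zp p"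
proof -
  have "P * (1 / of_nat (2 * i - 1)) \<in> Zp p" if i: "i \<in> {1..k}" for i
  proof (cases "2 * i - 1 = p")
    case False
    have "\<not> p dvd 2 * i - 1"
    proof
      assume "p dvd 2 * i - 1"
      then obtain c where c: "2 * i - 1 = p * c" ..
      have "0 < 2 * i - 1" "2 * i - 1 < p * 2" using i assms by auto
      then have "0 < c" "c < 2" unfolding c by auto
      then show False using c False by simp
    qed
    then show ?thesis by (intro Zp_mult Zp_divide_nat) auto
  qed simp
  then show ?thesis unfolding odd_harm_def sum_distrib_left by (rule Zp_sum)
qed

lemma tau_Zp: "tau a k \<in> Zp p"
  unfolding tau_def by (intro Zp_rules) auto

lemma tsum_truncate:
  assumes "a < p" "\<And>k. k < p \<Longrightarrow> u k \<in> Zp p"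
  shows "cg 2 (\<Sum>k=0..h. tau a k * u k) (tsum a u)"
proof -
  have "cg 2 (\<Sum>k\<in>{h<..a}. tau a k * u k) (\<Sum>k\<in>{h<..a}. 0)"
  proof (rule cg_sum)
    fix k assume k: "k \<in> {h<..a}"
    then obtain z where z: "z \<in> Zp p" "tau a k = P ^ 2 * z" using tau_tail[of k a] assms by auto
    have "u k \<in> Zp p" using k assms by auto
    then show "cg 2 (tau a k * u k) 0" using z by (intro cgI[of _ "z * u k"]) auto
  qed
  then have tail: "cg 2 (\<Sum>k\<in>{h<..a}. tau a k * u k) 0" by simp
  show ?thesis
  proof (cases "a \<le> h")
    case True
    then have "(\<Sum>k=0..h. tau a k * u k) = tsum a u" using tsum_extend[of a h u] by simp
    moreover have "tsum a u \<in> Zp p" unfolding tsum_def using assms tau_Zp by (intro Zp_sum Zp_mult) auto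
    ultimately show ?thesis by auto
  next
    case False
    then have "{0..a} = {0..h} \<union> {h<..a}" by auto
    then have "tsum a u = (\<Sum>k=0..h. tau a k * u k) + (\<Sum>k\<in>{h<..a}. tau a k * u k)"
      unfolding tsum_def by (subst sum.union_disjoint[symmetric]) auto
    moreover have "cg 2 ((\<Sum>k=0..h. tau a k * u k) + (\<Sum>k\<in>{h<..a}. tau a k * u k)) ((\<Sum>k=0..h. tau a k * u k) + 0)"
      using tail assms h_less_p tau_Zp by (intro cg_add cg_refl Zp_sum Zp_mult) auto
    ultimately show ?thesis using cg_sym by auto
  qed
qed

lemma ssum_of_nat: "a < p \<Longrightarrow> cg 2 (ssum h (of_nat a)) (tsum a (\<lambda>_. 1))"
  using tsum_truncate[of a "\<lambda>_. 1"] by (simp add: ssum_def tau_eq_gprod)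

lemma G_of_nat: assumes "a < p" shows "cg 2 (G h (of_nat a)) (tsum a (\<lambda>_. 1) - P * tsum a odd_harm)"
proof -
  have "cg 2 (G h (of_nat a)) (\<Sum>k=0..h. cbin k * (1 - P * odd_harm k) * gprod (of_nat a) k)"
    unfolding G_gprod
  proof (rule cg_sum)
    fix k assume "k \<in> {0..h}"
    then have "cg 2 (gprod (of_nat a) k * (of_nat (h choose k) * (- 1) ^ k)) (gprod (of_nat a) k * (cbin k * (1 - P * odd_harm k)))"
      using h_less_p by (intro cg_mult_left choose_h_cong gprod_Zp) auto
    then show "cg 2 (of_nat (h choose k) * (- 1) ^ k * gprod (of_nat a) k) (cbin k * (1 - P * odd_harm k) * gprod (of_nat a) k)"
      by (simp add: mult.commute)
  qed
  also have "(\<Sum>k=0..h. cbin k * (1 - P * odd_harm k) * gprod (of_nat a) k) = (\<Sum>k=0..h. tau a k * (1 - P * odd_harm k))"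
    by (simp add: tau_eq_gprod mult_ac)
  also have "cg 2 \<dots> (tsum a (\<lambda>k. 1 - P * odd_harm k))"
    using assms P_odd_harm_Zp by (intro tsum_truncate) auto
  also have "tsum a (\<lambda>k. 1 - P * odd_harm k) = tsum a (\<lambda>_. 1) - P * tsum a odd_harm"
    unfolding tsum_diff by (simp add: tsum_def sum_distrib_left mult_ac)
  finally show ?thesis .
qed

lemma G_ssum_shift: assumes "t \<in> Zp p"
  shows "cg 2 (G h (of_nat a + P * t)) (ssum h (of_nat a + P * t) + (G h (of_nat a) - ssum h (of_nat a)))"
proof -
  let ?x = "of_nat a + P * t"
  let ?d = "\<lambda>k. of_nat (h choose k) * (-1) ^ k - cbin k :: rat"
  have "cg 2 (\<Sum>k=0..h. ?d k * gprod ?x k) (\<Sum>k=0..h. ?d k * gprod (of_nat a) k)"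
  proof (rule cg_sum)
    fix k assume k: "k \<in> {0..h}"
    have "cg 1 (of_nat (h choose k) * (-1) ^ k) (cbin k * (1 - P * odd_harm k))"
      using choose_h_cong[of k] k by (auto intro: cg_mono)
    also have "cg 1 \<dots> (cbin k)"
      using k by (intro cgI[of _ "- cbin k * odd_harm k"]) (auto simp: algebra_simps intro!: Zp_rules cbin_Zp odd_harm_Zp)
    finally obtain z where z: "z \<in> Zp p" "of_nat (h choose k) * (-1) ^ k = cbin k + P ^ 1 * z" by (rule cgE)
    have "aff (\<lambda>t. gprod (of_nat a + P * t) k)" using k h_less_p by (intro aff_gprod) auto
    from aff_cong[OF this assms] have "cg 1 (gprod ?x k) (gprod (of_nat a) k)" by simp
    then have "cg 2 (P * (z * gprod ?x k)) (P * (z * gprod (of_nat a) k))"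
      using z by (intro cg_P_mult2 cg_mult_left)
    moreover have "?d k = P * z" using z by simp
    ultimately show "cg 2 (?d k * gprod ?x k) (?d k * gprod (of_nat a) k)" by (simp add: mult.assoc)
  qed
  then have "cg 2 (G h ?x - ssum h ?x) (G h (of_nat a) - ssum h (of_nat a))"
    unfolding G_gprod ssum_def left_diff_distrib sum_subtractf by (simp only: mult.commute)
  moreover have "ssum h ?x \<in> Zp p" unfolding ssum_def using assms h_less_p
    by (intro Zp_rules cbin_Zp gprod_Zp) auto
  ultimately have "cg 2 (ssum h ?x + (G h ?x - ssum h ?x)) (ssum h ?x + (G h (of_nat a) - ssum h (of_nat a)))"
    by (intro cg_add) auto
  then show ?thesis by simp
qed

lemma G_even_ssum: assumes "t \<in> Zp p" "a < p" "even a"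
  shows "cg 2 (G h (of_nat a + P * t)) (ssum h (of_nat a + P * t))"
proof -
  let ?S = "ssum h (of_nat a + P * t)"
  have S: "?S \<in> Zp p" unfolding ssum_def using assms h_less_p
    by (intro Zp_rules cbin_Zp gprod_Zp) auto
  have "cg 2 (?S + (G h (of_nat a) - ssum h (of_nat a))) (?S + ((tsum a (\<lambda>_. 1) - P * tsum a odd_harm) - tsum a (\<lambda>_. 1)))"
    using assms S by (intro cg_add cg_diff G_of_nat ssum_of_nat) auto
  also have "\<dots> = ?S" using tsum_odd_harm_even[OF assms(3)] by simp
  finally have "cg 2 (?S + (G h (of_nat a) - ssum h (of_nat a))) ?S" .
  from cg_trans[OF G_ssum_shift[OF assms(1)] this] show ?thesis .
qed

lemma ssum_interpolate: assumes "t \<in> Zp p" "a < p"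
  shows "cg 2 (ssum h (of_nat a + P * t)) ((1 + t) * tsum a (\<lambda>_. 1) - t * tsum (p - 1 - a) (\<lambda>_. 1))"
proof -
  have "of_nat a + P * (-1) = -1 - (of_nat (p - 1 - a) :: rat)" using assms by (simp add: of_nat_diff)
  then have r: "ssum h (of_nat a + P * (-1)) = ssum h (of_nat (p - 1 - a))" by (simp only: ssum_reflect)
  have "cg 2 (ssum h (of_nat a + P * t)) ((1 + t) * ssum h (of_nat a + P * 0) - t * ssum h (of_nat a + P * (-1)))"
    using assms by (intro aff_interpolate[OF aff_ssum, of "of_nat a" t]) auto
  also have "\<dots> = (1 + t) * ssum h (of_nat a) - t * ssum h (of_nat (p - 1 - a))"
    unfolding r by simp
  also have "cg 2 \<dots> ((1 + t) * tsum a (\<lambda>_. 1) - t * tsum (p - 1 - a) (\<lambda>_. 1))"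
    using assms ssum_of_nat[of a] ssum_of_nat[of "p - 1 - a"] by (intro cg_diff cg_mult_left) auto
  finally show ?thesis .
qed

lemma G_even_mod_p: assumes "t \<in> Zp p" "a < p" "even a"
  shows "cg 1 (G h (of_nat a + P * t)) (of_nat (a choose (a div 2)) ^ 2 * (1 / 4 ^ a))"
proof -
  have "cg 1 (G h (of_nat a + P * t)) (ssum h (of_nat a + P * t))"
    using G_even_ssum[OF assms] by (rule cg_mono) simp
  also have "cg 1 \<dots> (ssum h (of_nat a))"
    using aff_cong[OF aff_ssum[of "of_nat a"] assms(1)] by simp
  also have "cg 1 \<dots> (tsum a (\<lambda>_. 1))"
    using ssum_of_nat[OF assms(2)] by (rule cg_mono) simp
  also have "tsum a (\<lambda>_. 1) = of_nat (a choose (a div 2)) ^ 2 * (1 / 4 ^ a)"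
    using assms(3) tsum_one_even[of "a div 2"] by (auto elim!: evenE simp: power_divide power_mult mult.commute[of 2])
  finally show ?thesis .
qed

lemma G_odd: assumes "t \<in> Zp p" "a < p" "odd a"
  shows "cg 2 (G h (of_nat a + P * t)) (- P * tsum a H)"
proof -
  have odd: "odd (p - 1 - a)" using assms(2,3) odd_p by presburger
  have z: "tsum a (\<lambda>_. 1) = 0" "tsum (p - 1 - a) (\<lambda>_. 1) = 0"
    using tsum_one_odd assms(3) odd by auto
  have S: "cg 2 (ssum h (of_nat a + P * t)) 0"
    using ssum_interpolate[OF assms(1,2)] z by simp
  have "cg 2 (ssum h (of_nat a + P * t) + (G h (of_nat a) - ssum h (of_nat a))) (0 + ((0 - P * tsum a odd_harm) - 0))"
    using G_of_nat[OF assms(2)] ssum_of_nat[OF assms(2)] z by (intro cg_add cg_diff S) auto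
  then show ?thesis using cg_trans[OF G_ssum_shift[OF assms(1), of a]] tsum_harm_odd[OF assms(3)] by simp
qed

lemma G_odd_mod_p: assumes "t \<in> Zp p" "a < p" "odd a"
  shows "cg 1 (G h (of_nat a + P * t)) 0"
proof -
  have T: "tsum a H \<in> Zp p" unfolding tsum_def using assms by (intro Zp_sum Zp_mult tau_Zp H_Zp) auto
  have "cg 1 (G h (of_nat a + P * t)) (- P * tsum a H)"
    using G_odd[OF assms] by (rule cg_mono) simp
  also have "cg 1 \<dots> 0" using T by (intro cgI[of _ "- tsum a H"]) auto
  finally show ?thesis .
qed

lemma G_odd_mod_p2: assumes "t \<in> Zp p" "a < p" "odd a"
  shows "cg 2 (G h (of_nat a + P * t))
    (- (\<Sum>k=(p + 1) div 2..a. of_nat (a choose k) * of_nat ((a + k) choose k) * (of_nat ((2 * k) choose k) / (-4) ^ k))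
     - P * (\<Sum>k=0..a. of_nat (a choose k) * of_nat ((a + k) choose k) * (of_nat ((2 * k) choose k) / (-4) ^ k) * H k))"
proof -
  have "cg 2 (\<Sum>k=(p + 1) div 2..a. tau a k) (\<Sum>k=(p + 1) div 2..a. 0)"
  proof (rule cg_sum)
    fix k assume k: "k \<in> {(p + 1) div 2..a}"
    then have "h < k" "k \<le> a" using p_eq by auto
    then obtain z where "z \<in> Zp p" "tau a k = P ^ 2 * z" using tau_tail[of k a] assms by auto
    then show "cg 2 (tau a k) 0" by (intro cgI[of _ z]) auto
  qed
  then have "cg 2 (\<Sum>k=(p + 1) div 2..a. tau a k) 0" by simp
  moreover have "tsum a H \<in> Zp p" unfolding tsum_def using assms by (intro Zp_sum Zp_mult tau_Zp H_Zp) auto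
  ultimately have "cg 2 (- (\<Sum>k=(p + 1) div 2..a. tau a k) - P * tsum a H) (- 0 - P * tsum a H)"
    by (intro cg_diff cg_minus) auto
  then have "cg 2 (- P * tsum a H) (- (\<Sum>k=(p + 1) div 2..a. tau a k) - P * tsum a H)"
    by (auto intro: cg_sym)
  from cg_trans[OF G_odd[OF assms] this] show ?thesis
    by (simp add: tau_def tsum_def)
qed

lemma zp_residue_props: assumes "x \<in> Zp p"
  obtains t where "t \<in> Zp p" "x = of_nat (zp_residue p x) + P * t" "zp_residue p x < p"
proof -
  obtain b c :: int where bc: "c \<noteq> 0" "coprime c (int p)" "x = of_int b / of_int c"
    using assms unfolding Zp_iff by blast
  obtain d where d: "[c * d = 1] (mod int p)" using bc(2) cong_solve_coprime_int by blast
  define a where "a = nat ((b * d) mod int p)"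
  have a: "a < p" "[int a = b * d] (mod int p)"
    using p_gt_2 by (auto simp: a_def cong_def nat_less_iff)
  have "cg 1 (of_int c * x) (of_int (c * int a))"
  proof -
    have "[c * int a = c * (b * d)] (mod int p)" using a(2) by (rule cong_scalar_left)
    also have "c * (b * d) = b * (c * d)" by simp
    also have "[b * (c * d) = b * 1] (mod int p)" using d by (rule cong_scalar_left)
    finally have "[b = c * int a] (mod int p)" by (simp add: cong_sym)
    then have "cg 1 (of_int b) (of_int (c * int a))" by (subst cg_of_int_iff) simp
    then show ?thesis using bc by simp
  qed
  then have *: "cg 1 (of_int c * x) (of_int c * of_nat a)" by simp
  have "\<not> int p dvd c"
    using bc(2) prime_p by (metis coprime_common_divisor dvd_refl not_prime_unit prime_nat_int_transfer)
  from cg_unit_cancel[OF unit_int[OF this] * assms] have 1: "cg 1 x (of_nat a)" by simp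
  have "zp_residue p x = a" unfolding zp_residue_def
  proof (rule the_equality)
    fix b assume "b < p \<and> cg 1 x (of_nat b)"
    then have "cg 1 (of_int (int b)) (of_int (int a))" 

      using cg_trans[OF cg_sym[of 1 x "of_nat b"] 1] by simp
    then have "[int b = int a] (mod int p)" by (subst (asm) cg_of_int_iff) simp
    then show "b = a" using \<open>b < p \<and> _\<close> a(1) by (simp add: cong_int_iff cong_less_modulus_unique_nat)
  qed (use 1 a in auto)
  moreover obtain t where "t \<in> Zp p" "x = of_nat a + P ^ 1 * t" using 1 by (rule cgE)
  ultimately show ?thesis using that a by simp
qed

end

section \<open>Even residues and harmonic numbers\<close>

lemma sum_choose_Suc:
  "(\<Sum>k\<le>Suc n. of_nat (Suc n choose k) * f k) = (\<Sum>k\<le>n. of_nat (n choose k) * f k) + (\<Sum>k\<le>n. of_nat (n choose k) * (f (Suc k) :: 'a::comm_semiring_1))"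
proof -
  have "(\<Sum>k\<le>Suc n. of_nat (Suc n choose k) * f k) = f 0 + (\<Sum>k\<le>n. of_nat (n choose Suc k) * f (Suc k)) + (\<Sum>k\<le>n. of_nat (n choose k) * f (Suc k))"
    by (subst sum.atMost_Suc_shift) (simp add: distrib_right sum.distrib add_ac)
  also have "f 0 + (\<Sum>k\<le>n. of_nat (n choose Suc k) * f (Suc k)) = (\<Sum>k\<le>Suc n. of_nat (n choose k) * f k)"
    by (subst sum.atMost_Suc_shift) simp
  also have "\<dots> = (\<Sum>k\<le>n. of_nat (n choose k) * f k)" by (simp add: binomial_eq_0)
  finally show ?thesis .
qed

lemma sum_choose_recip:
  fixes x :: "'a::field_char_0"
  assumes "\<And>k. k \<le> n \<Longrightarrow> x \<noteq> of_nat k"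
  shows "(\<Sum>k\<le>n. of_nat (n choose k) * ((-1) ^ k / (x - of_nat k))) = (-1) ^ n / (of_nat (Suc n) * (x gchoose Suc n))"
  using assms
proof (induction n arbitrary: x)
  case 0
  then show ?case by simp
next
  case (Suc n)
  let ?g = "x gchoose Suc (Suc n)" and ?a = "x gchoose Suc n" and ?b = "(x - 1) gchoose Suc n"
  have x: "x \<noteq> 0" "x - of_nat (Suc n) \<noteq> 0" using Suc.prems[of 0] Suc.prems[of "Suc n"] by auto
  have xk: "x - 1 \<noteq> of_nat k" if "k \<le> n" for k
    using Suc.prems[of "Suc k"] that by (auto simp: algebra_simps)
  have g: "of_nat (Suc (Suc n)) * ?g = x * ?b" "of_nat (Suc (Suc n)) * ?g = (x - of_nat (Suc n)) * ?a"
    using gbinomial_absorption[of "Suc n" x] gbinomial_absorb_comp[of x "Suc n"] by (simp_all add: algebra_simps)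
  have nz: "y gchoose Suc n \<noteq> 0" if "\<And>k. k \<le> n \<Longrightarrow> y \<noteq> of_nat k" for y :: 'a
    using that of_nat_neq_0[of n, where ?'a = 'a] by (auto simp: gbinomial_prod_rev)
  have ab: "?a \<noteq> 0" "?b \<noteq> 0" using nz[of x] nz[of "x - 1"] Suc.prems xk by auto
  let ?c = "of_nat (Suc n) :: 'a" and ?d = "of_nat (Suc (Suc n)) :: 'a"
  have cd: "?c \<noteq> 0" "?d \<noteq> 0" using of_nat_neq_0 by blast+
  have "(\<Sum>k\<le>Suc n. of_nat (Suc n choose k) * ((-1) ^ k / (x - of_nat k)))
      = (-1) ^ n / (?c * ?a) + (\<Sum>k\<le>n. of_nat (n choose k) * ((-1) ^ Suc k / (x - of_nat (Suc k))))"
    unfolding sum_choose_Suc using Suc.IH[of x] Suc.prems by simp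
  also have "(\<Sum>k\<le>n. of_nat (n choose k) * ((-1) ^ Suc k / (x - of_nat (Suc k))))
      = - (\<Sum>k\<le>n. of_nat (n choose k) * ((-1) ^ k / ((x - 1) - of_nat k)))"
    by (simp add: sum_negf[symmetric] algebra_simps)
  also have "\<dots> = - ((-1) ^ n / (?c * ?b))"
    using Suc.IH[of "x - 1"] xk by simp
  also have "(-1) ^ n / (?c * ?a) + - ((-1) ^ n / (?c * ?b)) = (-1) ^ n * (?b - ?a) / (?c * ?a * ?b)"
    using ab cd by (simp add: divide_simps) (simp add: algebra_simps)
  also have "\<dots> = (-1) ^ n * (- ?c * (?d * ?g)) / (?c * (?d * ?g) * (?d * ?g))"
  proof -
    have "?a = ?d * ?g / (x - ?c)" "?b = ?d * ?g / x" 
      by (simp only: g(2), use x in simp) (simp only: g(1), use x in simp)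
    moreover have "?d * ?g / x - ?d * ?g / (x - ?c) = - ?c * (?d * ?g) / (x * (x - ?c))"
      using x by (simp add: divide_simps del: of_nat_Suc) (simp add: algebra_simps)
    moreover have "?d * ?g \<noteq> 0" using g(1) ab x by simp
    ultimately show ?thesis using x cd by (simp del: of_nat_Suc)
  qed
  also have "\<dots> = (-1) ^ Suc n / (?d * ?g)"
    using g(1) ab x cd by (simp del: of_nat_Suc)
  finally show ?case .
qed

lemma sum_choose_recip_partial:
  "k \<le> n \<Longrightarrow> (\<Sum>j=1..k. (-1) ^ (j - 1) * of_nat (n choose (k - j)) / of_nat j) = of_nat (n choose k) * (H n - H (n - k))"
proof (induction n arbitrary: k)
  case 0
  then show ?case by simp
next
  case (Suc n)
  show ?case
  proof (cases k)
    case 0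
    then show ?thesis by simp
  next
    case [simp]: (Suc i)
    let ?L = "\<lambda>n k. \<Sum>j=1..k. (-1) ^ (j - 1) * of_nat (n choose (k - j)) / of_nat j :: rat"
    have "?L (Suc n) (Suc i) = (\<Sum>j=1..i. (-1) ^ (j - 1) * of_nat (Suc n choose (Suc i - j)) / of_nat j) + (-1) ^ i / of_nat (Suc i)"
      by simp
    also have "(\<Sum>j=1..i. (-1) ^ (j - 1) * of_nat (Suc n choose (Suc i - j)) / of_nat j)
        = (\<Sum>j=1..i. (-1) ^ (j - 1) * of_nat (n choose (Suc i - j)) / of_nat j) + ?L n i"
      unfolding sum.distrib[symmetric]
      by (rule sum.cong) (auto simp: Suc_diff_le add_divide_distrib distrib_left)
    finally have pascal: "?L (Suc n) (Suc i) = ?L n (Suc i) + ?L n i" by simp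
    have IH: "?L n i = of_nat (n choose i) * (H n - H (n - i))" using Suc.IH[of i] Suc.prems by simp
    show ?thesis
    proof (cases "i = n")
      case True
      have "?L n (Suc n) = (\<Sum>j\<le>n. (-1) ^ j * of_nat (n choose (n - j)) / of_nat (Suc j))"
        by (rule sum.reindex_bij_witness[of _ Suc "\<lambda>j. j - 1"]) auto
      also have "\<dots> = - (\<Sum>j\<le>n. of_nat (n choose j) * ((-1) ^ j / (-1 - of_nat j)))"
        unfolding sum_negf[symmetric]
      proof (rule sum.cong)
        fix j assume "j \<in> {..n}"
        then have "n choose (n - j) = n choose j" by (simp add: binomial_symmetric[symmetric])
        moreover have "(-1 - of_nat j :: rat) = - of_nat (Suc j)" by simp
        ultimately show "(-1) ^ j * of_nat (n choose (n - j)) / of_nat (Suc j) = - (of_nat (n choose j) * ((-1) ^ j / (-1 - of_nat j)) :: rat)"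
          by (simp only: minus_divide_right times_divide_eq_right mult.commute minus_minus)
      qed simp
      also have "\<dots> = - ((-1) ^ n / (of_nat (Suc n) * ((-1) gchoose Suc n)))"
      proof (subst sum_choose_recip)
        fix k show "(-1 :: rat) \<noteq> of_nat k"
          using of_nat_0_le_iff[of k, where ?'a = rat] by linarith
      qed simp
      also have "((-1) gchoose Suc n) = ((-1) ^ Suc n :: rat)"
        using gbinomial_neg_upper_nat[of 0 "Suc n", where ?'a = rat] by simp
      finally have "?L n (Suc n) = 1 / of_nat (Suc n)" by (simp add: divide_simps)
      then show ?thesis using pascal IH True by (simp add: H_Suc add.commute del: One_nat_def)
    next
      case False
      then have le: "Suc i \<le> n" using Suc.prems by simp
      let ?x = "of_nat (n choose i) :: rat" and ?y = "of_nat (n choose Suc i) :: rat"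
      obtain m where m: "n - i = Suc m" using le by (metis Suc_diff_Suc Suc_le_lessD)
      have 1: "of_nat (Suc i) * ?y = of_nat (n - i) * ?x"
        by (metis binomial_absorb_comp binomial_absorption mult.commute of_nat_mult)
      have 2: "of_nat (Suc n) = (of_nat (Suc i) + of_nat (n - i) :: rat)"
        using le by (simp add: of_nat_diff)
      have pos: "of_nat (Suc n) \<noteq> (0 :: rat)" "of_nat (n - i) \<noteq> (0::rat)" using le by (auto simp del: of_nat_Suc)
      have key: "(?x + ?y) / of_nat (Suc n) = ?x / of_nat (n - i) - (0::rat) + (?y / of_nat (Suc n) - ?y / of_nat (Suc n)) - (?x / of_nat (n - i) - (?x + ?y) / of_nat (Suc n))"
        by simp
      have "(?x + ?y) * of_nat (n - i) = ?y * of_nat (Suc n)"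
        unfolding 2 using 1 by (simp add: algebra_simps del: of_nat_Suc)
      then have key: "(?x + ?y) / of_nat (Suc n) = ?y / of_nat (n - i)"
        using pos by (simp add: frac_eq_eq del: of_nat_Suc)
      have "?L (Suc n) (Suc i) = ?y * (H n - H (n - Suc i)) + ?x * (H n - H (n - i))"
        using pascal IH Suc.IH[of "Suc i"] le by simp
      also have "H (n - Suc i) = H (n - i) - 1 / of_nat (n - i)"
        using m H_Suc[of m] by (simp add: add.commute diff_Suc)
      also have "?y * (H n - (H (n - i) - 1 / of_nat (n - i))) + ?x * (H n - H (n - i)) = (?x + ?y) * (H n - H (n - i)) + ?y / of_nat (n - i)"
        by (simp add: algebra_simps)
      also have "\<dots> = (?x + ?y) * (H n + 1 / of_nat (Suc n) - H (n - i))"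
        unfolding key[symmetric] by (simp only: right_diff_distrib distrib_left) simp
      finally show ?thesis by (simp add: H_Suc add.commute)
    qed
  qed
qed

context odd_prime
begin

lemma odd_harm_cong: "k \<le> h \<Longrightarrow> cg 1 (odd_harm k) ((H (h - k) - H h) / 2)"
proof (induction k)
  case 0
  then show ?case by auto
next
  case (Suc k)
  obtain m where m: "h - k = Suc m" using Suc.prems by (metis Suc_diff_Suc Suc_le_lessD)
  then have m': "h - Suc k = m" by simp
  let ?k = "of_nat k :: rat"
  have mk: "of_nat m + 1 = (of_nat h - ?k :: rat)"
    using m Suc.prems by (metis Suc_leD add.commute of_nat_Suc of_nat_diff)
  also have "\<dots> = (P - 1 - 2 * ?k) / 2" using P_eq by simp
  finally have mk: "2 * (of_nat m + 1) = P - (2 * ?k + 1)" by simp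
  have nz: "2 * ?k + 1 \<noteq> 0" "of_nat m + 1 \<noteq> (0::rat)"
    using of_nat_neq_0[of "2 * k", where ?'a = rat] of_nat_neq_0[of m, where ?'a = rat] by (simp_all add: add.commute)
  have z: "1 / (2 * ?k + 1) \<in> Zp p" "1 / (of_nat m + 1) \<in> Zp p"
    using Zp_odd_recip[of k] Zp_recip[of m] Suc.prems m p_eq by auto
  have "cg 1 (1 / (2 * ?k + 1)) (- (1 / (of_nat m + 1)) / 2)"
  proof (rule cgI)
    show "- (1 / (of_nat m + 1)) / 2 \<in> Zp p" by (intro Zp_rules z)
    show "(1 / (2 * ?k + 1)) * ((1 / (of_nat m + 1)) / 2) \<in> Zp p" by (intro Zp_rules z)
    have P: "P = 2 * (of_nat m + 1) + (2 * ?k + 1)" using mk by simp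
    show "1 / (2 * ?k + 1) = - (1 / (of_nat m + 1)) / 2 + P ^ 1 * ((1 / (2 * ?k + 1)) * ((1 / (of_nat m + 1)) / 2))"
      unfolding P using nz by (simp add: divide_simps) 
  qed
  then have "cg 1 (odd_harm (Suc k)) ((H (h - k) - H h) / 2 + - (1 / (of_nat m + 1)) / 2)"
    unfolding odd_harm_Suc using Suc by (intro cg_add) auto
  also have "(H (h - k) - H h) / 2 + - (1 / (of_nat m + 1)) / 2 = (H (h - Suc k) - H h) / 2"
    unfolding m m' H_Suc by (simp add: diff_divide_distrib add_divide_distrib)
  finally show ?case .
qed

lemma choose_h_sq_cong: assumes "k \<le> h"
  shows "cg 2 (cbin k ^ 2) (of_nat (h choose k) ^ 2 * (1 + 2 * P * odd_harm k))"
proof -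
  let ?O = "odd_harm k"
  have O: "?O \<in> Zp p" using assms by (rule odd_harm_Zp)
  have "cg 2 ((of_nat (h choose k) * (-1) ^ k) ^ 2) ((cbin k * (1 - P * ?O)) ^ 2)"
    using choose_h_cong[OF assms] by (rule cg_power)
  then have "cg 2 (of_nat (h choose k) ^ 2) ((cbin k * (1 - P * ?O)) ^ 2)"
    by (simp add: power_mult_distrib flip: power_mult)
  then have "cg 2 (of_nat (h choose k) ^ 2 * (1 + 2 * P * ?O)) ((cbin k * (1 - P * ?O)) ^ 2 * (1 + 2 * P * ?O))"
    by (rule cg_mult) (intro cg_refl Zp_rules O Zp_1 Zp_numeral Zp_of_nat)
  also have "cg 2 \<dots> (cbin k ^ 2)"
  proof (rule cgI)
    show "cbin k ^ 2 * (- 3 * ?O ^ 2 + 2 * P * ?O ^ 3) \<in> Zp p"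
      by (intro Zp_rules O cbin_Zp Zp_numeral Zp_of_nat)
    show "(cbin k * (1 - P * ?O)) ^ 2 * (1 + 2 * P * ?O) = cbin k ^ 2 + P ^ 2 * (cbin k ^ 2 * (- 3 * ?O ^ 2 + 2 * P * ?O ^ 3))"
      by (simp add: power2_eq_square power3_eq_cube algebra_simps)
  qed (intro Zp_rules cbin_Zp)
  finally show ?thesis by (rule cg_sym)
qed

lemma G_CM: assumes "2 * e < p" "t \<in> Zp p"
  shows "cg 2 (G h (of_nat (2 * e) + P * t))
    (of_nat (h choose e) ^ 2 * (1 + P * ((1 + t) * H (h - e) - t * H e - H h)))"
proof -
  have e: "e \<le> h" using assms(1) p_eq by linarith
  let ?C = "of_nat (h choose e) :: rat"
  have C: "of_nat (h choose (h - e)) = ?C" using e by (simp add: binomial_symmetric[symmetric])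
  have hh: "h - (h - e) = e" using e by simp
  have ts: "tsum (2 * m) (\<lambda>_. 1) = cbin m ^ 2" for m by (simp add: tsum_one_even cbin_def)
  have sub: "p - 1 - 2 * e = 2 * (h - e)" using e p_eq by linarith
  have Hz: "H h \<in> Zp p" "H e \<in> Zp p" "H (h - e) \<in> Zp p" using e h_less_p by (auto intro!: H_Zp)
  have sq: "cg 2 (cbin k ^ 2) (of_nat (h choose k) ^ 2 * (1 + P * (H (h - k) - H h)))" if k: "k \<le> h" for k
  proof -
    have hz: "H (h - k) \<in> Zp p" using h_less_p by (auto intro!: H_Zp)
    have "cg 2 (P * odd_harm k) (P * ((H (h - k) - H h) / 2))"
      using odd_harm_cong[OF k] by (rule cg_P_mult2)
    then have "cg 2 (of_nat (h choose k) ^ 2 * (1 + 2 * (P * odd_harm k))) (of_nat (h choose k) ^ 2 * (1 + 2 * (P * ((H (h - k) - H h) / 2))))"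
      by (intro cg_mult_left[OF cg_add[OF cg_refl cg_mult_left]]) auto
    then show ?thesis using cg_trans[OF choose_h_sq_cong[OF k]] by (simp add: mult.assoc)
  qed
  have "cg 2 (G h (of_nat (2 * e) + P * t)) (ssum h (of_nat (2 * e) + P * t))"
    using assms by (intro G_even_ssum) auto
  also have "cg 2 \<dots> ((1 + t) * cbin e ^ 2 - t * cbin (h - e) ^ 2)"
    using ssum_interpolate[OF assms(2,1)] unfolding sub ts .
  also have "cg 2 \<dots> ((1 + t) * (?C ^ 2 * (1 + P * (H (h - e) - H h))) - t * (?C ^ 2 * (1 + P * (H e - H h))))"
    using sq[OF e] sq[of "h - e"] unfolding C hh using assms by (intro cg_diff cg_mult_left) auto
  also have "\<dots> = ?C ^ 2 * (1 + P * ((1 + t) * H (h - e) - t * H e - H h))"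
    by (simp add: algebra_simps)
  finally show ?thesis .
qed

definition qbin :: "nat \<Rightarrow> nat" where
  "qbin r = (p choose r) div p"

lemma qbin: "0 < r \<Longrightarrow> r < p \<Longrightarrow> p choose r = p * qbin r"
  using dvd_choose_prime[of r p] prime_p by (auto simp: qbin_def)

lemma qbin_sym: "r \<le> p \<Longrightarrow> qbin (p - r) = qbin r"
  by (simp add: qbin_def binomial_symmetric[symmetric])

lemma choose_pm1_cong: "r < p \<Longrightarrow> cg 1 (of_nat ((p - 1) choose r)) ((-1) ^ r)"
proof -
  assume r: "r < p"
  have "aff (\<lambda>t. (-1 + P * t * 1) gchoose r)" using r by (intro aff_gchoose) (auto intro: Zp_minus)
  from aff_cong[OF this, of 1] have "cg 1 ((-1 + P) gchoose r) ((-1) gchoose r)" by simp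
  moreover have "(-1 + P) = of_nat (p - 1)" using p_gt_2 by (simp add: of_nat_diff)
  moreover have "((-1) gchoose r) = ((-1) ^ r :: rat)"
    using gbinomial_neg_upper_nat[of 0 r, where ?'a = rat] by simp
  ultimately show ?thesis by (simp only: binomial_gbinomial)
qed

lemma qbin_cong: assumes "0 < r" "r < p" shows "cg 1 (of_nat (qbin r)) ((-1) ^ (r - 1) / of_nat r)"
proof -
  have "r * (p choose r) = p * ((p - 1) choose (r - 1))"
    using assms times_binomial_minus1_eq[of r p] by simp
  then have "r * qbin r = (p - 1) choose (r - 1)" using qbin[OF assms] by simp
  then have "of_nat r * of_nat (qbin r) = (of_nat ((p - 1) choose (r - 1)) :: rat)"
    by (metis of_nat_mult)
  then have "cg 1 (of_nat r * of_nat (qbin r)) ((-1) ^ (r - 1))"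
    using choose_pm1_cong[of "r - 1"] assms by simp
  moreover have u: "unit (of_nat r)" using assms by (intro unit_nat) (auto dest: dvd_imp_le)
  ultimately show ?thesis using cg_divide_unit[OF u] assms by fastforce
qed

text \<open>The coefficient of \<open>y^k\<close> in \<open>(1 + y)^(h - 1) * w(y)\<close>, where \<open>(1 + y)^p = 1 + y^p + p w(y)\<close>.\<close>
definition conv :: "nat \<Rightarrow> nat" where
  "conv k = (\<Sum>K<h. if K < k \<and> k - K < p then ((h - 1) choose K) * qbin (k - K) else 0)"

lemma conv_sym: assumes "k \<le> h - 1 + p" shows "conv (h - 1 + p - k) = conv k"
  unfolding conv_def
proof (rule sum.reindex_bij_witness[of _ "\<lambda>K. h - 1 - K" "\<lambda>K. h - 1 - K"], goal_cases)
  case (5 K)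
  then have K: "K \<le> h - 1" by auto
  have c: "(h - 1) choose (h - 1 - K) = (h - 1) choose K" using binomial_symmetric[OF K] by simp
  have "(h - 1 - K < k \<and> k - (h - 1 - K) < p) = (K < h - 1 + p - k \<and> h - 1 + p - k - K < p)"
    using K assms p_gt_2 by linarith
  moreover have "qbin (k - (h - 1 - K)) = qbin (h - 1 + p - k - K)" if "h - 1 - K < k \<and> k - (h - 1 - K) < p"
  proof -
    have *: "h - 1 + p - k - K = p - (k - (h - 1 - K))" using K that by linarith
    show ?thesis unfolding * using that by (intro qbin_sym[symmetric]) linarith
  qed
  ultimately show ?case unfolding c by auto
qed auto

lemma h_pos: "h > 0" using p_gt_2 p_eq by linarith

lemma conv_small: assumes "k < h"
  shows "cg 1 (of_nat h * of_nat (conv k)) (of_nat (h choose k) * ((of_nat h - of_nat k) * (H (h - 1) - H (h - 1 - k))))"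
proof -
  have "cg 1 (of_nat (conv k)) (\<Sum>j=1..k. (-1) ^ (j - 1) * of_nat ((h - 1) choose (k - j)) / of_nat j)"
  proof -
    have "(of_nat (conv k) :: rat) = (\<Sum>K<k. of_nat ((h - 1) choose K) * of_nat (qbin (k - K)))"
      unfolding conv_def of_nat_sum using assms h_less_p
      by (intro sum.mono_neutral_cong_right) auto
    also have "\<dots> = (\<Sum>j=1..k. of_nat ((h - 1) choose (k - j)) * of_nat (qbin j))"
      by (rule sum.reindex_bij_witness[of _ "\<lambda>j. k - j" "\<lambda>K. k - K"]) auto
    also have "cg 1 \<dots> (\<Sum>j=1..k. of_nat ((h - 1) choose (k - j)) * ((-1) ^ (j - 1) / of_nat j))"
      using assms h_less_p by (intro cg_sum cg_mult_left qbin_cong) auto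
    finally show ?thesis by (simp add: mult.commute)
  qed
  also have "(\<Sum>j=1..k. (-1) ^ (j - 1) * of_nat ((h - 1) choose (k - j)) / of_nat j) = of_nat ((h - 1) choose k) * (H (h - 1) - H (h - 1 - k))"
    using assms by (intro sum_choose_recip_partial) simp
  finally have "cg 1 (of_nat h * of_nat (conv k)) (of_nat h * (of_nat ((h - 1) choose k) * (H (h - 1) - H (h - 1 - k))))"
    by (intro cg_mult_left) auto
  moreover have "of_nat h * (of_nat ((h - 1) choose k) * x) = of_nat (h choose k) * ((of_nat h - of_nat k) * x)" for x :: rat
  proof -
    have "(h - k) * (h choose k) = h * ((h - 1) choose k)" by (rule binomial_absorb_comp)
    then have "of_nat h * of_nat ((h - 1) choose k) = (of_nat h - of_nat k) * (of_nat (h choose k) :: rat)"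
      using assms by (metis less_imp_le of_nat_diff of_nat_mult)
    then show ?thesis by (simp only: mult.assoc[symmetric]) (simp only: mult_ac)
  qed
  ultimately show ?thesis by (simp only:)
qed

lemma choose_upper_reflect: assumes "r \<le> h" shows "cg 1 (of_nat ((h + r) choose h)) ((-1) ^ r * of_nat (h choose r))"
proof -
  have "aff (\<lambda>t. (of_nat h + P * t * 1) gchoose r)" using assms h_less_p by (intro aff_gchoose) auto
  from aff_cong[OF this, of "-1"] have "cg 1 ((of_nat h - P) gchoose r) (of_nat h gchoose r)"
    by (simp add: Zp_minus)
  moreover have "of_nat h - P = -1 - of_nat h" using P_eq by simp
  ultimately have "cg 1 ((-1) ^ r * of_nat ((h + r) choose r)) (of_nat (h choose r))"
    by (simp only: gbinomial_neg_upper_nat binomial_gbinomial[of h])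
  then have "cg 1 ((-1) ^ r * ((-1) ^ r * of_nat ((h + r) choose r))) ((-1) ^ r * of_nat (h choose r))"
    by (rule cg_mult_left) (intro Zp_rules Zp_1)
  moreover have "(h + r) choose r = (h + r) choose h" using binomial_symmetric[of r "h + r"] by simp
  ultimately show ?thesis by (simp flip: mult.assoc power_add mult_2)
qed

lemma unit_choose: assumes "n < p" "k \<le> n" shows "unit (of_nat (n choose k))"
proof (rule unit_nat)
  have "fact k * fact (n - k) * (n choose k) = (fact n :: nat)"
    using assms by (intro binomial_fact_lemma)
  moreover have "\<not> p dvd (fact n :: nat)" using assms prime_p by (simp add: prime_dvd_fact_iff)
  ultimately show "\<not> p dvd (n choose k)" by (metis dvd_mult)
qed

lemma conv_middle: assumes "r \<le> h"
  shows "cg 1 (of_nat h * of_nat (conv (h + r))) (1 / of_nat (h choose r))"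
proof -
  have hr: "h + r < p" using assms p_eq by linarith
  have "(of_nat (conv (h + r)) :: rat) = (\<Sum>K\<le>h - 1. of_nat ((h - 1) choose K) * of_nat (qbin (h + r - K)))"
    unfolding conv_def of_nat_sum using hr h_pos
    by (intro sum.cong) auto
  also have "cg 1 \<dots> (\<Sum>K\<le>h - 1. of_nat ((h - 1) choose K) * ((-1) ^ (h + r - K - 1) / of_nat (h + r - K)))"
    using hr h_pos by (intro cg_sum cg_mult_left qbin_cong) auto
  also have "(\<Sum>K\<le>h - 1. of_nat ((h - 1) choose K) * ((-1) ^ (h + r - K - 1) / of_nat (h + r - K)))
      = (-1) ^ (h + r - 1) * (\<Sum>K\<le>h - 1. of_nat ((h - 1) choose K) * ((-1) ^ K / (of_nat (h + r) - of_nat K)) :: rat)"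
    unfolding sum_distrib_left
  proof (rule sum.cong)
    fix K assume "K \<in> {..h - 1}"
    then have K: "K \<le> h + r - 1" "K \<le> h + r" using h_pos by auto
    have "(-1 :: rat) ^ (h + r - 1) = (-1) ^ (h + r - 1 - K) * (-1) ^ K"
      using K(1) by (simp only: power_add[symmetric] le_add_diff_inverse2)
    then have "(-1 :: rat) ^ (h + r - 1) * (-1) ^ K = (-1) ^ (h + r - 1 - K)"
      by (simp only: mult.assoc minus_one_mult_self mult_1_right)
    then have "(-1 :: rat) ^ (h + r - K - 1) = (-1) ^ (h + r - 1) * (-1) ^ K"
      by (simp add: diff_commute)
    then show "of_nat ((h - 1) choose K) * ((-1) ^ (h + r - K - 1) / of_nat (h + r - K))
      = (-1) ^ (h + r - 1) * (of_nat ((h - 1) choose K) * ((-1) ^ K / (of_nat (h + r) - of_nat K)) :: rat)"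
      using K by (simp add: of_nat_diff)
  qed simp
  also have "(\<Sum>K\<le>h - 1. of_nat ((h - 1) choose K) * ((-1) ^ K / (of_nat (h + r) - of_nat K)) :: rat)
     = (-1) ^ (h - 1) / (of_nat (Suc (h - 1)) * (of_nat (h + r) gchoose Suc (h - 1)))"
    using h_pos by (intro sum_choose_recip) (subst of_nat_eq_iff, linarith)
  also have "Suc (h - 1) = h" using h_pos by simp
  finally have "cg 1 (of_nat h * of_nat (conv (h + r))) (of_nat h * ((-1) ^ (h + r - 1) * ((-1) ^ (h - 1) / (of_nat h * (of_nat (h + r) gchoose h)))))"
    by (intro cg_mult_left) auto
  also have "of_nat h * ((-1) ^ (h + r - 1) * ((-1) ^ (h - 1) / (of_nat h * (of_nat (h + r) gchoose h)))) = (-1) ^ r / (of_nat ((h + r) choose h) :: rat)"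
  proof -
    have "h + r - 1 + (h - 1) = 2 * (h - 1) + r" using h_pos by linarith
    then have "(-1 :: rat) ^ (h + r - 1) * (-1) ^ (h - 1) = (-1) ^ (2 * (h - 1) + r)"
      by (simp only: power_add[symmetric])
    then have "(-1 :: rat) ^ (h + r - 1) * (-1) ^ (h - 1) = (-1) ^ r" by (simp add: power_add)
    then show ?thesis using h_pos by (simp add: binomial_gbinomial)
  qed
  also have "cg 1 \<dots> (1 / of_nat (h choose r))"
  proof -
    have u: "unit (of_nat (h choose r))" "unit (of_nat ((h + r) choose h))"
      using assms hr h_less_p by (auto intro!: unit_choose)
    have "cg 1 ((-1) ^ r * of_nat (h choose r) * (1 / of_nat (h choose r))) (of_nat ((h + r) choose h) * (1 / of_nat (h choose r)))"
      using choose_upper_reflect[OF assms] u by (intro cg_mult cg_sym[OF choose_upper_reflect] cg_refl assms) (simp add: unit_def)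
    from cg_divide_unit[OF u(2) this] show ?thesis
      using u by (simp add: unit_def)
  qed
  finally show ?thesis .
qed

end

section \<open>Power sums over roots of unity modulo \<open>p\<^sup>2\<close>\<close>

lemma power_add_mult_mod_square:
  fixes a b c :: "'a::comm_ring_1"
  shows "\<exists>r. (a + c * b) ^ n = a ^ n + c * of_nat n * a ^ (n - 1) * b + c ^ 2 * r"
proof (induction n)
  case 0
  show ?case by (rule exI[of _ 0]) simp
next
  case (Suc n)
  then obtain r where r: "(a + c * b) ^ n = a ^ n + c * of_nat n * a ^ (n - 1) * b + c ^ 2 * r" ..
  have *: "of_nat n * a ^ (n - 1) * a = of_nat n * a ^ n" by (cases n) (auto simp: mult_ac)
  have "(a + c * b) ^ Suc n = (a + c * b) * (a ^ n + c * of_nat n * a ^ (n - 1) * b + c ^ 2 * r)"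
    by (simp add: r)
  also have "\<dots> = a ^ Suc n + c * (of_nat n * a ^ (n - 1) * a + a ^ n) * b
      + c ^ 2 * (a * r + of_nat n * a ^ (n - 1) * b ^ 2 + c * b * r)"
    by (simp add: power2_eq_square algebra_simps)
  also have "\<dots> = a ^ Suc n + c * of_nat (Suc n) * a ^ (Suc n - 1) * b
      + c ^ 2 * (a * r + of_nat n * a ^ (n - 1) * b ^ 2 + c * b * r)"
    unfolding * by (simp add: algebra_simps)
  finally show ?case by blast
qed

lemma geometric_sum_dvd: "(z - 1) * (\<Sum>i<n. z ^ i) = z ^ n - (1 :: 'a::comm_ring_1)"
  by (simp add: power_diff_1_eq)

context odd_prime
begin

lemma one_plus_power_p:
  fixes y :: "'a::comm_ring_1"
  shows "(1 + y) ^ p = 1 + y ^ p + of_nat p * (\<Sum>r\<in>{1..<p}. of_nat (qbin r) * y ^ r)"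
proof -
  have "(y + 1) ^ p = (\<Sum>k\<le>p. of_nat (p choose k) * y ^ k)"
    by (simp add: binomial_ring)
  also have "{..p} = insert 0 (insert p {1..<p})" using p_gt_2 by auto
  also have "(\<Sum>k\<in>insert 0 (insert p {1..<p}). of_nat (p choose k) * y ^ k)
      = 1 + (y ^ p + (\<Sum>k\<in>{1..<p}. of_nat (p choose k) * y ^ k))"
    using p_gt_2 by (subst sum.insert; simp)+
  also have "(\<Sum>k\<in>{1..<p}. of_nat (p choose k) * y ^ k) = of_nat p * (\<Sum>r\<in>{1..<p}. of_nat (qbin r) * y ^ r)"
    unfolding sum_distrib_left
    by (rule sum.cong) (simp_all add: qbin mult.assoc)
  finally show ?thesis by (simp add: add_ac)
qed

lemma power_p_cong:
  fixes x y :: "'a::comm_ring_1"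
  assumes "of_nat p dvd x - y" shows "of_nat (p ^ 2) dvd x ^ p - y ^ p"
proof -
  obtain b where b: "x = y + of_nat p * b" using assms by (auto simp: dvd_def algebra_simps)
  obtain r where "(y + of_nat p * b) ^ p = y ^ p + of_nat p * of_nat p * y ^ (p - 1) * b + (of_nat p) ^ 2 * r"
    using power_add_mult_mod_square by blast
  then have "x ^ p - y ^ p = of_nat (p ^ 2) * (y ^ (p - 1) * b + r)"
    unfolding b by (simp add: power2_eq_square algebra_simps)
  then show ?thesis by simp
qed

lemma one_plus_power_ph:
  fixes y :: "'a::comm_ring_1"
  shows "\<exists>r. (1 + y) ^ (p * h) = (\<Sum>l\<le>h. of_nat (h choose l) * y ^ (p * l))
     + of_nat (p * h) * (\<Sum>K<h. \<Sum>R\<in>{1..<p}. of_nat (((h - 1) choose K) * qbin R) * y ^ (p * K + R))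
     + of_nat (p ^ 2) * r"
proof -
  let ?w = "\<Sum>r\<in>{1..<p}. of_nat (qbin r) * y ^ r"
  obtain r where r: "((1 + y ^ p) + of_nat p * ?w) ^ h
      = (1 + y ^ p) ^ h + of_nat p * of_nat h * (1 + y ^ p) ^ (h - 1) * ?w + (of_nat p) ^ 2 * r"
    using power_add_mult_mod_square by blast
  have bin: "(1 + y ^ p) ^ n = (\<Sum>l\<le>n. of_nat (n choose l) * y ^ (p * l))" for n
    using binomial_ring[of "y ^ p" 1 n] by (simp add: add.commute flip: power_mult)
  have "{..h - 1} = {..<h}" using h_pos by auto
  then have "(1 + y ^ p) ^ (h - 1) * ?w = (\<Sum>K<h. \<Sum>R\<in>{1..<p}. of_nat (((h - 1) choose K) * qbin R) * y ^ (p * K + R))"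
    unfolding bin sum_product by (simp add: power_add mult_ac)
  then have "(1 + y) ^ (p * h) = (\<Sum>l\<le>h. of_nat (h choose l) * y ^ (p * l))
     + of_nat (p * h) * (\<Sum>K<h. \<Sum>R\<in>{1..<p}. of_nat (((h - 1) choose K) * qbin R) * y ^ (p * K + R)) + of_nat (p ^ 2) * r"
    using r by (simp add: power_mult one_plus_power_p bin[of h] mult.assoc)
  then show ?thesis by blast
qed

text \<open>Summing \<open>z^b (1 + z^n)^(p h)\<close> over a cyclic group of \<open>N\<close>-th roots of unity modulo \<open>p^2\<close>
  picks out the exponents divisible by \<open>N\<close>.\<close>
lemma torus_sum:
  fixes \<zeta> :: "'a::comm_ring_1"
  assumes Z: "\<And>j. of_nat (p ^ 2) dvd (\<Sum>i<N. \<zeta> ^ (j * i)) - of_nat (if N dvd j then N else 0)"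
  shows "of_nat (p ^ 2) dvd (\<Sum>i<N. \<zeta> ^ (b * i) * (1 + \<zeta> ^ (n * i)) ^ (p * h))
     - of_nat (N * ((\<Sum>l\<le>h. if N dvd b + n * (p * l) then h choose l else 0)
        + p * h * (\<Sum>K<h. \<Sum>R\<in>{1..<p}. if N dvd b + n * (p * K + R) then ((h - 1) choose K) * qbin R else 0)))"
proof -
  let ?Z = "\<lambda>j. \<Sum>i<N. \<zeta> ^ (j * i)" and ?E = "\<lambda>j. of_nat (if N dvd j then N else 0) :: 'a"
  let ?c = "\<lambda>K R. of_nat (((h - 1) choose K) * qbin R) :: 'a"
  have "\<exists>r. \<forall>i. (1 + \<zeta> ^ (n * i)) ^ (p * h) = (\<Sum>l\<le>h. of_nat (h choose l) * (\<zeta> ^ (n * i)) ^ (p * l))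
     + of_nat (p * h) * (\<Sum>K<h. \<Sum>R\<in>{1..<p}. ?c K R * (\<zeta> ^ (n * i)) ^ (p * K + R))
     + of_nat (p ^ 2) * r i"
    by (intro choice allI one_plus_power_ph)
  then obtain r where r: "\<And>i. (1 + \<zeta> ^ (n * i)) ^ (p * h) = (\<Sum>l\<le>h. of_nat (h choose l) * (\<zeta> ^ (n * i)) ^ (p * l))
     + of_nat (p * h) * (\<Sum>K<h. \<Sum>R\<in>{1..<p}. ?c K R * (\<zeta> ^ (n * i)) ^ (p * K + R))
     + of_nat (p ^ 2) * r i" by blast
  have e: "\<zeta> ^ (b * i) * (\<zeta> ^ (n * i)) ^ m = \<zeta> ^ ((b + n * m) * i)" for i m
    by (simp add: algebra_simps flip: power_mult power_add)
  have "\<zeta> ^ (b * i) * (1 + \<zeta> ^ (n * i)) ^ (p * h) = (\<Sum>l\<le>h. of_nat (h choose l) * \<zeta> ^ ((b + n * (p * l)) * i))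
     + of_nat (p * h) * (\<Sum>K<h. \<Sum>R\<in>{1..<p}. ?c K R * \<zeta> ^ ((b + n * (p * K + R)) * i))
     + of_nat (p ^ 2) * (\<zeta> ^ (b * i) * r i)" for i
    unfolding r distrib_left sum_distrib_left mult.left_commute[of "\<zeta> ^ (b * i)"] e ..
  then have "(\<Sum>i<N. \<zeta> ^ (b * i) * (1 + \<zeta> ^ (n * i)) ^ (p * h))
    = (\<Sum>i<N. \<Sum>l\<le>h. of_nat (h choose l) * \<zeta> ^ ((b + n * (p * l)) * i))
     + of_nat (p * h) * (\<Sum>i<N. \<Sum>K<h. \<Sum>R\<in>{1..<p}. ?c K R * \<zeta> ^ ((b + n * (p * K + R)) * i))
     + of_nat (p ^ 2) * (\<Sum>i<N. \<zeta> ^ (b * i) * r i)"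
    by (simp add: sum.distrib sum_distrib_left)
  also have "(\<Sum>i<N. \<Sum>l\<le>h. of_nat (h choose l) * \<zeta> ^ ((b + n * (p * l)) * i))
     = (\<Sum>l\<le>h. of_nat (h choose l) * ?Z (b + n * (p * l)))"
    unfolding sum_distrib_left by (rule sum.swap)
  also have "(\<Sum>i<N. \<Sum>K<h. \<Sum>R\<in>{1..<p}. ?c K R * \<zeta> ^ ((b + n * (p * K + R)) * i))
     = (\<Sum>K<h. \<Sum>R\<in>{1..<p}. ?c K R * ?Z (b + n * (p * K + R)))"
    unfolding sum_distrib_left
    by (subst sum.swap, rule sum.cong[OF refl], rule sum.swap)
  finally have T: "(\<Sum>i<N. \<zeta> ^ (b * i) * (1 + \<zeta> ^ (n * i)) ^ (p * h)) = (\<Sum>l\<le>h. of_nat (h choose l) * ?Z (b + n * (p * l)))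
     + of_nat (p * h) * (\<Sum>K<h. \<Sum>R\<in>{1..<p}. ?c K R * ?Z (b + n * (p * K + R)))
     + of_nat (p ^ 2) * (\<Sum>i<N. \<zeta> ^ (b * i) * r i)" .
  have E: "of_nat (N * ((\<Sum>l\<le>h. if N dvd b + n * (p * l) then h choose l else 0)
        + p * h * (\<Sum>K<h. \<Sum>R\<in>{1..<p}. if N dvd b + n * (p * K + R) then ((h - 1) choose K) * qbin R else 0)))
    = (\<Sum>l\<le>h. of_nat (h choose l) * ?E (b + n * (p * l)))
     + of_nat (p * h) * (\<Sum>K<h. \<Sum>R\<in>{1..<p}. ?c K R * ?E (b + n * (p * K + R)))"
  proof -
    have "N * (\<Sum>l\<le>h. if N dvd b + n * (p * l) then h choose l else 0) = (\<Sum>l\<le>h. (h choose l) * (if N dvd b + n * (p * l) then N else 0))"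
      unfolding sum_distrib_left by (rule sum.cong) auto
    moreover have "N * (\<Sum>K<h. \<Sum>R\<in>{1..<p}. if N dvd b + n * (p * K + R) then ((h - 1) choose K) * qbin R else 0)
       = (\<Sum>K<h. \<Sum>R\<in>{1..<p}. ((h - 1) choose K) * qbin R * (if N dvd b + n * (p * K + R) then N else 0))"
      unfolding sum_distrib_left by (intro sum.cong) auto
    ultimately show ?thesis
      by (simp only: distrib_left mult.left_commute[of N] of_nat_add of_nat_mult of_nat_sum)
  qed
  have d1: "of_nat (p ^ 2) dvd (\<Sum>l\<le>h. of_nat (h choose l) * (?Z (b + n * (p * l)) - ?E (b + n * (p * l))))"
    by (intro dvd_sum dvd_mult Z)
  note d1 = d1[unfolded right_diff_distrib sum_subtractf]
  have d2: "of_nat (p ^ 2) dvd (\<Sum>K<h. \<Sum>R\<in>{1..<p}. ?c K R * (?Z (b + n * (p * K + R)) - ?E (b + n * (p * K + R))))"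
    by (intro dvd_sum dvd_mult Z)
  note d2 = d2[unfolded right_diff_distrib sum_subtractf]
  have eq: "(a + m * c + e) - (a' + m * c') = (a - a') + m * (c - c') + e" for a a' c c' m e :: 'a
    by (simp add: algebra_simps)
  show ?thesis unfolding T E eq
    by (intro dvd_add d1 dvd_mult[OF d2] dvd_triv_left)
qed

lemma conv_total:
  "(\<Sum>K<h. \<Sum>R\<in>{1..<p}. if Q (K + R) then ((h - 1) choose K) * qbin R else 0) = (\<Sum>k | k < h + p \<and> Q k. conv k)"
proof -
  let ?f = "\<lambda>K R. ((h - 1) choose K) * qbin R"
  have "(\<Sum>R\<in>{1..<p}. if Q (K + R) then ?f K R else 0)
      = (\<Sum>k | k < h + p \<and> Q k. if K < k \<and> k - K < p then ?f K (k - K) else 0)" if "K < h" for K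
  proof -
    have "(\<Sum>R\<in>{1..<p}. if Q (K + R) then ?f K R else 0) = (\<Sum>R\<in>{R\<in>{1..<p}. Q (K + R)}. ?f K R)"
      by (rule sum.inter_filter[symmetric]) simp
    also have "\<dots> = (\<Sum>k\<in>{k\<in>{k. k < h + p \<and> Q k}. K < k \<and> k - K < p}. ?f K (k - K))"
      using that by (intro sum.reindex_bij_witness[of _ "\<lambda>k. k - K" "\<lambda>R. K + R"]) auto
    also have "\<dots> = (\<Sum>k | k < h + p \<and> Q k. if K < k \<and> k - K < p then ?f K (k - K) else 0)"
      by (rule sum.inter_filter) simp
    finally show ?thesis .
  qed
  then have "(\<Sum>K<h. \<Sum>R\<in>{1..<p}. if Q (K + R) then ?f K R else 0)
     = (\<Sum>K<h. \<Sum>k | k < h + p \<and> Q k. if K < k \<and> k - K < p then ?f K (k - K) else 0)"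
    by simp
  then show ?thesis unfolding conv_def by (simp only: sum.swap[of _ "{..<h}"])
qed

definition leg :: "int \<Rightarrow> int" where
  "leg a = Legendre a (int p)"

lemma leg_cong: "[a = b] (mod int p) \<Longrightarrow> leg a = leg b"
  by (simp add: leg_def Legendre_def QuadRes_def cong_def)

lemma leg_eq_0_iff: "leg a = 0 \<longleftrightarrow> int p dvd a"
  by (simp add: leg_def Legendre_def cong_0_iff)

lemma leg_cases: "leg a = 0 \<or> leg a = 1 \<or> leg a = -1"
  by (simp add: leg_def Legendre_def)

lemma leg_square: "\<not> int p dvd a \<Longrightarrow> leg a * leg a = 1"
  using leg_cases[of a] leg_eq_0_iff[of a] by auto

lemma leg_euler: "[leg a = a ^ h] (mod int p)"
proof -
  have "[leg a = a ^ ((p - 1) div 2)] (mod int p)"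
    unfolding leg_def using euler_criterion[OF prime_p p_gt_2] by simp
  then show ?thesis by (simp add: h_def)
qed

lemma leg_unique:
  assumes "[x = y] (mod int p)" "x \<in> {-1, 0, 1}" "y \<in> {-1, 0, 1}" shows "x = y"
proof -
  have "int p dvd x - y" using assms(1) by (simp add: cong_iff_dvd_diff)
  then have "x - y = 0 \<or> int p \<le> \<bar>x - y\<bar>" using dvd_imp_le_int[of "x - y" "int p"] by auto
  moreover have "\<bar>x - y\<bar> \<le> 2" using assms by auto
  ultimately show ?thesis using p_gt_2 by linarith
qed

lemma leg_mult: "leg (a * b) = leg a * leg b"
proof (rule leg_unique)
  have "[leg (a * b) = (a * b) ^ h] (mod int p)" by (rule leg_euler)
  also have "(a * b) ^ h = a ^ h * b ^ h" by (rule power_mult_distrib)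
  also have "[\<dots> = leg a * leg b] (mod int p)" by (intro cong_mult cong_sym[OF leg_euler])
  finally show "[leg (a * b) = leg a * leg b] (mod int p)" .
  show "leg (a * b) \<in> {-1, 0, 1}" using leg_cases by blast
  show "leg a * leg b \<in> {-1, 0, 1}" using leg_cases[of a] leg_cases[of b] by auto
qed

lemma leg_1 [simp]: "leg 1 = 1"
proof -
  have "leg 1 * leg 1 = leg 1" using leg_mult[of 1 1] by simp
  moreover have "leg 1 \<noteq> 0" using prime_p by (auto simp: leg_eq_0_iff)
  ultimately show ?thesis by simp
qed

lemma leg_power: "leg (a ^ n) = leg a ^ n"
  by (induction n) (auto simp: leg_mult)

lemma leg_0 [simp]: "leg 0 = 0" by (simp add: leg_eq_0_iff)

lemma leg_mod_p2: "[leg a = a ^ (p * h)] (mod int p ^ 2)"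
proof -
  have "int p dvd a ^ h - leg a" using leg_euler[of a] by (metis cong_iff_dvd_diff cong_sym)
  then have "int (p ^ 2) dvd (a ^ h) ^ p - leg a ^ p" using power_p_cong[where ?'a = int] by simp
  moreover have "leg a ^ p = leg a" using leg_cases[of a] odd_p p_gt_2 by auto
  ultimately have "[a ^ (p * h) = leg a] (mod int p ^ 2)"
    by (simp add: cong_iff_dvd_diff mult.commute flip: power_mult)
  then show ?thesis by (rule cong_sym)
qed

lemma sum_affine:
  fixes f :: "int \<Rightarrow> 'b::comm_monoid_add"
  assumes f: "\<And>x y. [x = y] (mod int p) \<Longrightarrow> f x = f y" and a: "\<not> int p dvd a"
  shows "(\<Sum>x\<in>{0..<int p}. f (a * x + b)) = (\<Sum>x\<in>{0..<int p}. f x)"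
proof -
  let ?g = "\<lambda>x. (a * x + b) mod int p"
  have cop: "coprime a (int p)" using a prime_p by (metis coprime_commute prime_imp_coprime prime_nat_int_transfer)
  have pos: "int p > 0" using p_gt_2 by simp
  have inj: "inj_on ?g {0..<int p}"
  proof (rule inj_onI)
    fix x y assume xy: "x \<in> {0..<int p}" "y \<in> {0..<int p}" "?g x = ?g y"
    then have "[a * x + b = a * y + b] (mod int p)" by (simp add: cong_def)
    then have "[a * x = a * y] (mod int p)" by (simp add: cong_add_rcancel)
    then have "[x = y] (mod int p)" using cop by (simp add: cong_mult_lcancel)
    then show "x = y" using xy by (simp add: cong_def)
  qed
  have "?g ` {0..<int p} = {0..<int p}"
    using inj pos by (intro card_subset_eq) (auto simp: card_image)
  then have "(\<Sum>x\<in>{0..<int p}. f x) = (\<Sum>x\<in>{0..<int p}. f (?g x))"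
    using sum.reindex[OF inj, of f] by simp
  also have "\<dots> = (\<Sum>x\<in>{0..<int p}. f (a * x + b))"
    by (intro sum.cong refl f) (simp add: cong_def)
  finally show ?thesis by simp
qed

definition pr :: int where
  "pr = int (SOME g. residue_primroot p g)"

lemma primroot: obtains g where "pr = int g" "residue_primroot p g"
proof -
  have "\<exists>g. residue_primroot p g"
    using prime_primitive_root_exists[of p] prime_p p_gt_2 by auto
  then have "residue_primroot p (SOME g. residue_primroot p g)" by (rule someI_ex)
  then show ?thesis using that unfolding pr_def by blast
qed

lemma pr_not_dvd: "\<not> int p dvd pr"
proof -
  obtain g where g: "pr = int g" "residue_primroot p g" by (rule primroot)
  then have "coprime p g" by (simp add: residue_primroot_def)
  then show ?thesis using g(1) prime_p by (metis coprime_absorb_left int_dvd_int_iff not_prime_unit)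
qed

lemma pr_power_cong_1_iff: "[pr ^ n = 1] (mod int p) \<longleftrightarrow> (p - 1) dvd n"
proof -
  obtain g where g: "pr = int g" "residue_primroot p g" by (rule primroot)
  then have o: "ord p g = p - 1" using prime_p by (simp add: residue_primroot_def totient_prime)
  have "[pr ^ n = 1] (mod int p) \<longleftrightarrow> [g ^ n = 1] (mod p)"
    unfolding g(1) using cong_int_iff[of "g ^ n" 1 p] by simp
  then show ?thesis using ord_divides[of g n p] o by simp
qed

lemma sum_units_primroot:
  fixes f :: "int \<Rightarrow> 'b::comm_monoid_add"
  assumes f: "\<And>x y. [x = y] (mod int p) \<Longrightarrow> f x = f y"
  shows "(\<Sum>x\<in>{1..<int p}. f x) = (\<Sum>i<p - 1. f (pr ^ i))"
proof -
  let ?g = "\<lambda>i. pr ^ i mod int p"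
  have inj: "inj_on ?g {..<p - 1}"
  proof (rule linorder_inj_onI')
    fix i j assume ij: "i \<in> {..<p - 1}" "j \<in> {..<p - 1}" "i < j"
    have "\<not> [pr ^ i = pr ^ j] (mod int p)"
    proof
      assume "[pr ^ i = pr ^ j] (mod int p)"
      then have "[pr ^ i * 1 = pr ^ i * pr ^ (j - i)] (mod int p)" using ij by (simp flip: power_add)
      moreover have "coprime (pr ^ i) (int p)"
        using pr_not_dvd prime_p by (metis coprime_commute coprime_power_left_iff prime_imp_coprime prime_nat_int_transfer)
      ultimately have "[pr ^ (j - i) = 1] (mod int p)" by (metis cong_mult_lcancel cong_sym)
      then have "(p - 1) dvd (j - i)" by (simp add: pr_power_cong_1_iff)
      then show False using ij by (auto dest: dvd_imp_le)
    qed
    then show "?g i \<noteq> ?g j" by (simp add: cong_def)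
  qed
  have "\<not> int p dvd pr ^ i" for i using pr_not_dvd prime_p by (metis prime_dvd_power prime_nat_int_transfer)
  then have nz: "?g i \<noteq> 0" for i by (simp add: dvd_eq_mod_eq_0)
  have sub: "?g ` {..<p - 1} \<subseteq> {1..<int p}"
  proof (rule image_subsetI)
    fix i
    have "0 \<le> ?g i" "?g i < int p" using p_gt_2 by (intro pos_mod_sign pos_mod_bound; simp)+
    then show "?g i \<in> {1..<int p}" using nz[of i] by auto
  qed
  have "?g ` {..<p - 1} = {1..<int p}"
    using inj sub p_gt_2 by (intro card_subset_eq) (auto simp: card_image nat_diff_distrib)
  then have "(\<Sum>x\<in>{1..<int p}. f x) = (\<Sum>i<p - 1. f (?g i))"
    using sum.reindex[OF inj, of f] by simp
  also have "\<dots> = (\<Sum>i<p - 1. f (pr ^ i))"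
    by (intro sum.cong refl f) (simp add: cong_def)
  finally show ?thesis .
qed

lemma leg_pr: "leg pr = -1"
proof -
  have "\<not> (p - 1) dvd h" using h_pos p_eq by (auto dest: dvd_imp_le)
  then have "\<not> [leg pr = 1] (mod int p)"
    using leg_euler[of pr] pr_power_cong_1_iff[of h] by (metis cong_sym cong_trans)
  then show ?thesis using leg_cases[of pr] leg_eq_0_iff[of pr] pr_not_dvd by auto
qed

lemma pr_teich:
  "of_nat (p ^ 2) dvd (\<Sum>i<p - 1. (pr ^ p) ^ (j * i)) - of_nat (if (p - 1) dvd j then p - 1 else 0 :: nat)"
proof -
  let ?z = "(pr ^ p) ^ j"
  have pw: "(\<Sum>i<p - 1. (pr ^ p) ^ (j * i)) = (\<Sum>i<p - 1. ?z ^ i)" by (simp add: power_mult)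
  have "int p dvd pr ^ (p - 1) - 1" using pr_power_cong_1_iff[of "p - 1"] by (simp add: cong_iff_dvd_diff)
  then have "int (p ^ 2) dvd (pr ^ (p - 1)) ^ p - 1" using power_p_cong[of "pr ^ (p - 1)" 1] by simp
  then have one: "[(pr ^ p) ^ (p - 1) = 1] (mod int (p ^ 2))"
    by (simp add: cong_iff_dvd_diff mult.commute flip: power_mult)
  show ?thesis
  proof (cases "(p - 1) dvd j")
    case True
    then obtain k where "j = (p - 1) * k" ..
    then have "[?z = 1] (mod int (p ^ 2))" using cong_pow[OF one, of k] by (simp add: power_mult)
    then have "[?z ^ i = 1] (mod int (p ^ 2))" for i using cong_pow[of ?z 1 _ i] by simp
    then have "[(\<Sum>i<p - 1. ?z ^ i) = (\<Sum>i<p - 1. 1)] (mod int (p ^ 2))" by (intro cong_sum) auto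
    then show ?thesis using True unfolding pw by (simp add: cong_iff_dvd_diff)
  next
    case False
    have "[?z ^ (p - 1) = 1] (mod int (p ^ 2))"
      using cong_pow[OF one, of j] by (simp add: mult_ac flip: power_mult)
    then have d: "int (p ^ 2) dvd (?z - 1) * (\<Sum>i<p - 1. ?z ^ i)"
      by (simp add: geometric_sum_dvd cong_iff_dvd_diff)
    have "\<not> (p - 1) dvd p * j"
    proof
      assume "(p - 1) dvd p * j"
      moreover have "coprime (p - 1) p" using p_gt_2 by (intro coprime_diff_one_left_nat) simp
      ultimately show False using False by (simp add: coprime_dvd_mult_right_iff)
    qed
    then have "\<not> int p dvd ?z - 1" using pr_power_cong_1_iff[of "p * j"] by (simp add: cong_iff_dvd_diff power_mult)
    then have "coprime (int (p ^ 2)) (?z - 1)"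
      using prime_p by (simp add: prime_imp_coprime)
    then show ?thesis using d False unfolding pw by (simp add: coprime_dvd_mult_right_iff)
  qed
qed

definition split_sum :: "nat \<Rightarrow> nat \<Rightarrow> int \<Rightarrow> int" where
  "split_sum s n c = (\<Sum>z\<in>{1..<int p}. leg z ^ s * leg (z ^ n + c))"

lemma split_sum_cong:
  "[split_sum s n 1 = (int p - 1) * (int (\<Sum>l | l \<le> h \<and> (p - 1) dvd h * s + n * l. h choose l)
      + int p * int h * int (\<Sum>k | k < h + p \<and> (p - 1) dvd h * s + n * k. conv k))] (mod int p ^ 2)"
proof -
  let ?z = "pr ^ p" and ?N = "p - 1"
  have fz: "[pr = ?z] (mod int p)"
  proof -
    have "[pr ^ (p - 1) * pr = 1 * pr] (mod int p)" using pr_power_cong_1_iff[of "p - 1"] by (intro cong_mult) auto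
    moreover have "pr ^ (p - 1) * pr = ?z" using p_gt_2 by (metis power_minus_mult p_nz neq0_conv)
    ultimately show ?thesis by (simp add: cong_sym)
  qed
  have dv: "?N dvd h * s + n * (p * K + R) \<longleftrightarrow> ?N dvd h * s + n * (K + R)" for K R
  proof -
    have "p * K = K + ?N * K" using p_gt_2 by (simp add: algebra_simps)
    moreover have "h * s + n * (K + m * K + R) = (h * s + n * (K + R)) + m * (n * K)" for m
      by (simp add: algebra_simps)
    ultimately have "h * s + n * (p * K + R) = (h * s + n * (K + R)) + ?N * (n * K)" by simp
    then show ?thesis by (simp only: dvd_add_left_iff[OF dvd_triv_left])
  qed
  have dv0: "?N dvd h * s + n * (p * l) \<longleftrightarrow> ?N dvd h * s + n * l" for l
    using dv[of l 0] by (simp only: add_0_right)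
  have "split_sum s n 1 = (\<Sum>i<p - 1. leg (pr ^ i) ^ s * leg ((pr ^ i) ^ n + 1))"
    unfolding split_sum_def
  proof (rule sum_units_primroot)
    fix x y assume "[x = y] (mod int p)"
    moreover from this have "[x ^ n + 1 = y ^ n + 1] (mod int p)" by (intro cong_add cong_pow) auto
    ultimately show "leg x ^ s * leg (x ^ n + 1) = leg y ^ s * leg (y ^ n + 1)"
      using leg_cong by metis
  qed
  also have "\<dots> = (\<Sum>i<p - 1. leg ?z ^ (s * i) * leg (1 + ?z ^ (n * i)))"
  proof (rule sum.cong)
    fix i assume "i \<in> {..<p - 1}"
    have "[(pr ^ i) ^ n + 1 = 1 + ?z ^ (n * i)] (mod int p)"
      using cong_add[OF cong_pow[OF fz, of "n * i"] cong_refl, of 1]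
      by (simp add: add.commute mult.commute flip: power_mult)
    then have "leg ((pr ^ i) ^ n + 1) = leg (1 + ?z ^ (n * i))" by (rule leg_cong)
    moreover have "leg (pr ^ i) ^ s = leg ?z ^ (s * i)"
      using leg_cong[OF fz] by (simp add: leg_power mult.commute flip: power_mult)
    ultimately show "leg (pr ^ i) ^ s * leg ((pr ^ i) ^ n + 1) = leg ?z ^ (s * i) * leg (1 + ?z ^ (n * i))" by simp
  qed simp
  finally have 1: "split_sum s n 1 = (\<Sum>i<p - 1. leg ?z ^ (s * i) * leg (1 + ?z ^ (n * i)))" .
  have 2: "[(\<Sum>i<p - 1. leg ?z ^ (s * i) * leg (1 + ?z ^ (n * i)))
      = (\<Sum>i<p - 1. ?z ^ (h * s * i) * (1 + ?z ^ (n * i)) ^ (p * h))] (mod int p ^ 2)"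
  proof (intro cong_sum cong_mult leg_mod_p2)
    fix i assume "i \<in> {..<p - 1}"
    have "int (p ^ 2) dvd (pr ^ (h * p)) ^ p - (pr ^ h) ^ p"
    proof (rule power_p_cong)
      have "[?z ^ h = pr ^ h] (mod int p)" using cong_pow[OF fz, of h] by (rule cong_sym)
      then show "int p dvd pr ^ (h * p) - pr ^ h" by (simp add: cong_iff_dvd_diff mult.commute flip: power_mult)
    qed
    then have "[?z ^ (p * h) = ?z ^ h] (mod int p ^ 2)"
      by (simp add: cong_iff_dvd_diff mult_ac flip: power_mult)
    with leg_mod_p2[of ?z] have "[leg ?z = ?z ^ h] (mod int p ^ 2)" by (rule cong_trans)
    from cong_pow[OF this, of "s * i"] show "[leg ?z ^ (s * i) = ?z ^ (h * s * i)] (mod int p ^ 2)"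
      by (simp add: mult_ac flip: power_mult)
  qed
  have 3: "[(\<Sum>i<p - 1. ?z ^ (h * s * i) * (1 + ?z ^ (n * i)) ^ (p * h)) =
     int (?N * ((\<Sum>l\<le>h. if ?N dvd h * s + n * (p * l) then h choose l else 0)
        + p * h * (\<Sum>K<h. \<Sum>R\<in>{1..<p}. if ?N dvd h * s + n * (p * K + R) then ((h - 1) choose K) * qbin R else 0)))] (mod int p ^ 2)"
    using torus_sum[where N = ?N and \<zeta> = ?z and b = "h * s" and n = n, OF pr_teich]
    by (simp only: cong_iff_dvd_diff of_nat_power)
  have 4: "(\<Sum>K<h. \<Sum>R\<in>{1..<p}. if ?N dvd h * s + n * (p * K + R) then ((h - 1) choose K) * qbin R else 0)
      = (\<Sum>k | k < h + p \<and> ?N dvd h * s + n * k. conv k)"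
    unfolding dv by (rule conv_total)
  have 5: "(\<Sum>l\<le>h. if ?N dvd h * s + n * (p * l) then h choose l else 0) = (\<Sum>l | l \<le> h \<and> ?N dvd h * s + n * l. h choose l)"
    unfolding dv0 by (subst sum.inter_filter[symmetric]) (auto intro: sum.cong)
  have 6: "int (?N * (a + p * h * b)) = (int p - 1) * (int a + int p * int h * int b)" for a b
    using p_gt_2 by (simp add: of_nat_diff)
  show ?thesis using cong_trans[OF 2 3] unfolding 1[symmetric] 4 5 6 .
qed

end

section \<open>Orthogonality and binary quadratic forms\<close>

lemma sum_periodic:
  fixes f :: "nat \<Rightarrow> int"
  assumes "\<And>j. f (j + n) = f j"
  shows "(\<Sum>j<m * n. f j) = int m * (\<Sum>j<n. f j)"
proof -
  have per: "f (j + k * n) = f j" for j k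
  proof (induction k)
    case (Suc k)
    have "f (j + Suc k * n) = f ((j + k * n) + n)" by (simp add: algebra_simps)
    then show ?case using assms Suc by simp
  qed simp
  show ?thesis
  proof (induction m)
    case (Suc m)
    have "{..<Suc m * n} = {..<m * n} \<union> {m * n..<m * n + n}" by auto
    then have "(\<Sum>j<Suc m * n. f j) = (\<Sum>j<m * n. f j) + (\<Sum>j\<in>{m * n..<m * n + n}. f j)"
      by (simp add: sum.union_disjoint[symmetric] ivl_disj_int)
    also have "(\<Sum>j\<in>{m * n..<m * n + n}. f j) = (\<Sum>j<n. f (j + m * n))"
      using sum.shift_bounds_nat_ivl[of f 0 "m * n" n] by (simp add: atLeast0LessThan add.commute)
    finally show ?case using Suc per by (simp add: algebra_simps)
  qed simp
qed

lemma representation_unique: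
  fixes a b c d n :: int
  assumes p: "prime p" and n: "n \<ge> 2" and ab: "p = a ^ 2 + n * b ^ 2" and cd: "p = c ^ 2 + n * d ^ 2"
  shows "a ^ 2 = c ^ 2"
proof -
  have key: "a ^ 2 = c ^ 2" if "p dvd a * d - b * c" "p = a ^ 2 + n * b ^ 2" "p = c ^ 2 + n * d ^ 2" for a b c d :: int
  proof -
    have "p ^ 2 = (a ^ 2 + n * b ^ 2) * (c ^ 2 + n * d ^ 2)" using that by (simp add: power2_eq_square)
    also have "\<dots> = (a * c + n * b * d) ^ 2 + n * (a * d - b * c) ^ 2"
      by (simp add: power2_eq_square algebra_simps)
    finally have sq: "p ^ 2 = (a * c + n * b * d) ^ 2 + n * (a * d - b * c) ^ 2" .
    have pos: "p > 0" using p by (simp add: prime_gt_0_int)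
    have "a * d - b * c = 0"
    proof (rule ccontr)
      assume nz: "a * d - b * c \<noteq> 0"
      then have "p \<le> \<bar>a * d - b * c\<bar>" using that(1) pos dvd_imp_le_int[of "a * d - b * c" p] by simp
      then have "p ^ 2 \<le> (a * d - b * c) ^ 2" using pos by (metis abs_le_square_iff abs_of_pos)
      moreover have "p ^ 2 > 0" using pos by simp
      moreover have "n * (a * d - b * c) ^ 2 \<ge> 2 * (a * d - b * c) ^ 2" using n by (intro mult_right_mono) auto
      moreover have "(a * c + n * b * d) ^ 2 \<ge> 0" by simp
      ultimately show False using sq by linarith
    qed
    then have "a * d = b * c" by simp
    then have "a ^ 2 * d ^ 2 = b ^ 2 * c ^ 2" by (metis power_mult_distrib)
    moreover have "a ^ 2 = p - n * b ^ 2" "c ^ 2 = p - n * d ^ 2" using that by simp_all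
    ultimately have "(p - n * b ^ 2) * d ^ 2 = b ^ 2 * (p - n * d ^ 2)" by simp
    then have "p * (d ^ 2 - b ^ 2) = 0" by (simp add: algebra_simps)
    then show ?thesis using pos that by simp
  qed
  have "(a * d - b * c) * (a * d - b * - c) = a ^ 2 * d ^ 2 - b ^ 2 * c ^ 2"
    by (simp add: power2_eq_square algebra_simps)
  also have "a ^ 2 = p - n * b ^ 2" using ab by simp
  also have "c ^ 2 = p - n * d ^ 2" using cd by simp
  also have "(p - n * b ^ 2) * d ^ 2 - b ^ 2 * (p - n * d ^ 2) = p * (d ^ 2 - b ^ 2)"
    by (simp add: algebra_simps)
  finally have "p dvd (a * d - b * c) * (a * d - b * - c)" by simp
  then consider "p dvd a * d - b * c" | "p dvd a * d - b * - c" using p by (auto simp: prime_dvd_mult_iff)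
  then show ?thesis
  proof cases
    case 1
    then show ?thesis using key ab cd by blast
  next
    case 2
    then show ?thesis using key[of a d b "-c"] ab cd by simp
  qed
qed

lemma sixteen_p:
  fixes T W q :: int
  assumes "T ^ 2 + 2 * W ^ 2 = 16 * q"
  obtains t w where "T = 4 * t" "q = t ^ 2 + 2 * w ^ 2"
proof -
  have ev: "\<exists>b. a = 2 * b" if "a ^ 2 = 2 * k" for a k :: int
  proof -
    have "even (a ^ 2)" unfolding that by simp
    then show ?thesis by (auto elim: evenE)
  qed
  have "T ^ 2 = 2 * (8 * q - W ^ 2)" using assms by simp
  then obtain a where a: "T = 2 * a" using ev by blast
  have "W ^ 2 = 2 * (4 * q - a ^ 2)" using assms a by (simp add: power_mult_distrib)
  then obtain b where b: "W = 2 * b" using ev by blast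
  have "a ^ 2 = 2 * (2 * q - b ^ 2)" using assms a b by (simp add: power_mult_distrib)
  then obtain c where c: "a = 2 * c" using ev by blast
  have "b ^ 2 = 2 * (q - c ^ 2)" using assms a b c by (simp add: power_mult_distrib)
  then obtain d where d: "b = 2 * d" using ev by blast
  show ?thesis using assms a b c d by (intro that[of c d]) (simp_all add: power_mult_distrib)
qed

context odd_prime
begin

lemma residues_split: "{0..<int p} = insert 0 {1..<int p}"
  using p_gt_2 by auto

lemma sum_leg: "(\<Sum>x\<in>{0..<int p}. leg x) = 0"
proof -
  have "(\<Sum>x\<in>{0..<int p}. leg (pr * x + 0)) = (\<Sum>x\<in>{0..<int p}. leg x)"
    using pr_not_dvd by (intro sum_affine leg_cong)
  then have "- (\<Sum>x\<in>{0..<int p}. leg x) = (\<Sum>x\<in>{0..<int p}. leg x)"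
    by (simp add: leg_mult leg_pr sum_negf)
  then show ?thesis by simp
qed

lemma sum_leg_units: "(\<Sum>x\<in>{1..<int p}. leg x) = 0"
  using sum_leg by (simp add: residues_split)

lemma not_dvd_unit: "x \<in> {1..<int p} \<Longrightarrow> \<not> int p dvd x"
  by (auto dest: zdvd_imp_le)

lemma sum_units_scale:
  fixes f :: "int \<Rightarrow> int"
  assumes f: "\<And>x y. [x = y] (mod int p) \<Longrightarrow> f x = f y" and a: "\<not> int p dvd a"
  shows "(\<Sum>x\<in>{1..<int p}. f (a * x)) = (\<Sum>x\<in>{1..<int p}. f x)"
proof -
  have "(\<Sum>x\<in>{0..<int p}. f (a * x + 0)) = (\<Sum>x\<in>{0..<int p}. f x)"
    using assms by (rule sum_affine)
  then show ?thesis by (simp add: residues_split)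
qed

lemma unit_inverse_mod: assumes "\<not> int p dvd a" obtains b where "[a * b = 1] (mod int p)"
  using assms prime_p by (metis cong_solve_coprime_int coprime_commute prime_imp_coprime prime_nat_int_transfer)

lemma sum_units_inverse:
  fixes f :: "int \<Rightarrow> int"
  assumes f: "\<And>x y. [x = y] (mod int p) \<Longrightarrow> f x = f y"
    and inv: "\<And>x y. [x * y = 1] (mod int p) \<Longrightarrow> f x = g y"
    and g: "\<And>x y. [x = y] (mod int p) \<Longrightarrow> g x = g y"
  shows "(\<Sum>x\<in>{1..<int p}. f x) = (\<Sum>x\<in>{1..<int p}. g x)"
proof -
  let ?N = "p - 1"
  have one: "[pr ^ ?N = 1] (mod int p)" by (simp add: pr_power_cong_1_iff)
  have "(\<Sum>x\<in>{1..<int p}. f x) = (\<Sum>i<?N. f (pr ^ i))" by (intro sum_units_primroot f)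
  also have "\<dots> = (\<Sum>i<?N. f (pr ^ (?N - Suc i)))" by (rule sum.nat_diff_reindex[symmetric])
  also have "\<dots> = (\<Sum>i<?N. g (pr * pr ^ i))"
  proof (rule sum.cong)
    fix i assume i: "i \<in> {..<?N}"
    then have "pr ^ (?N - Suc i) * (pr * pr ^ i) = pr ^ (?N - Suc i + Suc i)" by (simp only: power_add power_Suc)
    also have "?N - Suc i + Suc i = ?N" using i by simp
    finally show "f (pr ^ (?N - Suc i)) = g (pr * pr ^ i)" using one by (intro inv) simp
  qed simp
  also have "\<dots> = (\<Sum>x\<in>{1..<int p}. g (pr * x))"
  proof (rule sum_units_primroot[symmetric])
    fix x y :: int assume "[x = y] (mod int p)"
    then show "g (pr * x) = g (pr * y)" by (intro g cong_scalar_left)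
  qed
  also have "\<dots> = (\<Sum>x\<in>{1..<int p}. g x)" using g pr_not_dvd by (rule sum_units_scale)
  finally show ?thesis .
qed

lemma leg_inverse: assumes "[x * y = 1] (mod int p)" shows "leg x = leg y"
proof -
  have "leg x * leg y = 1" using leg_cong[OF assms] by (simp add: leg_mult)
  then show ?thesis using leg_cases[of x] leg_cases[of y] by auto
qed

lemma sum_leg_product:
  "(\<Sum>c\<in>{0..<int p}. leg ((a + c) * (b + c))) = (if [a = b] (mod int p) then int p - 1 else -1)"
proof -
  let ?d = "b - a"
  have "(\<Sum>c\<in>{0..<int p}. leg ((a + c) * (b + c))) = (\<Sum>c\<in>{0..<int p}. (\<lambda>x. leg (x * (x + ?d))) (1 * c + a))"
    by (intro sum.cong refl arg_cong[of _ _ leg]) (simp add: algebra_simps)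
  also have "\<dots> = (\<Sum>c\<in>{0..<int p}. leg (c * (c + ?d)))"
  proof (rule sum_affine)
    fix x y assume "[x = y] (mod int p)"
    then show "leg (x * (x + ?d)) = leg (y * (y + ?d))"
      by (intro leg_cong cong_mult cong_add cong_refl)
  qed (use prime_p in auto)
  also have "\<dots> = (\<Sum>c\<in>{1..<int p}. leg (c * (c + ?d)))" by (simp add: residues_split)
  also have "\<dots> = (\<Sum>c\<in>{1..<int p}. leg (1 + c * ?d))"
  proof (rule sum_units_inverse)
    fix x y assume xy: "[x = y] (mod int p)"
    show "leg (x * (x + ?d)) = leg (y * (y + ?d))" "leg (1 + x * ?d) = leg (1 + y * ?d)"
      by (intro leg_cong cong_mult cong_add xy cong_refl)+
  next
    fix x y assume xy: "[x * y = 1] (mod int p)"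
    have "[y * (x + ?d) = 1 + y * ?d] (mod int p)"
      using cong_add[OF xy cong_refl[of "y * ?d"]] by (simp add: algebra_simps)
    then have "leg (1 + y * ?d) = leg y * leg (x + ?d)" using leg_cong leg_mult by metis
    then show "leg (x * (x + ?d)) = leg (1 + y * ?d)" using leg_inverse[OF xy] by (simp add: leg_mult)
  qed
  also have "\<dots> = (if [a = b] (mod int p) then int p - 1 else -1)"
  proof (cases "[a = b] (mod int p)")
    case True
    then have d0: "[?d = 0] (mod int p)" by (simp add: cong_0_iff cong_iff_dvd_diff dvd_diff_commute)
    have "leg (1 + c * ?d) = leg 1" for c
      using leg_cong[OF cong_add[OF cong_refl[of 1] cong_scalar_left[OF d0, of c]]] by simp
    then show ?thesis using True p_gt_2 by simp
  next
    case False
    then have d: "\<not> int p dvd ?d" by (metis cong_iff_dvd_diff cong_sym)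
    have "(\<Sum>c\<in>{0..<int p}. leg (?d * c + 1)) = (\<Sum>c\<in>{0..<int p}. leg c)"
      by (intro sum_affine leg_cong d)
    then have "leg 1 + (\<Sum>c\<in>{1..<int p}. leg (1 + c * ?d)) = 0"
      by (simp add: residues_split sum_leg_units mult.commute add.commute)
    then show ?thesis using False by simp
  qed
  finally show ?thesis .
qed

lemma sum_leg_shift_square:
  assumes "finite Z"
  shows "(\<Sum>c\<in>{0..<int p}. (\<Sum>z\<in>Z. a z * leg (f z + c)) ^ 2)
    = int p * (\<Sum>z\<in>Z. \<Sum>w\<in>Z. if [f z = f w] (mod int p) then a z * a w else 0) - (\<Sum>z\<in>Z. a z) ^ 2"
proof -
  have "(\<Sum>c\<in>{0..<int p}. (\<Sum>z\<in>Z. a z * leg (f z + c)) ^ 2)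
     = (\<Sum>c\<in>{0..<int p}. \<Sum>z\<in>Z. \<Sum>w\<in>Z. a z * a w * leg ((f z + c) * (f w + c)))"
    by (simp add: power2_eq_square sum_product leg_mult mult_ac)
  also have "\<dots> = (\<Sum>z\<in>Z. \<Sum>w\<in>Z. \<Sum>c\<in>{0..<int p}. a z * a w * leg ((f z + c) * (f w + c)))"
    by (subst sum.swap, rule sum.cong[OF refl], rule sum.swap)
  also have "\<dots> = (\<Sum>z\<in>Z. \<Sum>w\<in>Z. a z * a w * (if [f z = f w] (mod int p) then int p - 1 else -1))"
    unfolding sum_distrib_left[symmetric] sum_leg_product ..
  also have "\<dots> = (\<Sum>z\<in>Z. \<Sum>w\<in>Z. int p * (if [f z = f w] (mod int p) then a z * a w else 0) - a z * a w)"
    by (intro sum.cong refl) (auto simp: algebra_simps)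
  finally have *: "(\<Sum>c\<in>{0..<int p}. (\<Sum>z\<in>Z. a z * leg (f z + c)) ^ 2) = \<dots>" .
  have sq: "(\<Sum>z\<in>Z. a z) ^ 2 = (\<Sum>z\<in>Z. \<Sum>w\<in>Z. a z * a w)"
    by (simp add: power2_eq_square sum_product)
  show ?thesis unfolding * sq by (simp add: sum_subtractf sum_distrib_left)
qed

lemma sum_equal_powers:
  assumes "n dvd p - 1" "s = 0 \<or> even ((p - 1) div n)"
  shows "(\<Sum>z\<in>{1..<int p}. \<Sum>w\<in>{1..<int p}. if [z ^ n = w ^ n] (mod int p) then leg z ^ s * leg w ^ s else 0) = int n * (int p - 1)"
proof -
  obtain m where m: "p - 1 = n * m" using assms(1) ..
  have nz: "n > 0" "m > 0" using m p_gt_2 by (auto intro: gr0I)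
  have "(\<Sum>u\<in>{1..<int p}. if [u ^ n = 1] (mod int p) then leg u ^ s else 0) = (\<Sum>i<p - 1. if [(pr ^ i) ^ n = 1] (mod int p) then leg (pr ^ i) ^ s else 0)"
  proof (rule sum_units_primroot)
    fix x y assume xy: "[x = y] (mod int p)"
    have "[x ^ n = 1] (mod int p) \<longleftrightarrow> [y ^ n = 1] (mod int p)"
      using cong_pow[OF xy, of n] by (metis cong_sym cong_trans)
    then show "(if [x ^ n = 1] (mod int p) then leg x ^ s else 0) = (if [y ^ n = 1] (mod int p) then leg y ^ s else 0)"
      using leg_cong[OF xy] by simp
  qed
  also have "\<dots> = (\<Sum>i\<in>{i\<in>{..<p - 1}. m dvd i}. leg (pr ^ i) ^ s)"
  proof -
    have "[(pr ^ i) ^ n = 1] (mod int p) \<longleftrightarrow> m dvd i" for i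
      using pr_power_cong_1_iff[of "n * i"] m nz by (simp add: mult.commute flip: power_mult)
    then show ?thesis by (simp only:) (rule sum.inter_filter[symmetric], simp)
  qed
  also have "\<dots> = (\<Sum>i\<in>{i\<in>{..<p - 1}. m dvd i}. 1)"
  proof (rule sum.cong)
    fix i assume "i \<in> {i\<in>{..<p - 1}. m dvd i}"
    then obtain k where k: "i = m * k" by auto
    have "s = 0 \<or> even m" using assms(2) m nz by simp
    then show "leg (pr ^ i) ^ s = 1" by (auto simp: leg_power leg_pr k power_mult)
  qed simp
  also have "{i\<in>{..<p - 1}. m dvd i} = (\<lambda>k. m * k) ` {..<n}"
    using nz m by (auto simp: mult.commute)
  also have "(\<Sum>i\<in>(\<lambda>k. m * k) ` {..<n}. 1) = int n"
    using nz by (subst sum.reindex) (auto simp: inj_on_def)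
  finally have U: "(\<Sum>u\<in>{1..<int p}. if [u ^ n = 1] (mod int p) then leg u ^ s else 0) = int n" .
  have "(\<Sum>w\<in>{1..<int p}. if [z ^ n = w ^ n] (mod int p) then leg z ^ s * leg w ^ s else 0) = int n" if z: "z \<in> {1..<int p}" for z
  proof -
    have zd: "\<not> int p dvd z" using z by (rule not_dvd_unit)
    have "(\<Sum>w\<in>{1..<int p}. if [z ^ n = (z * w) ^ n] (mod int p) then leg z ^ s * leg (z * w) ^ s else 0)
      = (\<Sum>w\<in>{1..<int p}. if [z ^ n = w ^ n] (mod int p) then leg z ^ s * leg w ^ s else 0)"
    proof (rule sum_units_scale)
      fix x y assume xy: "[x = y] (mod int p)"
      have "[z ^ n = x ^ n] (mod int p) \<longleftrightarrow> [z ^ n = y ^ n] (mod int p)"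
        using cong_pow[OF xy, of n] by (metis cong_sym cong_trans)
      then show "(if [z ^ n = x ^ n] (mod int p) then leg z ^ s * leg x ^ s else 0)
        = (if [z ^ n = y ^ n] (mod int p) then leg z ^ s * leg y ^ s else 0)"
        using leg_cong[OF xy] by simp
    qed (rule zd)
    moreover have "(if [z ^ n = (z * w) ^ n] (mod int p) then leg z ^ s * leg (z * w) ^ s else 0)
      = (if [w ^ n = 1] (mod int p) then leg w ^ s else 0)" for w
    proof -
      have "coprime (z ^ n) (int p)"
        using zd prime_p by (metis coprime_commute coprime_power_left_iff prime_imp_coprime prime_nat_int_transfer)
      then have "[z ^ n * 1 = z ^ n * w ^ n] (mod int p) \<longleftrightarrow> [1 = w ^ n] (mod int p)" by (rule cong_mult_lcancel)
      then have "[z ^ n = (z * w) ^ n] (mod int p) \<longleftrightarrow> [w ^ n = 1] (mod int p)"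
        by (simp add: power_mult_distrib cong_sym_eq)
      moreover have "leg z ^ s * leg (z * w) ^ s = leg w ^ s"
        using leg_square[OF zd] by (simp add: leg_mult power_mult_distrib mult.assoc[symmetric]) (simp flip: power_mult_distrib)
      ultimately show ?thesis by simp
    qed
    ultimately show ?thesis using U by simp
  qed
  then have "(\<Sum>z\<in>{1..<int p}. \<Sum>w\<in>{1..<int p}. if [z ^ n = w ^ n] (mod int p) then leg z ^ s * leg w ^ s else 0) = (\<Sum>z\<in>{1..<int p}. int n)"
    by (intro sum.cong refl)
  then show ?thesis using p_gt_2 by (simp add: of_nat_diff)
qed

lemma split_sum_periodic: "[c = d] (mod int p) \<Longrightarrow> split_sum s n c = split_sum s n d"
proof -
  assume cd: "[c = d] (mod int p)"
  have "leg (z + c) = leg (z + d)" for z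
    using cong_add[OF cong_refl cd] by (rule leg_cong)
  then show ?thesis by (simp add: split_sum_def)
qed

lemma split_sum_twist:
  assumes "even n"
  shows "split_sum 1 n (pr ^ (j + n)) = - split_sum 1 n (pr ^ j)"
proof -
  have "split_sum 1 n (pr ^ (j + n)) = (\<Sum>z\<in>{1..<int p}. (\<lambda>z. leg z * leg (z ^ n + pr ^ (j + n))) (pr * z))"
    unfolding split_sum_def power_one_right
  proof (rule sum_units_scale[symmetric])
    fix x y assume xy: "[x = y] (mod int p)"
    then have "[x ^ n + pr ^ (j + n) = y ^ n + pr ^ (j + n)] (mod int p)"
      by (intro cong_add cong_pow cong_refl)
    then show "leg x * leg (x ^ n + pr ^ (j + n)) = leg y * leg (y ^ n + pr ^ (j + n))"
      using leg_cong[OF xy] leg_cong by metis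
  qed (rule pr_not_dvd)
  also have "\<dots> = (\<Sum>z\<in>{1..<int p}. - (leg z * leg (z ^ n + pr ^ j)))"
  proof (rule sum.cong)
    fix z
    have "(pr * z) ^ n + pr ^ (j + n) = pr ^ n * (z ^ n + pr ^ j)"
      by (simp add: power_mult_distrib power_add algebra_simps)
    moreover have "leg (pr ^ n) = 1" using assms by (simp add: leg_power leg_pr)
    ultimately show "leg (pr * z) * leg ((pr * z) ^ n + pr ^ (j + n)) = - (leg z * leg (z ^ n + pr ^ j))"
      by (simp add: leg_mult leg_pr)
  qed simp
  finally show ?thesis by (simp add: split_sum_def sum_negf)
qed

lemma split_sum_square_sum:
  assumes n: "n dvd p - 1" "even n" "even ((p - 1) div n)"
  shows "(\<Sum>j<n. split_sum 1 n (pr ^ j) ^ 2) = int n ^ 2 * int p"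
proof -
  obtain m where m: "p - 1 = m * n" using n(1) by (metis dvd_div_mult_self)
  have nz: "n > 0" "m > 0" using m p_gt_2 by (auto intro: gr0I)
  have "(\<Sum>c\<in>{0..<int p}. split_sum 1 n c ^ 2) = int p * (int n * (int p - 1)) - 0 ^ 2"
    unfolding split_sum_def using sum_leg_shift_square[of "{1..<int p}" "\<lambda>z. leg z ^ 1" "\<lambda>z. z ^ n"]
      sum_equal_powers[OF n(1), of 1] n sum_leg_units by simp
  moreover have "split_sum 1 n 0 = 0"
  proof -
    have "split_sum 1 n 0 = (\<Sum>z\<in>{1..<int p}. leg z)"
      unfolding split_sum_def
    proof (rule sum.cong)
      fix z assume "z \<in> {1..<int p}"
      then have "leg z = 1 \<or> leg z = -1" using not_dvd_unit leg_cases leg_eq_0_iff by metis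
      then have "leg z ^ n = 1" using n(2) by auto
      then show "leg z ^ 1 * leg (z ^ n + 0) = leg z" by (simp add: leg_power)
    qed simp
    then show ?thesis using sum_leg_units by simp
  qed
  ultimately have "(\<Sum>c\<in>{1..<int p}. split_sum 1 n c ^ 2) = int p * (int n * (int p - 1))"
    by (simp add: residues_split)
  also have "(\<Sum>c\<in>{1..<int p}. split_sum 1 n c ^ 2) = (\<Sum>j<m * n. split_sum 1 n (pr ^ j) ^ 2)"
    unfolding m[symmetric] by (intro sum_units_primroot arg_cong[of _ _ "\<lambda>x. x ^ 2"] split_sum_periodic)
  also have "\<dots> = int m * (\<Sum>j<n. split_sum 1 n (pr ^ j) ^ 2)"
    using split_sum_twist[OF n(2)] by (intro sum_periodic) simp
  finally have "int m * (\<Sum>j<n. split_sum 1 n (pr ^ j) ^ 2) = int p * (int n * (int p - 1))" .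
  moreover have "int p - 1 = int m * int n"
    using arg_cong[OF m, of int] p_gt_2 by (simp add: of_nat_diff)
  ultimately show ?thesis using nz by (simp add: power2_eq_square)
qed

text \<open>For \<open>p \<equiv> 1 (mod 4)\<close>: half of \<open>T = split_sum 1 2 1\<close> is a sum of \<open>h - 1\<close> signs, as the terms of \<open>z\<close> and \<open>-z\<close> agree.\<close>
lemma quartic_sum:
  assumes "p = 4 * f + 1"
  obtains t w where "split_sum 1 2 1 = 2 * t" "int p = t ^ 2 + 4 * w ^ 2"
proof -
  have h: "h = 2 * f" "p - 1 = 2 * h" "f > 0" using assms p_eq h_pos by auto
  let ?a = "\<lambda>i. leg (pr ^ i) * leg ((pr ^ i) ^ 2 + 1)"
  have "(\<Sum>j<2. split_sum 1 2 (pr ^ j) ^ 2) = int 2 ^ 2 * int p"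
    using h assms by (intro split_sum_square_sum) auto
  then have sq: "split_sum 1 2 1 ^ 2 + split_sum 1 2 pr ^ 2 = 4 * int p"
    by (simp add: numeral_2_eq_2)
  have pers: "leg x * leg (x ^ 2 + 1) = leg y * leg (y ^ 2 + 1)" if "[x = y] (mod int p)" for x y
  proof -
    have "[x ^ 2 + 1 = y ^ 2 + 1] (mod int p)" using that by (intro cong_add cong_pow cong_refl)
    then show ?thesis using leg_cong[OF that] leg_cong by metis
  qed
  have hm: "[pr ^ h = -1] (mod int p)" using leg_euler[of pr] leg_pr by (simp add: cong_sym)
  have "split_sum 1 2 1 = (\<Sum>i<2 * h. ?a i)"
    unfolding split_sum_def h(2)[symmetric] power_one_right by (intro sum_units_primroot pers)
  also have "\<dots> = int 2 * (\<Sum>i<h. ?a i)"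
  proof (rule sum_periodic)
    fix j
    have "[pr ^ (j + h) = - (pr ^ j)] (mod int p)"
      using cong_scalar_left[OF hm, of "pr ^ j"] by (simp add: power_add)
    then have "?a (j + h) = leg (- (pr ^ j)) * leg ((- (pr ^ j)) ^ 2 + 1)" by (rule pers)
    also have "leg (- (pr ^ j)) = leg (pr ^ j)"
    proof -
      have "leg (-1) = leg (pr ^ h)" by (rule leg_cong[OF cong_sym[OF hm]])
      then have "leg (-1) = 1" using h by (simp add: leg_power leg_pr)
      then show ?thesis using leg_mult[of "-1" "pr ^ j"] by simp
    qed
    finally show "?a (j + h) = ?a j" by simp
  qed
  finally have t: "split_sum 1 2 1 = 2 * (\<Sum>i<h. ?a i)" by simp
  have odd_iff: "odd (?a i) \<longleftrightarrow> i \<noteq> f" if "i < h" for i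
  proof -
    have "\<not> int p dvd pr ^ i" using pr_not_dvd prime_p by (metis prime_dvd_power prime_nat_int_transfer)
    then have l: "leg (pr ^ i) = 1 \<or> leg (pr ^ i) = -1" using leg_cases leg_eq_0_iff by metis
    have "[pr ^ (2 * i) = -1] (mod int p) \<longleftrightarrow> i = f"
    proof
      assume "[pr ^ (2 * i) = -1] (mod int p)"
      then have "[pr ^ (2 * i) * pr ^ h = -1 * -1] (mod int p)" using hm by (rule cong_mult)
      then have "[pr ^ (2 * i + h) = 1] (mod int p)" by (simp add: power_add)
      then have "4 * f dvd 2 * i + 2 * f" using pr_power_cong_1_iff[of "2 * i + h"] h assms by simp
      then obtain k where k: "2 * i + 2 * f = 4 * f * k" ..
      then have kf: "i + f = 2 * f * k" by simp
      have "2 * f * k < 2 * f * 2" unfolding kf[symmetric] using that h by simp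
      then have "k < 2" by (simp only: mult_less_cancel1)
      then have "k = 0 \<or> k = 1" by auto
      then show "i = f" using kf h by auto
    qed (use hm h in simp)
    moreover have "leg ((pr ^ i) ^ 2 + 1) = 0 \<longleftrightarrow> [pr ^ (2 * i) = -1] (mod int p)"
      by (simp add: leg_eq_0_iff cong_iff_dvd_diff mult.commute flip: power_mult)
    ultimately show ?thesis using l leg_cases[of "(pr ^ i) ^ 2 + 1"] by auto
  qed
  have "odd (\<Sum>i<h. ?a i)"
  proof -
    have "odd (\<Sum>i<h. ?a i) \<longleftrightarrow> odd (card {i\<in>{..<h}. odd (?a i)})"
      by (rule even_sum_iff[THEN arg_cong[of _ _ Not]]) simp
    also have "{i\<in>{..<h}. odd (?a i)} = {..<h} - {f}" using odd_iff by auto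
    also have "odd (card ({..<h} - {f}))" using h by simp
    finally show ?thesis by simp
  qed
  define t where "t = (\<Sum>i<h. ?a i)"
  define u where "u = split_sum 1 2 pr"
  have T: "split_sum 1 2 1 = 2 * t" "odd t" using \<open>odd (\<Sum>i<h. ?a i)\<close> t by (simp_all add: t_def)
  have u: "u ^ 2 = 4 * (int p - t ^ 2)" using sq T by (simp add: u_def power_mult_distrib)
  then have "even (u ^ 2)" by simp
  then obtain v where v: "u = 2 * v" by auto
  then have v2: "int p = t ^ 2 + v ^ 2" using u by (simp add: power_mult_distrib)
  have "odd (t ^ 2)" "odd (int p)" using T odd_p by auto
  then have "even (v ^ 2)" using v2 by (metis even_add)
  then obtain w where "v = 2 * w" by auto
  then show ?thesis using that T v2 by (simp add: power_mult_distrib)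
qed

lemma octic_sum:
  assumes "p = 8 * e + 1"
  obtains t w where "split_sum 1 4 1 = 4 * t" "int p = t ^ 2 + 2 * w ^ 2"
proof -
  have e: "e > 0" "p - 1 = 8 * e" using assms p_gt_2 by auto
  let ?F = "\<lambda>j. split_sum 1 4 (pr ^ j)"
  have "(\<Sum>j<4. ?F j ^ 2) = int 4 ^ 2 * int p"
    using e by (intro split_sum_square_sum) auto
  then have sq: "?F 0 ^ 2 + ?F 1 ^ 2 + ?F 2 ^ 2 + ?F 3 ^ 2 = 16 * int p"
    by (simp add: eval_nat_numeral)
  have one: "[pr ^ (8 * e) = 1] (mod int p)" using pr_power_cong_1_iff[of "8 * e"] e by simp
  have tw: "?F (j + 8 * m) = ?F j" for j m
  proof (induction m)
    case (Suc m)
    have "?F (j + 8 * Suc m) = ?F (((j + 8 * m) + 4) + 4)" by (simp add: algebra_simps)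
    then show ?case using split_sum_twist[of 4 "(j + 8 * m) + 4"] split_sum_twist[of 4 "j + 8 * m"] Suc by simp
  qed simp
  have refl: "?F j = - ((-1) ^ j * ?F (4 - j))" if "j \<le> 4" for j
  proof -
    let ?k = "4 - j + 8 * (e - 1) + 4"
    have jk: "j + ?k = 8 * e" using that e by simp
    have per: "leg x * leg (x ^ 4 + c) = leg y * leg (y ^ 4 + c)" if "[x = y] (mod int p)" for x y c
    proof -
      have "[x ^ 4 + c = y ^ 4 + c] (mod int p)" using that by (intro cong_add cong_pow cong_refl)
      then show ?thesis using leg_cong[OF that] leg_cong by metis
    qed
    have "(\<Sum>z\<in>{1..<int p}. leg z * leg (z ^ 4 + pr ^ j)) = (\<Sum>z\<in>{1..<int p}. leg (pr ^ j) * (leg z * leg (z ^ 4 + pr ^ ?k)))"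
    proof (rule sum_units_inverse)
      fix x y assume "[x = y] (mod int p)"
      then show "leg x * leg (x ^ 4 + pr ^ j) = leg y * leg (y ^ 4 + pr ^ j)"
        "leg (pr ^ j) * (leg x * leg (x ^ 4 + pr ^ ?k)) = leg (pr ^ j) * (leg y * leg (y ^ 4 + pr ^ ?k))"
        using per by auto
    next
      fix x y assume xy: "[x * y = 1] (mod int p)"
      have "\<not> int p dvd y" using xy prime_p by (metis cong_dvd_iff dvd_mult not_prime_unit prime_nat_int_transfer)
      then have "leg (y ^ 4) = 1" using leg_cases[of y] leg_eq_0_iff[of y] by (auto simp: leg_power)
      then have "leg (x ^ 4 + pr ^ j) = leg (y ^ 4 * (x ^ 4 + pr ^ j))" by (simp add: leg_mult)
      also have "\<dots> = leg (pr ^ j * (y ^ 4 + pr ^ ?k))"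
      proof (rule leg_cong)
        have "[(x * y) ^ 4 + pr ^ j * y ^ 4 = 1 ^ 4 + pr ^ j * y ^ 4] (mod int p)"
          using xy by (intro cong_add cong_pow cong_refl)
        moreover have "[1 ^ 4 + pr ^ j * y ^ 4 = pr ^ (8 * e) + pr ^ j * y ^ 4] (mod int p)"
          unfolding power_one by (intro cong_add cong_refl cong_sym[OF one])
        ultimately have "[(x * y) ^ 4 + pr ^ j * y ^ 4 = pr ^ (8 * e) + pr ^ j * y ^ 4] (mod int p)"
          by (rule cong_trans)
        moreover have "pr ^ (8 * e) = pr ^ j * pr ^ ?k" by (simp only: power_add[symmetric] jk)
        ultimately show "[y ^ 4 * (x ^ 4 + pr ^ j) = pr ^ j * (y ^ 4 + pr ^ ?k)] (mod int p)"
          by (simp add: power_mult_distrib algebra_simps)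
      qed
      finally show "leg x * leg (x ^ 4 + pr ^ j) = leg (pr ^ j) * (leg y * leg (y ^ 4 + pr ^ ?k))"
        using leg_inverse[OF xy] by (simp add: leg_mult)
    qed
    then have "?F j = leg (pr ^ j) * ?F ?k" by (simp add: split_sum_def sum_distrib_left)
    also have "?F ?k = - ?F (4 - j)" using split_sum_twist[of 4 "4 - j + 8 * (e - 1)"] tw[of "4 - j" "e - 1"] by simp
    finally show ?thesis by (simp add: leg_power leg_pr)
  qed
  have "?F 2 = 0" "?F 1 = ?F 3" using refl[of 2] refl[of 1] by simp_all
  then have sq: "?F 0 ^ 2 + 2 * ?F 1 ^ 2 = 16 * int p" using sq by simp
  then show ?thesis using that by (elim sixteen_p) simp
qed

lemma cubic_sum:
  assumes "p = 6 * e + 1"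
  obtains t w where "split_sum 0 3 1 + 1 = 2 * t" "int p = t ^ 2 + 3 * w ^ 2"
proof -
  have h: "h = 3 * e" "p - 1 = 6 * e" "e > 0" using assms p_eq h_pos by auto
  define F where "F c = (\<Sum>z\<in>{0..<int p}. leg (z ^ 3 + c))" for c
  have F: "F c = split_sum 0 3 c + leg c" for c
    by (simp add: F_def split_sum_def residues_split)
  have pers: "F c = F d" if "[c = d] (mod int p)" for c d
    using split_sum_periodic[OF that] leg_cong[OF that] by (simp add: F)
  have F0: "F 0 = 0"
  proof -
    have "leg (z ^ 3) = leg z" for z using leg_cases[of z] by (auto simp: leg_power)
    then show ?thesis by (simp add: F_def sum_leg)
  qed
  have tw: "F (pr ^ (j + 3)) = - F (pr ^ j)" for j
  proof -
    have "F (pr ^ (j + 3)) = (\<Sum>z\<in>{0..<int p}. (\<lambda>z. leg (z ^ 3 + pr ^ (j + 3))) (pr * z + 0))"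
      unfolding F_def
    proof (rule sum_affine[symmetric])
      fix x y assume "[x = y] (mod int p)"
      then show "leg (x ^ 3 + pr ^ (j + 3)) = leg (y ^ 3 + pr ^ (j + 3))"
        by (intro leg_cong cong_add cong_pow cong_refl)
    qed (rule pr_not_dvd)
    also have "\<dots> = (\<Sum>z\<in>{0..<int p}. - leg (z ^ 3 + pr ^ j))"
    proof (rule sum.cong)
      fix z
      have "(pr * z + 0) ^ 3 + pr ^ (j + 3) = pr ^ 3 * (z ^ 3 + pr ^ j)"
        by (simp add: power_mult_distrib power_add algebra_simps)
      then show "leg ((pr * z + 0) ^ 3 + pr ^ (j + 3)) = - leg (z ^ 3 + pr ^ j)"
        by (simp add: leg_mult leg_power leg_pr)
    qed simp
    finally show ?thesis by (simp add: F_def sum_negf)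
  qed
  have cnt: "(\<Sum>z\<in>{0..<int p}. \<Sum>w\<in>{0..<int p}. if [z ^ 3 = w ^ 3] (mod int p) then 1 * 1 else 0) = 3 * (int p - 1) + 1"
  proof -
    have "[0 = w ^ 3] (mod int p) \<longleftrightarrow> False" "[w ^ 3 = 0] (mod int p) \<longleftrightarrow> False" if "w \<in> {1..<int p}" for w
    proof -
      have "\<not> int p dvd w ^ 3" using not_dvd_unit[OF that] prime_p by (metis prime_dvd_power prime_nat_int_transfer)
      then show "[0 = w ^ 3] (mod int p) \<longleftrightarrow> False" "[w ^ 3 = 0] (mod int p) \<longleftrightarrow> False"
        by (simp_all add: cong_0_iff cong_sym_eq[of 0])
    qed
    then show ?thesis using sum_equal_powers[of 3 0, unfolded power_0 mult_1] h by (simp add: residues_split)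
  qed
  have "(\<Sum>c\<in>{0..<int p}. F c ^ 2) = int p * (3 * (int p - 1) + 1) - int p ^ 2"
    using sum_leg_shift_square[of "{0..<int p}" "\<lambda>_. 1" "\<lambda>z. z ^ 3"] cnt by (simp add: F_def)
  then have "(\<Sum>c\<in>{1..<int p}. F c ^ 2) = 2 * int p * (int p - 1)"
    using F0 by (simp add: residues_split power2_eq_square algebra_simps)
  also have "(\<Sum>c\<in>{1..<int p}. F c ^ 2) = (\<Sum>j<(2 * e) * 3. F (pr ^ j) ^ 2)"
    using h(2) by (subst sum_units_primroot) (auto intro: arg_cong[of _ _ "\<lambda>x. x ^ 2"] pers simp: mult.commute)
  also have "\<dots> = int (2 * e) * (\<Sum>j<3. F (pr ^ j) ^ 2)"
    using tw by (intro sum_periodic) simp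
  finally have "int (2 * e) * (\<Sum>j<3. F (pr ^ j) ^ 2) = 2 * int p * (int p - 1)" .
  moreover have "int p - 1 = 3 * int (2 * e)" using assms by simp
  ultimately have sq: "(\<Sum>j<3. F (pr ^ j) ^ 2) = 6 * int p" using h by simp
  have "(\<Sum>c\<in>{0..<int p}. leg c * F c) = (\<Sum>c\<in>{0..<int p}. \<Sum>z\<in>{0..<int p}. leg ((0 + c) * (z ^ 3 + c)))"
    by (simp add: F_def sum_distrib_left leg_mult)
  also have "\<dots> = (\<Sum>z\<in>{0..<int p}. if [0 = z ^ 3] (mod int p) then int p - 1 else -1)"
    unfolding sum.swap[of _ "{0..<int p}"] sum_leg_product ..
  also have "\<dots> = 0"
  proof -
    have "(\<Sum>z\<in>{1..<int p}. if [0 = z ^ 3] (mod int p) then int p - 1 else -1) = (\<Sum>z\<in>{1..<int p}. -1)"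
    proof (rule sum.cong)
      fix w assume "w \<in> {1..<int p}"
      then have "\<not> int p dvd w ^ 3" using not_dvd_unit prime_p by (metis prime_dvd_power prime_nat_int_transfer)
      then show "(if [0 = w ^ 3] (mod int p) then int p - 1 else -1) = -1"
        by (simp add: cong_0_iff cong_sym_eq[of 0])
    qed simp
    then show ?thesis using p_gt_2 by (simp add: residues_split of_nat_diff)
  qed
  finally have "(\<Sum>c\<in>{1..<int p}. leg c * F c) = 0" by (simp add: residues_split)
  also have "(\<Sum>c\<in>{1..<int p}. leg c * F c) = (\<Sum>j<(2 * e) * 3. leg (pr ^ j) * F (pr ^ j))"
    using h(2) by (subst sum_units_primroot) (auto intro: arg_cong2[of _ _ _ _ "(*)"] pers leg_cong simp: mult.commute)
  also have "\<dots> = int (2 * e) * (\<Sum>j<3. leg (pr ^ j) * F (pr ^ j))"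
    by (intro sum_periodic) (simp only: tw leg_power leg_pr, simp add: power_add)
  finally have "(\<Sum>j<3. leg (pr ^ j) * F (pr ^ j)) = 0" using h by simp
  then have lin: "F (pr ^ 1) = F 1 + F (pr ^ 2)" by (simp add: eval_nat_numeral leg_mult leg_pr)
  have sq: "F 1 ^ 2 + F (pr ^ 1) ^ 2 + F (pr ^ 2) ^ 2 = 6 * int p" using sq by (simp add: eval_nat_numeral)
  have hm: "[pr ^ h = -1] (mod int p)" using leg_euler[of pr] leg_pr by (simp add: cong_sym)
  have "split_sum 0 3 1 = (\<Sum>i<p - 1. leg ((pr ^ i) ^ 3 + 1))"
    unfolding split_sum_def
  proof (subst sum_units_primroot)
    fix x y assume "[x = y] (mod int p)"
    then show "leg x ^ 0 * leg (x ^ 3 + 1) = leg y ^ 0 * leg (y ^ 3 + 1)"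
      by (intro arg_cong2[of _ _ _ _ "(*)"] leg_cong cong_add cong_pow cong_refl) auto
  qed simp
  moreover have "odd (\<Sum>i<p - 1. leg ((pr ^ i) ^ 3 + 1))"
  proof -
    have "even (leg ((pr ^ i) ^ 3 + 1)) \<longleftrightarrow> i \<in> {e, 3 * e, 5 * e}" if "i < p - 1" for i
    proof -
      have "[pr ^ (3 * i) = -1] (mod int p) \<longleftrightarrow> i \<in> {e, 3 * e, 5 * e}"
      proof
        assume "[pr ^ (3 * i) = -1] (mod int p)"
        then have "[pr ^ (3 * i) * pr ^ h = -1 * -1] (mod int p)" using hm by (rule cong_mult)
        then have "[pr ^ (3 * i + h) = 1] (mod int p)" by (simp add: power_add)
        then have "6 * e dvd 3 * i + 3 * e" using pr_power_cong_1_iff[of "3 * i + h"] h by simp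
        then obtain k where k: "3 * i + 3 * e = 6 * e * k" ..
        then have kf: "i + e = 2 * e * k" by simp
        have "2 * e * k < 2 * e * 4" unfolding kf[symmetric] using that h by simp
        then have "k < 4" by (simp only: mult_less_cancel1)
        then have "k = 0 \<or> k = 1 \<or> k = 2 \<or> k = 3" by auto
        then show "i \<in> {e, 3 * e, 5 * e}" using kf h by auto
      next
        assume "i \<in> {e, 3 * e, 5 * e}"
        then obtain k where "3 * i = h * k" "odd k" using h by (auto simp: mult.commute intro: that[of 1] that[of 3] that[of 5])
        then show "[pr ^ (3 * i) = -1] (mod int p)" using cong_pow[OF hm, of k] by (simp add: power_mult)
      qed
      moreover have "leg ((pr ^ i) ^ 3 + 1) = 0 \<longleftrightarrow> [pr ^ (3 * i) = -1] (mod int p)"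
        by (simp add: leg_eq_0_iff cong_iff_dvd_diff mult.commute flip: power_mult)
      ultimately show ?thesis using leg_cases[of "(pr ^ i) ^ 3 + 1"] by auto
    qed
    then have "{i\<in>{..<p - 1}. odd (leg ((pr ^ i) ^ 3 + 1))} = {..<p - 1} - {e, 3 * e, 5 * e}" by auto
    moreover have "card ({..<p - 1} - {e, 3 * e, 5 * e}) = 6 * e - 3"
      using h by (subst card_Diff_subset) auto
    ultimately show ?thesis using h by (subst even_sum_iff) auto
  qed
  ultimately have "even (split_sum 0 3 1 + 1)" by simp
  then obtain t where t: "split_sum 0 3 1 + 1 = 2 * t" by (rule evenE)
  define b where "b = F (pr ^ 2)"
  have "F 1 = 2 * t" using t F[of 1] by simp
  then have eq: "(2 * t) ^ 2 + (2 * t + b) ^ 2 + b ^ 2 = 6 * int p" using sq lin by (simp add: b_def)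
  then have e3: "(b + t) ^ 2 = 3 * (int p - t ^ 2)" by (simp add: power2_eq_square algebra_simps)
  then have "3 dvd (b + t) ^ 2" by simp
  then have "3 dvd b + t" using prime_dvd_power[of "3 :: int" "b + t" 2] by simp
  then obtain w where "b + t = 3 * w" ..
  then have "int p = t ^ 2 + 3 * w ^ 2" using e3 by (simp add: power_mult_distrib)
  then show ?thesis using that t by blast
qed

end

section \<open>Split primes\<close>

context odd_prime
begin

lemma H_pred: "0 < n \<Longrightarrow> H (n - 1) = H n - 1 / of_nat n"
  using H_Suc[of "n - 1"] by (simp add: of_nat_diff)

lemma conv_pair_split: assumes r: "0 < r" "r < h"
  shows "cg 1 (of_nat h * of_nat (conv r + conv (h - r)))
    (of_nat (h choose r) * (1 + (of_nat h * H h - of_nat r * H r - of_nat (h - r) * H (h - r))))"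
proof -
  let ?C = "of_nat (h choose r) :: rat"
  have hp: "H (h - r - 1) = H (h - r) - 1 / of_nat (h - r)" "H (r - 1) = H r - 1 / of_nat r"
    using H_pred[of "h - r"] H_pred[of r] r by simp_all
  have c: "of_nat (h choose (h - r)) = ?C" using r by (simp add: binomial_symmetric[symmetric])
  have "cg 1 (of_nat h * of_nat (conv r) + of_nat h * of_nat (conv (h - r)))
     (?C * ((of_nat h - of_nat r) * (H (h - 1) - H (h - 1 - r)))
      + of_nat (h choose (h - r)) * ((of_nat h - of_nat (h - r)) * (H (h - 1) - H (h - 1 - (h - r)))))"
    using r by (intro cg_add conv_small) auto
  also have "h - 1 - r = h - r - 1" by simp
  also have "h - 1 - (h - r) = r - 1" using r by simp
  also have "?C * ((of_nat h - of_nat r) * (H (h - 1) - H (h - r - 1)))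
      + of_nat (h choose (h - r)) * ((of_nat h - of_nat (h - r)) * (H (h - 1) - H (r - 1)))
    = ?C * (1 + (of_nat h * H h - of_nat r * H r - of_nat (h - r) * H (h - r)))"
    using r h_pos unfolding c H_pred[OF h_pos] hp(1) hp(2) by (simp add: of_nat_diff field_simps)
  finally show ?thesis by (simp add: distrib_left)
qed

lemma conv_pair_nonsplit: assumes r: "0 < r" "r < h"
  shows "cg 1 (of_nat h * of_nat (conv (r - 1) + conv (h - r - 1)))
    (of_nat (h choose r) * ((of_nat h * H h - of_nat r * H (h - r) - of_nat (h - r) * H r) - 1))"
proof -
  let ?C = "of_nat (h choose r) :: rat"
  have c1: "of_nat (h choose (r - 1)) * (of_nat h - of_nat (r - 1)) = of_nat r * ?C"
  proof -
    have "r * (h choose r) = h * ((h - 1) choose (r - 1))" using r by (simp add: times_binomial_minus1_eq)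
    also have "\<dots> = (h - (r - 1)) * (h choose (r - 1))" by (rule binomial_absorb_comp[symmetric])
    finally have "of_nat r * ?C = of_nat (h - (r - 1)) * (of_nat (h choose (r - 1)) :: rat)"
      by (metis of_nat_mult)
    then show ?thesis using r by (simp add: of_nat_diff mult.commute)
  qed
  have c2: "of_nat (h choose (h - r - 1)) * (of_nat h - of_nat (h - r - 1)) = of_nat (h - r) * ?C"
  proof -
    have "h choose (h - r - 1) = h choose (r + 1)"
      using r binomial_symmetric[of "r + 1" h] by (simp add: diff_diff_eq[symmetric])
    moreover have "(r + 1) * (h choose (r + 1)) = (h - r) * (h choose r)"
      using binomial_absorb_comp[of h r] binomial_absorption[of r h] by simp
    then have "of_nat (r + 1) * of_nat (h choose (r + 1)) = of_nat (h - r) * ?C" by (metis of_nat_mult)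
    moreover have "of_nat h - of_nat (h - r - 1) = (of_nat (r + 1) :: rat)" using r by (simp add: of_nat_diff)
    ultimately show ?thesis by (simp add: mult.commute)
  qed
  have "cg 1 (of_nat h * of_nat (conv (r - 1)) + of_nat h * of_nat (conv (h - r - 1)))
     (of_nat (h choose (r - 1)) * ((of_nat h - of_nat (r - 1)) * (H (h - 1) - H (h - 1 - (r - 1))))
      + of_nat (h choose (h - r - 1)) * ((of_nat h - of_nat (h - r - 1)) * (H (h - 1) - H (h - 1 - (h - r - 1)))))"
    using r by (intro cg_add conv_small) auto
  also have "h - 1 - (r - 1) = h - r" using r by simp
  also have "h - 1 - (h - r - 1) = r" using r by simp
  also have "of_nat (h choose (r - 1)) * ((of_nat h - of_nat (r - 1)) * (H (h - 1) - H (h - r)))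
      + of_nat (h choose (h - r - 1)) * ((of_nat h - of_nat (h - r - 1)) * (H (h - 1) - H r))
    = ?C * ((of_nat h * H h - of_nat r * H (h - r) - of_nat (h - r) * H r) - 1)"
    unfolding mult.assoc[symmetric] c1 c2 H_pred[OF h_pos] using r h_pos by (simp add: of_nat_diff field_simps)
  finally show ?thesis by (simp add: distrib_left)
qed

lemma alpha_square:
  assumes "unit C" "X \<in> Zp p" "cg 2 t (s * (C * (1 + P * X) + P / C))" "s * s = 1"
  shows "cg 2 (C ^ 2 * (1 + 2 * P * X)) (t ^ 2 - 2 * P)"
proof -
  have C: "C \<noteq> 0" "C \<in> Zp p" "1 / C \<in> Zp p" using assms(1) by (auto simp: unit_def)
  have "cg 2 (t ^ 2) ((s * (C * (1 + P * X) + P / C)) ^ 2)" using assms(3) by (rule cg_power)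
  also have "(s * (C * (1 + P * X) + P / C)) ^ 2 = (C * (1 + P * X) + P / C) ^ 2"
    using assms(4) by (simp add: power_mult_distrib power2_eq_square[of s])
  also have "cg 2 \<dots> (C ^ 2 * (1 + 2 * P * X) + 2 * P)"
  proof (rule cgI)
    show "C ^ 2 * (1 + 2 * P * X) + 2 * P \<in> Zp p" by (intro Zp_rules C assms Zp_1 Zp_numeral Zp_of_nat)
    show "C ^ 2 * X ^ 2 + 2 * X + (1 / C) ^ 2 \<in> Zp p" by (intro Zp_rules C assms Zp_1 Zp_numeral Zp_of_nat)
    show "(C * (1 + P * X) + P / C) ^ 2 = C ^ 2 * (1 + 2 * P * X) + 2 * P + P ^ 2 * (C ^ 2 * X ^ 2 + 2 * X + (1 / C) ^ 2)"
      using C(1) by (simp add: power2_eq_square field_simps)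
  qed
  finally have "cg 2 (t ^ 2 - 2 * P) (C ^ 2 * (1 + 2 * P * X) + 2 * P - 2 * P)"
    by (intro cg_diff) (auto intro: cg_refl)
  then show ?thesis by (simp add: cg_sym)
qed

lemma split_alpha:
  assumes r: "0 < r" "r < h"
    and t: "cg 2 t ((P - 1) * (of_nat (h choose r) + P * (of_nat h * of_nat (conv r + conv (h - r) + conv (h + r)))))"
  shows "cg 2 (of_nat (h choose r) ^ 2 * (1 + 2 * P * (of_nat h * H h - of_nat r * H r - of_nat (h - r) * H (h - r)))) (t ^ 2 - 2 * P)"
proof -
  let ?C = "of_nat (h choose r) :: rat" and ?X = "of_nat h * H h - of_nat r * H r - of_nat (h - r) * H (h - r)"
  have u: "unit ?C" using r h_less_p by (intro unit_choose) auto
  then have C: "?C \<noteq> 0" "?C \<in> Zp p" "1 / ?C \<in> Zp p" by (auto simp: unit_def)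
  have X: "?X \<in> Zp p" using r h_less_p by (intro Zp_rules H_Zp Zp_of_nat) auto
  have "cg 1 (of_nat h * of_nat (conv r + conv (h - r)) + of_nat h * of_nat (conv (h + r))) (?C * (1 + ?X) + 1 / ?C)"
    using r by (intro cg_add conv_pair_split conv_middle) auto
  then have y: "cg 1 (of_nat h * of_nat (conv r + conv (h - r) + conv (h + r))) (?C * (1 + ?X) + 1 / ?C)"
    by (simp add: distrib_left add.assoc)
  have "cg 2 ((P - 1) * (?C + P * (of_nat h * of_nat (conv r + conv (h - r) + conv (h + r)))))
     ((P - 1) * (?C + P * (?C * (1 + ?X) + 1 / ?C)))"
    by (intro cg_mult_left cg_add cg_P_mult2[OF y] cg_refl Zp_rules Zp_of_nat Zp_1)
  also have "cg 2 \<dots> (-1 * (?C * (1 + P * ?X) + P / ?C))"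
  proof (rule cgI)
    show "-1 * (?C * (1 + P * ?X) + P / ?C) \<in> Zp p"
      by (intro Zp_rules X C Zp_1 Zp_of_nat unit_divide u)
    show "?C * (1 + ?X) + 1 / ?C \<in> Zp p" by (intro Zp_rules C X Zp_1)
    have "(q - 1) * (c + q * (c * (1 + x) + z)) = -1 * (c * (1 + q * x) + q * z) + q ^ 2 * (c * (1 + x) + z)" for q c x z :: rat
      by (simp add: power2_eq_square algebra_simps)
    from this[of P ?C ?X "1 / ?C"]
    show "(P - 1) * (?C + P * (?C * (1 + ?X) + 1 / ?C)) = -1 * (?C * (1 + P * ?X) + P / ?C) + P ^ 2 * (?C * (1 + ?X) + 1 / ?C)"
      by (simp only: times_divide_eq_right mult_1_right)
  qed
  finally have "cg 2 t (-1 * (?C * (1 + P * ?X) + P / ?C))" by (rule cg_trans[OF t])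
  then show ?thesis using alpha_square[OF u X, of t "-1"] by simp
qed

lemma nonsplit_alpha:
  assumes r: "0 < r" "r < h"
    and t: "cg 2 t ((P + 1) * (of_nat (h choose r) + P * (of_nat h * of_nat (conv (r - 1) + conv (h - r - 1) + conv (h + r)))))"
  shows "cg 2 (of_nat (h choose r) ^ 2 * (1 + 2 * P * (of_nat h * H h - of_nat r * H (h - r) - of_nat (h - r) * H r))) (t ^ 2 - 2 * P)"
proof -
  let ?C = "of_nat (h choose r) :: rat" and ?X = "of_nat h * H h - of_nat r * H (h - r) - of_nat (h - r) * H r"
  have u: "unit ?C" using r h_less_p by (intro unit_choose) auto
  then have C: "?C \<noteq> 0" "?C \<in> Zp p" "1 / ?C \<in> Zp p" by (auto simp: unit_def)
  have X: "?X \<in> Zp p" using r h_less_p by (intro Zp_rules H_Zp Zp_of_nat) auto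
  have "cg 1 (of_nat h * of_nat (conv (r - 1) + conv (h - r - 1)) + of_nat h * of_nat (conv (h + r))) (?C * (?X - 1) + 1 / ?C)"
    using r by (intro cg_add conv_pair_nonsplit conv_middle) auto
  then have y: "cg 1 (of_nat h * of_nat (conv (r - 1) + conv (h - r - 1) + conv (h + r))) (?C * (?X - 1) + 1 / ?C)"
    by (simp add: distrib_left add.assoc)
  have "cg 2 ((P + 1) * (?C + P * (of_nat h * of_nat (conv (r - 1) + conv (h - r - 1) + conv (h + r)))))
     ((P + 1) * (?C + P * (?C * (?X - 1) + 1 / ?C)))"
    by (intro cg_mult_left cg_add cg_P_mult2[OF y] cg_refl Zp_rules Zp_of_nat Zp_1)
  also have "cg 2 \<dots> (1 * (?C * (1 + P * ?X) + P / ?C))"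
  proof (rule cgI)
    show "1 * (?C * (1 + P * ?X) + P / ?C) \<in> Zp p"
      by (intro Zp_rules X C Zp_1 Zp_of_nat unit_divide u)
    show "?C * (?X - 1) + 1 / ?C \<in> Zp p" by (intro Zp_rules C X Zp_1)
    have "(q + 1) * (c + q * (c * (x - 1) + z)) = 1 * (c * (1 + q * x) + q * z) + q ^ 2 * (c * (x - 1) + z)" for q c x z :: rat
      by (simp add: power2_eq_square algebra_simps)
    from this[of P ?C ?X "1 / ?C"]
    show "(P + 1) * (?C + P * (?C * (?X - 1) + 1 / ?C)) = 1 * (?C * (1 + P * ?X) + P / ?C) + P ^ 2 * (?C * (?X - 1) + 1 / ?C)"
      by (simp only: times_divide_eq_right mult_1_right)
  qed
  finally have "cg 2 t (1 * (?C * (1 + P * ?X) + P / ?C))" by (rule cg_trans[OF t])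
  then show ?thesis using alpha_square[OF u X, of t 1] by simp
qed

lemma G_CM_log:
  assumes e: "2 * e < p" and t: "t \<in> Zp p" and z: "z \<in> Zp p"
    and X: "2 * X = (1 + t) * H (h - e) - t * H e - H h + P * z"
    and a: "cg 2 (of_nat (h choose e) ^ 2 * (1 + 2 * P * X)) y"
  shows "cg 2 (G h (of_nat (2 * e) + P * t)) y"
proof -
  let ?Y = "(1 + t) * H (h - e) - t * H e - H h"
  let ?C = "of_nat (h choose e) :: rat"
  have Hz: "H h \<in> Zp p" "H e \<in> Zp p" "H (h - e) \<in> Zp p" using e h_less_p by (auto intro!: H_Zp)
  have "cg 2 (?C ^ 2 * (1 + 2 * P * X)) (?C ^ 2 * (1 + P * ?Y))"
  proof (rule cgI)
    show "?C ^ 2 * (1 + P * ?Y) \<in> Zp p" by (intro Zp_rules Hz t Zp_1 Zp_of_nat)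
    show "?C ^ 2 * z \<in> Zp p" by (intro Zp_rules z Zp_of_nat)
    have "2 * P * X = P * (?Y + P * z)" using X by (metis mult.assoc mult.commute)
    then show "?C ^ 2 * (1 + 2 * P * X) = ?C ^ 2 * (1 + P * ?Y) + P ^ 2 * (?C ^ 2 * z)"
      by (simp only:) (simp add: power2_eq_square algebra_simps)
  qed
  from cg_trans[OF cg_sym[OF this] a] have "cg 2 (?C ^ 2 * (1 + P * ?Y)) y" .
  from cg_trans[OF G_CM[OF e t] this] show ?thesis .
qed

lemma G_CM_split:
  assumes p: "p = 2 * m * e + 1" "m \<ge> 2"
    and t: "cg 2 t ((P - 1) * (of_nat (h choose e) + P * (of_nat h * of_nat (conv e + conv (h - e) + conv (h + e)))))"
  shows "cg 2 (G h (- 1 / of_nat m)) (t ^ 2 - 2 * P)"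
proof -
  have h: "h = m * e" using p p_eq by simp
  have e0: "e > 0" using p p_gt_2 by (auto intro: gr0I)
  have eh: "e < h" using h p(2) e0 by simp
  have m: "of_nat m \<noteq> (0::rat)" using p(2) by simp
  have "m < p" using p e0 by (metis Suc_eq_plus1 le_imp_less_Suc mult.assoc mult.commute mult_le_mono2 nat_mult_1_right One_nat_def Suc_leI le_trans mult_le_mono1 one_le_numeral)
  then have ti: "- 1 / of_nat m \<in> Zp p" using p(2) by (intro Zp_divide_small Zp_minus) auto
  let ?t = "- 1 / of_nat m :: rat"
  have Pm: "P = 2 * of_nat m * of_nat e + 1" by (subst p(1)) simp
  have arg: "of_nat (2 * e) + P * ?t = ?t" unfolding Pm using m by (simp add: field_simps)
  let ?Y = "(1 + ?t) * H (h - e) - ?t * H e - H h"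
  have Hz: "H h \<in> Zp p" "H e \<in> Zp p" "H (h - e) \<in> Zp p" using eh h_less_p by (auto intro!: H_Zp)
  have "cg 2 (G h (of_nat (2 * e) + P * ?t)) (t ^ 2 - 2 * P)"
  proof (rule G_CM_log[OF _ ti])
    show "2 * e < p" using eh p_eq by simp
    show "- ?Y \<in> Zp p" by (intro Zp_rules Hz ti Zp_1)
    show "2 * (of_nat h * H h - of_nat e * H e - of_nat (h - e) * H (h - e)) = ?Y + P * - ?Y"
      using eh m unfolding Pm by (simp add: of_nat_diff h field_simps)
    show "cg 2 (of_nat (h choose e) ^ 2 * (1 + 2 * P * (of_nat h * H h - of_nat e * H e - of_nat (h - e) * H (h - e)))) (t ^ 2 - 2 * P)"
      by (rule split_alpha[OF e0 eh t])
  qed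
  then show ?thesis unfolding arg .
qed

lemma cg_of_int: "[a = b] (mod int p ^ 2) \<Longrightarrow> cg 2 (of_int a) (of_int b)"
  by (simp add: cg_of_int_iff)

lemma split_sum_cg:
  assumes "{l. l \<le> h \<and> (p - 1) dvd h * s + n * l} = L" "{k. k < h + p \<and> (p - 1) dvd h * s + n * k} = K"
  shows "cg 2 (of_int (split_sum s n 1)) ((P - 1) * (of_nat (\<Sum>l\<in>L. h choose l) + P * (of_nat h * of_nat (\<Sum>k\<in>K. conv k))))"
proof -
  have "cg 2 (of_int (split_sum s n 1)) (of_int ((int p - 1) * (int (\<Sum>l\<in>L. h choose l) + int p * int h * int (\<Sum>k\<in>K. conv k))))"
    using cg_of_int[OF split_sum_cong[of s n]] unfolding assms .
  then show ?thesis by (simp add: mult.assoc)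
qed

lemma cubic_alpha:
  assumes p: "p = 6 * e + 1"
  shows "cg 2 (of_int (split_sum 0 3 1 + 1)) ((P - 1) * (of_nat (h choose e) + P * (of_nat h * of_nat (conv e + conv (h - e) + conv (h + e)))))"
proof -
  have h: "h = 3 * e" "e > 0" "p - 1 = 6 * e" using p p_eq h_pos by auto
  have dv: "(p - 1) dvd h * 0 + 3 * k \<longleftrightarrow> (\<exists>i. k = 2 * e * i)" for k
    unfolding h(3) by (auto simp: dvd_def)
  have L: "{l. l \<le> h \<and> (p - 1) dvd h * 0 + 3 * l} = {0, 2 * e}"
  proof -
    have "i = 0 \<or> i = 1" if "2 * e * i \<le> 3 * e" for i
    proof -
      have "e * (2 * i) \<le> e * 3" using that by (simp add: mult_ac)
      then have "2 * i \<le> 3" using h by (simp only: mult_le_cancel1)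
      then show ?thesis by auto
    qed
    then show ?thesis unfolding dv unfolding h(1) by (auto intro: exI[of _ 0] exI[of _ 1])
  qed
  have K: "{k. k < h + p \<and> (p - 1) dvd h * 0 + 3 * k} = {0, 2 * e, 4 * e, 6 * e, 8 * e}"
  proof -
    have bound: "i \<in> {0, 1, 2, 3, 4}" if "2 * e * i < 3 * e + (6 * e + 1)" for i
    proof -
      have "e * (2 * i) \<le> e * 9" using that by linarith
      then have "2 * i \<le> 9" using h by (simp only: mult_le_cancel1)
      then show ?thesis by auto
    qed
    have in_set: "k \<in> {0, 2 * e, 4 * e, 6 * e, 8 * e}" if "k < h + p" "k = 2 * e * i" for k i
    proof -
      have "2 * e * i < 3 * e + (6 * e + 1)" using that h(1) p by linarith
      from bound[OF this] show ?thesis using that(2) by auto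
    qed
    have witness: "\<exists>i. k = 2 * e * i" if "k \<in> {0, 2 * e, 4 * e, 6 * e, 8 * e}" for k
      using that by (auto intro: exI[of _ 0] exI[of _ 1] exI[of _ 2] exI[of _ 3] exI[of _ 4])
    show ?thesis unfolding dv
    proof (rule subset_antisym; rule subsetI)
      fix k assume "k \<in> {k. k < h + p \<and> (\<exists>i. k = 2 * e * i)}"
      then obtain i where "k < h + p" "k = 2 * e * i" by (elim CollectE conjE exE)
      then show "k \<in> {0, 2 * e, 4 * e, 6 * e, 8 * e}" by (rule in_set)
    next
      fix k assume k: "k \<in> {0, 2 * e, 4 * e, 6 * e, 8 * e}"
      then have "k \<le> 8 * e" by auto
      then have "k < h + p" using h(1,2) p by linarith
      with witness[OF k] show "k \<in> {k. k < h + p \<and> (\<exists>i. k = 2 * e * i)}" by (intro CollectI conjI)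
    qed
  qed
  have c: "h choose (2 * e) = h choose e" using binomial_symmetric[of e h] h by simp
  have "conv 0 = 0" by (simp add: conv_def)
  moreover have "conv (8 * e) = conv e" using conv_sym[of e] h p by simp
  ultimately have Ks: "(\<Sum>k\<in>{0, 2 * e, 4 * e, 6 * e, 8 * e}. conv k) = conv e + conv (h - e) + conv (h + e) + conv (h + h)"
    using h by simp
  have Ls: "(\<Sum>l\<in>{0, 2 * e}. h choose l) = 1 + (h choose e)" using h c by simp
  let ?Y = "of_nat h * of_nat (conv e + conv (h - e) + conv (h + e)) :: rat"
  let ?Z = "of_nat h * of_nat (conv (h + h)) :: rat"
  have id: "(P - 1) * (of_nat (1 + c) + P * (of_nat h * of_nat (a + b))) + 1
      = (P - 1) * (of_nat c + P * (of_nat h * of_nat a)) + (P - 1) * (1 + P * (of_nat h * of_nat b)) + 1" for a b c :: nat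
    by (simp add: algebra_simps)
  have "cg 2 (of_int (split_sum 0 3 1)) ((P - 1) * (of_nat (1 + (h choose e)) + P * (of_nat h * of_nat (conv e + conv (h - e) + conv (h + e) + conv (h + h)))))"
    using split_sum_cg[OF L K] unfolding Ks Ls .
  then have "cg 2 (of_int (split_sum 0 3 1) + 1) ((P - 1) * (of_nat (h choose e) + P * ?Y) + (P - 1) * (1 + P * ?Z) + 1)"
    unfolding id[symmetric] by (rule cg_add[OF _ cg_refl[OF Zp_1]])
  also have "cg 2 \<dots> ((P - 1) * (of_nat (h choose e) + P * ?Y) + (P - 1) * (1 + P * 1) + 1)"
  proof -
    have "cg 1 ?Z 1" using conv_middle[of h] by simp
    then have "cg 2 (P * ?Z) (P * 1)" by (rule cg_P_mult2)
    then show ?thesis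
      by (intro cg_add[OF cg_add[OF cg_refl cg_mult_left[OF cg_add[OF cg_refl]]] cg_refl] Zp_rules Zp_of_nat Zp_1)
  qed
  also have "cg 2 \<dots> ((P - 1) * (of_nat (h choose e) + P * ?Y))"
  proof (rule cgI)
    show "y + (P - 1) * (1 + P * 1) + 1 = y + P ^ 2 * 1" for y :: rat
      by (simp add: power2_eq_square algebra_simps)
  qed (intro Zp_rules Zp_of_nat Zp_1)+
  finally show ?thesis by simp
qed

lemma quartic_alpha:
  assumes p: "p = 4 * f + 1"
  shows "cg 2 (of_int (split_sum 1 2 1)) ((P - 1) * (of_nat (h choose f) + P * (of_nat h * of_nat (conv f + conv (h - f) + conv (h + f)))))"
proof -
  have h: "h = 2 * f" "f > 0" "p - 1 = 4 * f" using p p_eq h_pos by auto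
  have dv: "(p - 1) dvd h * 1 + 2 * k \<longleftrightarrow> (\<exists>i. k = f * (2 * i + 1))" for k
  proof
    assume "(p - 1) dvd h * 1 + 2 * k"
    then obtain j where "2 * f + 2 * k = 4 * f * j" unfolding h(3) h(1) by (auto simp: dvd_def)
    then have j: "f + k = 2 * f * j" by simp
    then have "j > 0" using h by (auto intro: gr0I)
    then obtain i where "j = Suc i" by (auto simp: gr0_conv_Suc)
    then have "k = f * (2 * i + 1)" using j by (simp add: algebra_simps)
    then show "\<exists>i. k = f * (2 * i + 1)" ..
  next
    assume "\<exists>i. k = f * (2 * i + 1)"
    then obtain i where "k = f * (2 * i + 1)" ..
    then have "h * 1 + 2 * k = 4 * f * (i + 1)" using h by (simp add: algebra_simps)
    then show "(p - 1) dvd h * 1 + 2 * k" unfolding h(3) by simp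
  qed
  have bd: "2 * i + 1 \<le> c" if "f * (2 * i + 1) \<le> f * c" for i c
    using that h by (simp only: mult_le_cancel1)
  have L: "{l. l \<le> h \<and> (p - 1) dvd h * 1 + 2 * l} = {f}"
  proof -
    have "i = 0" if "f * (2 * i + 1) \<le> 2 * f" for i using bd[of i 2] that by (simp add: mult.commute)
    then show ?thesis unfolding dv unfolding h(1) by (auto intro: exI[of _ 0])
  qed
  have K: "{k. k < h + p \<and> (p - 1) dvd h * 1 + 2 * k} = {f, 3 * f, 5 * f}"
  proof -
    have in_set: "k \<in> {f, 3 * f, 5 * f}" if "k < h + p" "k = f * (2 * i + 1)" for k i
    proof -
      have "k < 6 * f + 1" using that(1) h(1) p by linarith
      then have "f * (2 * i + 1) \<le> f * 6" unfolding that(2) by linarith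
      then have "i = 0 \<or> i = 1 \<or> i = 2" using bd[of i 6] by auto
      then show ?thesis using that by auto
    qed
    have witness: "\<exists>i. k = f * (2 * i + 1)" if "k \<in> {f, 3 * f, 5 * f}" for k
      using that by (auto intro: exI[of _ 0] exI[of _ 1] exI[of _ 2])
    show ?thesis unfolding dv
    proof (rule subset_antisym; rule subsetI)
      fix k assume "k \<in> {k. k < h + p \<and> (\<exists>i. k = f * (2 * i + 1))}"
      then obtain i where "k < h + p" "k = f * (2 * i + 1)" by (elim CollectE conjE exE)
      then show "k \<in> {f, 3 * f, 5 * f}" by (rule in_set)
    next
      fix k assume k: "k \<in> {f, 3 * f, 5 * f}"
      then have "k \<le> 5 * f" by auto
      then have "k < h + p" using h(1,2) p by linarith
      with witness[OF k] show "k \<in> {k. k < h + p \<and> (\<exists>i. k = f * (2 * i + 1))}" by (intro CollectI conjI)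
    qed
  qed
  have "conv (5 * f) = conv f" using conv_sym[of f] h p by simp
  then have Ks: "(\<Sum>k\<in>{f, 3 * f, 5 * f}. conv k) = conv f + conv (h - f) + conv (h + f)"
    using h by simp
  show ?thesis using split_sum_cg[OF L K] unfolding Ks by simp
qed

lemma octic_alpha:
  assumes p: "p = 8 * e + 1" and T: "split_sum 1 4 1 = 2 * t"
  shows "cg 2 (of_int t) ((P - 1) * (of_nat (h choose e) + P * (of_nat h * of_nat (conv e + conv (h - e) + conv (h + e)))))"
proof -
  have h: "h = 4 * e" "e > 0" "p - 1 = 8 * e" using p p_eq h_pos by auto
  have dv: "(p - 1) dvd h * 1 + 4 * k \<longleftrightarrow> (\<exists>i. k = e * (2 * i + 1))" for k
  proof
    assume "(p - 1) dvd h * 1 + 4 * k"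
    then obtain j where "4 * e + 4 * k = 8 * e * j" unfolding h(3) h(1) by (auto simp: dvd_def)
    then have j: "e + k = 2 * e * j" by simp
    then have "j > 0" using h by (auto intro: gr0I)
    then obtain i where "j = Suc i" by (auto simp: gr0_conv_Suc)
    then have "k = e * (2 * i + 1)" using j by (simp add: algebra_simps)
    then show "\<exists>i. k = e * (2 * i + 1)" ..
  next
    assume "\<exists>i. k = e * (2 * i + 1)"
    then obtain i where "k = e * (2 * i + 1)" ..
    then have "h * 1 + 4 * k = 8 * e * (i + 1)" using h by (simp add: algebra_simps)
    then show "(p - 1) dvd h * 1 + 4 * k" unfolding h(3) by simp
  qed
  have bd: "2 * i + 1 \<le> c" if "e * (2 * i + 1) \<le> e * c" for i c
    using that h by (simp only: mult_le_cancel1)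
  have L: "{l. l \<le> h \<and> (p - 1) dvd h * 1 + 4 * l} = {e, 3 * e}"
  proof -
    have "i = 0 \<or> i = 1" if "e * (2 * i + 1) \<le> 4 * e" for i using bd[of i 4] that by (auto simp: mult.commute)
    then have "l \<in> {e, 3 * e}" if "l \<le> h" "l = e * (2 * i + 1)" for l i using that h by force
    moreover have "\<exists>i. k = e * (2 * i + 1)" if "k \<in> {e, 3 * e}" for k
      using that by (auto intro: exI[of _ 0] exI[of _ 1])
    ultimately show ?thesis unfolding dv using h by auto
  qed
  have K: "{k. k < h + p \<and> (p - 1) dvd h * 1 + 4 * k} = {e, 3 * e, 5 * e, 7 * e, 9 * e, 11 * e}"
  proof -
    have in_set: "k \<in> {e, 3 * e, 5 * e, 7 * e, 9 * e, 11 * e}" if "k < h + p" "k = e * (2 * i + 1)" for k i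
    proof -
      have "k < 12 * e + 1" using that(1) h(1) p by linarith
      then have "e * (2 * i + 1) \<le> e * 12" unfolding that(2) by linarith
      then have "i = 0 \<or> i = 1 \<or> i = 2 \<or> i = 3 \<or> i = 4 \<or> i = 5" using bd[of i 12] by auto
      then show ?thesis using that by auto
    qed
    have witness: "\<exists>i. k = e * (2 * i + 1)" if "k \<in> {e, 3 * e, 5 * e, 7 * e, 9 * e, 11 * e}" for k
      using that by (auto intro: exI[of _ 0] exI[of _ 1] exI[of _ 2] exI[of _ 3] exI[of _ 4] exI[of _ 5])
    show ?thesis unfolding dv
    proof (rule subset_antisym; rule subsetI)
      fix k assume "k \<in> {k. k < h + p \<and> (\<exists>i. k = e * (2 * i + 1))}"
      then obtain i where "k < h + p" "k = e * (2 * i + 1)" by (elim CollectE conjE exE)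
      then show "k \<in> {e, 3 * e, 5 * e, 7 * e, 9 * e, 11 * e}" by (rule in_set)
    next
      fix k assume k: "k \<in> {e, 3 * e, 5 * e, 7 * e, 9 * e, 11 * e}"
      then have "k \<le> 11 * e" by auto
      then have "k < h + p" using h(1,2) p by linarith
      with witness[OF k] show "k \<in> {k. k < h + p \<and> (\<exists>i. k = e * (2 * i + 1))}" by (intro CollectI conjI)
    qed
  qed
  have c: "h choose (3 * e) = h choose e" using binomial_symmetric[of e h] h by simp
  have "conv (11 * e) = conv e" "conv (9 * e) = conv (3 * e)" "conv (7 * e) = conv (5 * e)"
    using conv_sym[of e] conv_sym[of "3 * e"] conv_sym[of "5 * e"] h p by simp_all
  then have Ks: "(\<Sum>k\<in>{e, 3 * e, 5 * e, 7 * e, 9 * e, 11 * e}. conv k) = 2 * (conv e + conv (h - e) + conv (h + e))"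
    using h by simp
  have Ls: "(\<Sum>l\<in>{e, 3 * e}. h choose l) = 2 * (h choose e)" using h c by simp
  have id: "(P - 1) * (of_nat (2 * c) + P * (of_nat h * of_nat (2 * a)))
      = 2 * ((P - 1) * (of_nat c + P * (of_nat h * of_nat a)))" for a c :: nat
    by (simp add: algebra_simps)
  have "cg 2 (of_int (2 * t)) ((P - 1) * (of_nat (2 * (h choose e)) + P * (of_nat h * of_nat (2 * (conv e + conv (h - e) + conv (h + e))))))"
    using split_sum_cg[OF L K] unfolding Ks Ls T .
  then have D: "cg 2 (2 * of_int t) (2 * ((P - 1) * (of_nat (h choose e) + P * (of_nat h * of_nat (conv e + conv (h - e) + conv (h + e))))))"
    by (simp only: id of_int_mult of_int_numeral)
  have "\<not> p dvd 2" using p_gt_2 by (auto dest: dvd_imp_le)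
  then have "unit (of_nat 2)" by (rule unit_nat)
  then have "unit 2" by simp
  then show ?thesis by (rule cg_unit_cancel[OF _ D]) (intro Zp_rules Zp_of_int Zp_of_nat Zp_1)+
qed

lemma G3_split:
  assumes "p = 6 * e + 1" "int p = u ^ 2 + 3 * v ^ 2"
  shows "cg 2 (G h (-1 / 3)) (4 * of_int u ^ 2 - 2 * P)"
proof -
  obtain t w where t: "split_sum 0 3 1 + 1 = 2 * t" "int p = t ^ 2 + 3 * w ^ 2" using cubic_sum[OF assms(1)] .
  have "t ^ 2 = u ^ 2" 
    by (rule representation_unique[OF _ _ t(2) assms(2)]) (use prime_p in auto)
  then have "(of_int t :: rat) ^ 2 = of_int u ^ 2" by (metis of_int_power)
  then have tu: "(of_int (2 * t) :: rat) ^ 2 = 4 * of_int u ^ 2" by (simp add: power_mult_distrib)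
  have "cg 2 (G h (- 1 / of_nat 3)) (of_int (2 * t) ^ 2 - 2 * P)"
  proof (rule G_CM_split)
    show "p = 2 * 3 * e + 1" using assms(1) by simp
  qed (simp, rule cubic_alpha[OF assms(1), unfolded t(1)])
  then show ?thesis unfolding tu by (simp only: of_nat_numeral)
qed

lemma G4_split:
  assumes "p = 8 * e + 1" "int p = u ^ 2 + 2 * v ^ 2"
  shows "cg 2 (G h (-1 / 4)) (4 * of_int u ^ 2 - 2 * P)"
proof -
  obtain t w where t: "split_sum 1 4 1 = 4 * t" "int p = t ^ 2 + 2 * w ^ 2" using octic_sum[OF assms(1)] .
  have "t ^ 2 = u ^ 2" 
    by (rule representation_unique[OF _ _ t(2) assms(2)]) (use prime_p in auto)
  then have "(of_int t :: rat) ^ 2 = of_int u ^ 2" by (metis of_int_power)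
  then have tu: "(of_int (2 * t) :: rat) ^ 2 = 4 * of_int u ^ 2" by (simp add: power_mult_distrib)
  have "cg 2 (G h (- 1 / of_nat 4)) (of_int (2 * t) ^ 2 - 2 * P)"
  proof (rule G_CM_split)
    show "p = 2 * 4 * e + 1" using assms(1) by simp
    have "split_sum 1 4 1 = 2 * (2 * t)" using t(1) by simp
    then show "cg 2 (of_int (2 * t)) ((P - 1) * (of_nat (h choose e) + P * (of_nat h * of_nat (conv e + conv (h - e) + conv (h + e)))))"
      by (rule octic_alpha[OF assms(1)])
  qed simp
  then show ?thesis unfolding tu by (simp only: of_nat_numeral)
qed

lemma quartic_binomial:
  assumes "p = 4 * f + 1" "int p = u ^ 2 + 4 * v ^ 2"
  shows "cg 2 (of_nat (h choose f) ^ 2 * (1 - P * (H h - H f))) (4 * of_int u ^ 2 - 2 * P)"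
proof -
  obtain t w where t: "split_sum 1 2 1 = 2 * t" "int p = t ^ 2 + 4 * w ^ 2" using quartic_sum[OF assms(1)] .
  have "t ^ 2 = u ^ 2" 
    by (rule representation_unique[OF _ _ t(2) assms(2)]) (use prime_p in auto)
  then have tu: "(of_int (2 * t) :: rat) ^ 2 = 4 * of_int u ^ 2" by (simp add: power_mult_distrib) (metis of_int_power)
  have h: "h = 2 * f" "0 < f" "f < h" "h - f = f" using assms(1) p_eq h_pos by auto
  let ?C = "of_nat (h choose f) :: rat"
  let ?X = "of_nat h * H h - of_nat f * H f - of_nat (h - f) * H (h - f)"
  have a: "cg 2 (?C ^ 2 * (1 + 2 * P * ?X)) (4 * of_int u ^ 2 - 2 * P)"
    using split_alpha[OF h(2,3)] quartic_alpha[OF assms(1)] unfolding t(1) tu[symmetric] by blast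
  have Hz: "H h \<in> Zp p" "H f \<in> Zp p" using h h_less_p by (auto intro!: H_Zp)
  have "cg 2 (?C ^ 2 * (1 + 2 * P * ?X)) (?C ^ 2 * (1 - P * (H h - H f)))"
  proof (rule cgI)
    show "?C ^ 2 * (1 - P * (H h - H f)) \<in> Zp p" by (intro Zp_rules Hz Zp_of_nat Zp_1)
    show "?C ^ 2 * (H h - H f) \<in> Zp p" by (intro Zp_rules Hz Zp_of_nat)
    have "2 * ?X = 2 * of_nat h * (H h - H f)" using h by (simp add: algebra_simps)
    also have "2 * of_nat h = P - 1" using P_eq by simp
    finally have "2 * P * ?X = P * ((P - 1) * (H h - H f))" by (metis mult.assoc mult.commute)
    then show "?C ^ 2 * (1 + 2 * P * ?X) = ?C ^ 2 * (1 - P * (H h - H f)) + P ^ 2 * (?C ^ 2 * (H h - H f))"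
      by (simp only:) (simp add: power2_eq_square algebra_simps)
  qed
  from cg_trans[OF cg_sym[OF this] a] show ?thesis .
qed

end

section \<open>Gaussian integers modulo \<open>p\<^sup>2\<close>\<close>

text \<open>The ring of Gaussian integers; modulo a prime \<open>p \<equiv> 3 (mod 4)\<close> it is the field with \<open>p^2\<close> elements.\<close>
datatype gauss = Gauss (gre: int) (gim: int)

instantiation gauss :: comm_ring_1
begin

definition "0 = Gauss 0 0"
definition "1 = Gauss 1 0"
definition "z + w = Gauss (gre z + gre w) (gim z + gim w)"
definition "- z = Gauss (- gre z) (- gim z)"
definition "z - w = Gauss (gre z - gre w) (gim z - gim w)"
definition "z * w = Gauss (gre z * gre w - gim z * gim w) (gre z * gim w + gim z * gre w)"

instance
  by standard
    (auto simp: zero_gauss_def one_gauss_def plus_gauss_def uminus_gauss_def minus_gauss_def times_gauss_def algebra_simps)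

end

lemma gauss_simps [simp]:
  "gre 0 = 0" "gim 0 = 0" "gre 1 = 1" "gim 1 = 0"
  "gre (z + w) = gre z + gre w" "gim (z + w) = gim z + gim w"
  "gre (- z) = - gre z" "gim (- z) = - gim z"
  "gre (z - w) = gre z - gre w" "gim (z - w) = gim z - gim w"
  "gre (z * w) = gre z * gre w - gim z * gim w" "gim (z * w) = gre z * gim w + gim z * gre w"
  by (simp_all add: zero_gauss_def one_gauss_def plus_gauss_def uminus_gauss_def minus_gauss_def times_gauss_def)

lemma gauss_eqI: "gre z = gre w \<Longrightarrow> gim z = gim w \<Longrightarrow> z = w"
  by (cases z; cases w) simp

lemma gauss_of_nat [simp]: "gre (of_nat n) = int n" "gim (of_nat n) = 0"
  by (induction n) simp_all

lemma gauss_of_int [simp]: "gre (of_int k) = k" "gim (of_int k) = 0"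
  by (cases k; simp)+

lemma of_int_dvd_gauss_iff: "of_int k dvd z \<longleftrightarrow> k dvd gre z \<and> k dvd gim z"
proof
  assume "k dvd gre z \<and> k dvd gim z"
  then obtain a b where "gre z = k * a" "gim z = k * b" by (auto simp: dvd_def)
  then have "z = of_int k * Gauss a b" by (intro gauss_eqI) simp_all
  then show "of_int k dvd z" by simp
qed (auto simp: dvd_def)

lemma of_nat_dvd_gauss_iff: "of_nat n dvd z \<longleftrightarrow> int n dvd gre z \<and> int n dvd gim z"
  using of_int_dvd_gauss_iff[of "int n" z] by simp

lemma gauss_numeral [simp]: "gre (numeral k) = numeral k" "gim (numeral k) = 0"
  using gauss_of_nat[of "numeral k"] by simp_all

definition gcnj :: "gauss \<Rightarrow> gauss" where "gcnj z = Gauss (gre z) (- gim z)"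
definition gnrm :: "gauss \<Rightarrow> int" where "gnrm z = gre z ^ 2 + gim z ^ 2"
definition gtr :: "gauss \<Rightarrow> int" where "gtr z = 2 * gre z"

lemma gcnj_simps [simp]: "gre (gcnj z) = gre z" "gim (gcnj z) = - gim z"
  by (simp_all add: gcnj_def)

lemma gcnj_mult: "gcnj (z * w) = gcnj z * gcnj w"
  by (rule gauss_eqI) (simp_all add: algebra_simps)

lemma gcnj_1 [simp]: "gcnj 1 = 1"
  by (rule gauss_eqI) simp_all

lemma gcnj_power: "gcnj (z ^ n) = gcnj z ^ n"
  by (induction n) (simp_all add: gcnj_mult)

lemma mult_gcnj: "z * gcnj z = of_int (gnrm z)"
  by (rule gauss_eqI) (simp_all add: gnrm_def power2_eq_square)

lemma gtr_conv: "of_int (gtr z) = z + gcnj z"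
  by (rule gauss_eqI) (simp_all add: gtr_def)

definition dcong :: "'a::comm_ring_1 \<Rightarrow> 'a \<Rightarrow> 'a \<Rightarrow> bool" where
  "dcong m a b \<longleftrightarrow> m dvd a - b"

lemma dcong_refl [simp]: "dcong m a a"
  by (simp add: dcong_def)

lemma dcong_sym: "dcong m a b \<Longrightarrow> dcong m b a"
  unfolding dcong_def by (metis dvd_minus_iff minus_diff_eq)

lemma dcong_trans: "dcong m a b \<Longrightarrow> dcong m b c \<Longrightarrow> dcong m a c"
  unfolding dcong_def using dvd_add[of m "a - b" "b - c"] by simp

lemma dcong_add: "dcong m a b \<Longrightarrow> dcong m c d \<Longrightarrow> dcong m (a + c) (b + d)"
  unfolding dcong_def using dvd_add[of m "a - b" "c - d"] by (simp add: algebra_simps)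

lemma dcong_mult: assumes "dcong m a b" "dcong m c d" shows "dcong m (a * c) (b * d)"
proof -
  have "a * c - b * d = (a - b) * c + b * (c - d)" by (simp add: algebra_simps)
  then show ?thesis using assms unfolding dcong_def by simp
qed

lemma dcong_power: "dcong m a b \<Longrightarrow> dcong m (a ^ n) (b ^ n)"
  by (induction n) (auto intro: dcong_mult)

lemma dcong_sum: "(\<And>i. i \<in> A \<Longrightarrow> dcong m (f i) (g i)) \<Longrightarrow> dcong m (sum f A) (sum g A)"
  by (induction A rule: infinite_finite_induct) (auto intro: dcong_add)

lemma sum_shift_cyclic:
  fixes f :: "nat \<Rightarrow> 'a::ab_group_add"
  assumes "f N = f 0"
  shows "(\<Sum>i<N. f (Suc i)) = (\<Sum>i<N. f i)"
proof -
  have "(\<Sum>i<N. f i) + f N = (\<Sum>i<Suc N. f i)" by simp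
  also have "\<dots> = f 0 + (\<Sum>i<N. f (Suc i))" by (rule sum.lessThan_Suc_shift)
  finally show ?thesis using assms by (simp add: add.commute)
qed

locale prime_3_mod_8 = odd_prime +
  fixes e :: nat
  assumes p_form: "p = 8 * e + 3"
begin

abbreviation gc :: "gauss \<Rightarrow> gauss \<Rightarrow> bool" where "gc \<equiv> dcong (of_nat p)"

lemma h_form: "h = 4 * e + 1"
  using p_form p_eq by linarith

lemma gc_iff: "gc z w \<longleftrightarrow> [gre z = gre w] (mod int p) \<and> [gim z = gim w] (mod int p)"
  by (simp add: dcong_def of_nat_dvd_gauss_iff cong_iff_dvd_diff)

lemma leg_minus_1: "leg (-1) = -1"
proof -
  have "[leg (-1) = (-1) ^ h] (mod int p)" by (rule leg_euler)
  also have "(-1 :: int) ^ h = -1" unfolding h_form by simp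
  finally show ?thesis using leg_unique leg_cases by blast
qed

lemma gnrm_dvd: assumes "int p dvd gnrm z" shows "of_nat p dvd z"
proof -
  have "int p dvd gim z"
  proof (rule ccontr)
    assume n: "\<not> int p dvd gim z"
    have "[gre z ^ 2 = -1 * gim z ^ 2] (mod int p)"
      using assms by (simp add: gnrm_def cong_iff_dvd_diff)
    then have "leg (gre z ^ 2) = leg (-1 * gim z ^ 2)" by (rule leg_cong)
    also have "\<dots> = -1" using leg_square[OF n] by (simp only: leg_mult leg_minus_1 leg_power power2_eq_square)
    finally show False using leg_cases[of "gre z"] by (auto simp: leg_power)
  qed
  moreover from this have "int p dvd gre z ^ 2"
    using assms unfolding gnrm_def by (metis dvd_add_left_iff dvd_power_le le_numeral_extra(4) one_le_numeral dvd_mult power2_eq_square)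
  then have "int p dvd gre z" using prime_p by (metis prime_dvd_power prime_nat_int_transfer)
  ultimately show ?thesis by (simp add: of_nat_dvd_gauss_iff)
qed

definition gred :: "gauss \<Rightarrow> gauss" where
  "gred z = Gauss (gre z mod int p) (gim z mod int p)"

lemma gred_eq_iff: "gred z = gred w \<longleftrightarrow> gc z w"
  by (auto simp: gred_def gc_iff cong_def)

lemma gc_gred: "gc (gred z) z"
  by (simp add: gc_iff gred_def cong_def)

lemma gred_gred [simp]: "gred (gred z) = gred z"
  by (simp add: gred_def)

definition GF :: "gauss ring" where
  "GF = \<lparr>carrier = range gred, mult = \<lambda>x y. gred (x * y), one = 1, zero = 0, add = \<lambda>x y. gred (x + y)\<rparr>"

lemma GF_simps:
  "carrier GF = range gred" "x \<otimes>\<^bsub>GF\<^esub> y = gred (x * y)" "\<one>\<^bsub>GF\<^esub> = 1" "\<zero>\<^bsub>GF\<^esub> = 0" "x \<oplus>\<^bsub>GF\<^esub> y = gred (x + y)"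
  by (simp_all add: GF_def)

lemma carrier_GF: "carrier GF = (\<lambda>(x, y). Gauss x y) ` ({0..<int p} \<times> {0..<int p})"
proof -
  have "gred z \<in> (\<lambda>(x, y). Gauss x y) ` ({0..<int p} \<times> {0..<int p})" for z
    using p_gt_2 by (auto simp: gred_def)
  moreover have "Gauss x y \<in> range gred" if "x \<in> {0..<int p}" "y \<in> {0..<int p}" for x y
    using that by (intro range_eqI[of _ _ "Gauss x y"]) (simp add: gred_def)
  ultimately show ?thesis by (auto simp: GF_simps)
qed

lemma finite_GF: "finite (carrier GF)" and card_GF: "card (carrier GF) = p ^ 2"
proof -
  have inj: "inj_on (\<lambda>(x, y). Gauss x y) ({0..<int p} \<times> {0..<int p})" by (auto simp: inj_on_def)
  show "finite (carrier GF)" unfolding carrier_GF by simp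
  show "card (carrier GF) = p ^ 2" unfolding carrier_GF by (simp add: card_image[OF inj] card_cartesian_product power2_eq_square)
qed

lemma gred_id: "x \<in> carrier GF \<Longrightarrow> gred x = x"
  by (auto simp: GF_simps)

lemma gred_01 [simp]: "gred 0 = 0" "gred 1 = 1"
  using p_gt_2 by (auto simp: gred_def intro: gauss_eqI)

lemma gauss_inverse: assumes "\<not> of_nat p dvd z" obtains w where "gc (z * w) 1"
proof -
  have "\<not> int p dvd gnrm z" using assms gnrm_dvd by blast
  then obtain k where k: "[gnrm z * k = 1] (mod int p)" by (rule unit_inverse_mod)
  have "gc (z * (gcnj z * of_int k)) 1"
    unfolding mult.assoc[symmetric] mult_gcnj using k by (simp add: gc_iff)
  then show ?thesis by (rule that)
qed

lemma gred_mult_left: "gred (gred x * y) = gred (x * y)"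
  unfolding gred_eq_iff by (intro dcong_mult gc_gred) simp

lemma gred_mult_right: "gred (x * gred y) = gred (x * y)"
  unfolding gred_eq_iff by (intro dcong_mult gc_gred) simp

lemma gred_add_left: "gred (gred x + y) = gred (x + y)"
  unfolding gred_eq_iff by (intro dcong_add gc_gred) simp

lemma gred_add_right: "gred (x + gred y) = gred (x + y)"
  unfolding gred_eq_iff by (intro dcong_add gc_gred) simp

lemmas gred_ring = gred_mult_left gred_mult_right gred_add_left gred_add_right

lemma field_GF: "field GF"
proof -
  have "abelian_group GF"
  proof (rule abelian_groupI)
    show "\<zero>\<^bsub>GF\<^esub> \<in> carrier GF" unfolding GF_simps by (rule range_eqI[of _ _ 0]) simp
    show "\<exists>y\<in>carrier GF. y \<oplus>\<^bsub>GF\<^esub> x = \<zero>\<^bsub>GF\<^esub>" if "x \<in> carrier GF" for x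
      unfolding GF_simps by (rule bexI[of _ "gred (- x)"]) (simp_all add: gred_ring)
  qed (auto simp: GF_simps gred_ring algebra_simps)
  moreover have "comm_monoid GF"
  proof (rule comm_monoidI)
    show "\<one>\<^bsub>GF\<^esub> \<in> carrier GF" unfolding GF_simps by (rule range_eqI[of _ _ 1]) simp
  qed (auto simp: GF_simps gred_ring mult_ac)
  ultimately interpret cring GF
    by (rule cringI) (simp add: GF_simps gred_ring algebra_simps)
  show ?thesis
  proof (rule cring_fieldI2)
    have "gre 1 \<noteq> gre 0" by simp
    then show "\<zero>\<^bsub>GF\<^esub> \<noteq> \<one>\<^bsub>GF\<^esub>" unfolding GF_simps by metis
    fix x assume x: "x \<in> carrier GF" "x \<noteq> \<zero>\<^bsub>GF\<^esub>"
    have "\<not> of_nat p dvd x"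
    proof
      assume "of_nat p dvd x"
      then have "gred x = gred 0" unfolding gred_eq_iff dcong_def by simp
      then show False using x gred_id[OF x(1)] by (simp add: GF_simps)
    qed
    then obtain w where "gc (x * w) 1" by (rule gauss_inverse)
    then have "gred (x * w) = 1" unfolding gred_eq_iff[symmetric] by simp
    then show "\<exists>b\<in>carrier GF. x \<otimes>\<^bsub>GF\<^esub> b = \<one>\<^bsub>GF\<^esub>"
      unfolding GF_simps by (intro bexI[of _ "gred w"]) (simp_all add: gred_ring)
  qed
qed

definition generator :: "gauss \<Rightarrow> bool" where
  "generator g \<longleftrightarrow> (\<forall>z. \<not> of_nat p dvd z \<longrightarrow> (\<exists>i. gc z (g ^ i))) \<and> (\<forall>n. gc (g ^ n) 1 \<longleftrightarrow> (p ^ 2 - 1) dvd n)"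

lemma generator_exists: "\<exists>g. generator g"
proof -
  interpret field GF by (rule field_GF)
  interpret M: group "mult_of GF" by (rule field_mult_group)
  obtain a where a: "a \<in> carrier (mult_of GF)" "carrier (mult_of GF) = {a [^]\<^bsub>GF\<^esub> i | i::nat. i \<in> UNIV}"
    using finite_field_mult_group_has_gen[OF finite_GF] by blast
  have pw: "x [^]\<^bsub>GF\<^esub> i = gred (x ^ i)" for x and i :: nat
    by (induction i) (simp_all add: GF_simps gred_ring mult.commute nat_pow_def)
  have fin: "finite (carrier (mult_of GF))" using finite_GF by (rule finite_mult_of)
  have pw': "x [^]\<^bsub>mult_of GF\<^esub> i = gred (x ^ i)" for x and i :: nat
    by (simp add: nat_pow_mult_of pw)
  have "M.ord a = card (carrier (mult_of GF))"
  proof -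
    have "M.ord a \<ge> 1" using M.ord_ge_1[OF fin a(1)] .
    have "carrier (mult_of GF) = {a [^]\<^bsub>mult_of GF\<^esub> i | i. i \<in> (UNIV :: nat set)}" using a(2) by (simp add: nat_pow_mult_of)
    also have "\<dots> = {a [^]\<^bsub>mult_of GF\<^esub> i | i. i \<in> {0 .. M.ord a - 1}}" by (rule M.ord_elems[OF fin a(1)])
    also have "\<dots> = (\<lambda>i. a [^]\<^bsub>mult_of GF\<^esub> i) ` {0 .. M.ord a - 1}" by auto
    finally have "card (carrier (mult_of GF)) = card {0 .. M.ord a - 1}"
      using card_image[OF M.ord_inj[OF a(1)]] by simp
    then show ?thesis using \<open>M.ord a \<ge> 1\<close> by simp
  qed
  also have "\<dots> = p ^ 2 - 1"
    using card_GF finite_GF zero_closed by (simp add: carrier_mult_of)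
  finally have o: "M.ord a = p ^ 2 - 1" .
  have "gc (a ^ n) 1 \<longleftrightarrow> (p ^ 2 - 1) dvd n" for n
  proof -
    have "gc (a ^ n) 1 \<longleftrightarrow> a [^]\<^bsub>mult_of GF\<^esub> n = \<one>\<^bsub>mult_of GF\<^esub>"
      unfolding pw' gred_eq_iff[symmetric] by (simp add: GF_simps)
    then show ?thesis using M.pow_eq_id[OF a(1), of n] o by simp
  qed
  moreover have "\<exists>i. gc z (a ^ i)" if "\<not> of_nat p dvd z" for z
  proof -
    have "gred z \<noteq> gred 0" unfolding gred_eq_iff dcong_def using that by simp
    then have "gred z \<in> carrier (mult_of GF)" by (simp add: carrier_mult_of GF_simps)
    then obtain i :: nat where "gred z = a [^]\<^bsub>GF\<^esub> i" using a(2) by blast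
    then show ?thesis unfolding pw gred_eq_iff by blast
  qed
  ultimately show ?thesis unfolding generator_def by blast
qed

definition gg :: gauss where "gg = (SOME g. generator g)"

lemma gg: "generator gg"
  unfolding gg_def using generator_exists by (rule someI_ex)

lemma gg_power_1_iff: "gc (gg ^ n) 1 \<longleftrightarrow> (p ^ 2 - 1) dvd n"
  using gg by (simp add: generator_def)

lemma p_sq_minus_1: "p ^ 2 - 1 = (p + 1) * (p - 1)"
  by (simp add: power2_eq_square algebra_simps diff_mult_distrib2)

lemma gg_not_dvd: "\<not> of_nat p dvd gg ^ n"
proof
  assume "of_nat p dvd gg ^ n"
  then have "of_nat p dvd gg ^ n * gg ^ (n * (p ^ 2 - 1) - n)" by simp
  moreover have "1 \<le> (p + 1) * (p - 1)" using p_gt_2 by simp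
  then have "n * 1 \<le> n * (p ^ 2 - 1)" unfolding p_sq_minus_1 by (rule mult_le_mono2)
  then have "n \<le> n * (p ^ 2 - 1)" by simp
  then have "n + (n * (p ^ 2 - 1) - n) = n * (p ^ 2 - 1)" by (rule le_add_diff_inverse)
  ultimately have "of_nat p dvd gg ^ (n * (p ^ 2 - 1))" by (simp only: power_add[symmetric])
  moreover have "gc (gg ^ (n * (p ^ 2 - 1))) 1" by (simp add: gg_power_1_iff)
  ultimately have "of_nat p dvd gg ^ (n * (p ^ 2 - 1)) - (gg ^ (n * (p ^ 2 - 1)) - 1)"
    unfolding dcong_def by (rule dvd_diff)
  then have "of_nat p dvd (1 :: gauss)" by simp
  then have "int p dvd 1" by (simp add: of_nat_dvd_gauss_iff)
  then show False using p_gt_2 by simp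
qed

lemma power_p_conj: "gc (z ^ p) (gcnj z)"
proof -
  let ?x = "of_int (gre z) :: gauss" and ?i = "Gauss 0 1"
  have fermat: "gc (of_int x ^ p) (of_int x)" for x
  proof -
    have "[x ^ p = x] (mod int p)"
    proof (cases "int p dvd x")
      case True
      then have "int p dvd x ^ p" using p_gt_2 by (simp add: dvd_power_le[of _ _ 1, simplified] dvd_trans)
      then show ?thesis using True by (simp add: cong_iff_dvd_diff)
    next
      case False
      have "[x ^ (2 * h) * x = 1 * x] (mod int p)"
      proof (rule cong_scalar_right)
        have "[x ^ h * x ^ h = leg x * leg x] (mod int p)" by (intro cong_mult cong_sym[OF leg_euler])
        then show "[x ^ (2 * h) = 1] (mod int p)" using leg_square[OF False] by (simp add: mult_2 power_add)
      qed
      moreover have "x ^ p = x ^ (2 * h) * x" using arg_cong[OF p_eq, of "\<lambda>n. x ^ n"] by simp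
      ultimately show ?thesis by simp
    qed
    then show ?thesis by (simp add: gc_iff flip: of_int_power)
  qed
  have z: "z = ?x + of_int (gim z) * ?i" by (rule gauss_eqI) simp_all
  have ip: "?i ^ p = - ?i"
  proof -
    have "?i ^ 2 = -1" by (rule gauss_eqI) (simp_all add: power2_eq_square)
    moreover have "?i ^ p = (?i ^ 2) ^ h * ?i" using arg_cong[OF p_eq, of "\<lambda>n. ?i ^ n"] by (simp add: power_mult)
    ultimately show ?thesis unfolding h_form by (simp add: power_mult)
  qed
  have frob: "gc ((x + y) ^ p) (x ^ p + y ^ p)" for x y :: gauss
  proof -
    have "(x + y) ^ p = (\<Sum>k\<le>p. of_nat (p choose k) * x ^ k * y ^ (p - k))" by (rule binomial_ring)
    also have "{..p} = insert 0 (insert p {1..<p})" using p_gt_2 by auto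
    also have "(\<Sum>k\<in>insert 0 (insert p {1..<p}). of_nat (p choose k) * x ^ k * y ^ (p - k))
        = y ^ p + (x ^ p + (\<Sum>k\<in>{1..<p}. of_nat (p choose k) * x ^ k * y ^ (p - k)))"
      using p_gt_2 by (subst sum.insert; simp)+
    finally have "(x + y) ^ p - (x ^ p + y ^ p) = (\<Sum>k\<in>{1..<p}. of_nat (p choose k) * x ^ k * y ^ (p - k))" by simp
    moreover have "of_nat p dvd (\<Sum>k\<in>{1..<p}. of_nat (p choose k) * x ^ k * y ^ (p - k))"
      by (intro dvd_sum) (auto simp: qbin mult.assoc)
    ultimately show ?thesis by (simp add: dcong_def)
  qed
  have "gc (z ^ p) (?x ^ p + (of_int (gim z) * ?i) ^ p)" by (subst z) (rule frob)
  moreover have "gc (?x ^ p + (of_int (gim z) * ?i) ^ p) (?x + of_int (gim z) * - ?i)"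
    unfolding power_mult_distrib ip by (intro dcong_add dcong_mult fermat) simp
  moreover have "?x + of_int (gim z) * - ?i = gcnj z" by (rule gauss_eqI) simp_all
  ultimately show ?thesis by (metis dcong_trans)
qed

end

section \<open>Primes congruent to 3 modulo 8\<close>

lemma of_nat_dvd_of_int_mult:
  "of_nat n dvd of_int k * z \<Longrightarrow> coprime (int n) k \<Longrightarrow> of_nat n dvd (z :: gauss)"
  by (simp add: of_nat_dvd_gauss_iff coprime_dvd_mult_right_iff)

context prime_3_mod_8
begin

definition nn :: nat where "nn = p + 1"

lemma nn_form: "nn = 4 * (2 * e + 1)"
  unfolding nn_def using p_form by simp

lemma p_sq_nn: "p ^ 2 - 1 = nn * (p - 1)"
  unfolding p_sq_minus_1 nn_def ..

lemma int_nn: "int nn = int p + 1"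
  by (simp add: nn_def)

lemma Suc_p: "Suc p = nn"
  by (simp add: nn_def)

text \<open>A \<open>(p+1)\<close>-st root of unity modulo \<open>p^2\<close> generating the norm-one group.\<close>
definition zt :: gauss where "zt = (gg ^ (p - 1)) ^ p"

lemma zt_power_1_iff: "gc (zt ^ j) 1 \<longleftrightarrow> nn dvd j"
proof -
  have "zt ^ j = gg ^ ((p - 1) * (p * j))" by (simp add: zt_def mult.assoc flip: power_mult)
  moreover have "(p ^ 2 - 1) dvd (p - 1) * (p * j) \<longleftrightarrow> nn dvd p * j"
    unfolding p_sq_nn mult.commute[of nn] nat_mult_dvd_cancel_disj using p_gt_2 by simp
  moreover have "coprime nn p" unfolding nn_def by (metis coprime_Suc_left_nat Suc_eq_plus1)
  ultimately show ?thesis by (simp add: gg_power_1_iff coprime_dvd_mult_right_iff)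
qed

lemma dcong_p2: "gc x y \<Longrightarrow> dcong (of_nat (p ^ 2)) (x ^ p) (y ^ p)"
  unfolding dcong_def by (rule power_p_cong)

lemma zt_power_N: "dcong (of_nat (p ^ 2)) (zt ^ nn) 1"
proof -
  have "gc (gg ^ ((p - 1) * nn)) 1" unfolding gg_power_1_iff p_sq_nn by (simp add: mult.commute)
  from dcong_p2[OF this] show ?thesis by (simp add: zt_def mult_ac flip: power_mult)
qed

lemma zt_conj: "dcong (of_nat (p ^ 2)) (zt * gcnj zt) 1"
proof -
  have "gc (gcnj (gg ^ (p - 1))) ((gg ^ (p - 1)) ^ p)" by (rule dcong_sym[OF power_p_conj])
  then have "gc (gg ^ (p - 1) * gcnj (gg ^ (p - 1))) (gg ^ (p - 1) * (gg ^ (p - 1)) ^ p)" by (intro dcong_mult) simp_all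
  moreover have "gg ^ (p - 1) * (gg ^ (p - 1)) ^ p = gg ^ ((p - 1) * nn)"
    unfolding power_mult nn_def by simp
  then have "gc (gg ^ (p - 1) * (gg ^ (p - 1)) ^ p) 1"
    by (simp only: gg_power_1_iff p_sq_nn) (simp add: mult.commute)
  ultimately have "gc (gg ^ (p - 1) * gcnj (gg ^ (p - 1))) 1" by (rule dcong_trans)
  from dcong_p2[OF this] show ?thesis by (simp add: zt_def gcnj_power power_mult_distrib)
qed

lemma gc_of_p2: "dcong (of_nat (p ^ 2)) x y \<Longrightarrow> gc x y"
  unfolding dcong_def by (metis dvd_mult_left of_nat_mult power2_eq_square)

lemma gcnj_zt: "dcong (of_nat (p ^ 2)) (gcnj zt) (zt ^ p)"
proof -
  have "dcong (of_nat (p ^ 2)) (gcnj zt * zt ^ nn) (gcnj zt * 1)" by (intro dcong_mult zt_power_N) simp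
  moreover have "dcong (of_nat (p ^ 2)) ((zt * gcnj zt) * zt ^ p) (1 * zt ^ p)" by (intro dcong_mult zt_conj) simp
  ultimately have "dcong (of_nat (p ^ 2)) (gcnj zt * 1) (1 * zt ^ p)"
    by (metis (no_types, lifting) dcong_sym dcong_trans mult.assoc mult.commute power_Suc Suc_p)
  then show ?thesis by simp
qed

lemma zt_sum:
  "of_nat (p ^ 2) dvd (\<Sum>i<nn. zt ^ (j * i)) - of_nat (if nn dvd j then nn else 0 :: nat)"
proof -
  let ?z = "zt ^ j" and ?m = "of_nat (p ^ 2) :: gauss"
  have pw: "(\<Sum>i<nn. zt ^ (j * i)) = (\<Sum>i<nn. ?z ^ i)" by (simp add: power_mult)
  show ?thesis
  proof (cases "nn dvd j")
    case True
    then obtain k where "j = nn * k" ..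
    then have "dcong ?m ?z 1" using dcong_power[OF zt_power_N, of k] by (simp add: power_mult)
    then have "dcong ?m (?z ^ i) 1" for i using dcong_power[of ?m ?z 1 i] by simp
    then have "dcong ?m (\<Sum>i<nn. ?z ^ i) (\<Sum>i<nn. 1)" by (intro dcong_sum)
    then show ?thesis using True unfolding pw by (simp add: dcong_def)
  next
    case False
    have "dcong ?m (?z ^ nn) 1"
      using dcong_power[OF zt_power_N, of j] by (simp add: mult.commute flip: power_mult)
    then have d: "?m dvd (?z - 1) * (\<Sum>i<nn. ?z ^ i)" by (simp add: geometric_sum_dvd dcong_def)
    have "\<not> of_nat p dvd ?z - 1" using False zt_power_1_iff[of j] by (simp add: dcong_def)
    then have "\<not> int p dvd gnrm (?z - 1)" using gnrm_dvd by blast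
    then have cop: "coprime (int (p ^ 2)) (gnrm (?z - 1))" using prime_p by (simp add: prime_imp_coprime)
    have "?m dvd gcnj (?z - 1) * ((?z - 1) * (\<Sum>i<nn. ?z ^ i))" using d by (rule dvd_mult)
    also have "\<dots> = of_int (gnrm (?z - 1)) * (\<Sum>i<nn. ?z ^ i)"
      by (simp add: mult.commute[of _ "?z - 1"] flip: mult.assoc mult_gcnj)
    finally have "?m dvd (\<Sum>i<nn. ?z ^ i)"
      using cop by (rule of_nat_dvd_of_int_mult)
    then show ?thesis using False unfolding pw by simp
  qed
qed

definition nsum :: "gauss \<Rightarrow> int" where
  "nsum c = (\<Sum>i<nn. leg (gtr (c * zt ^ (4 * i))))"

lemma leg_gtr_cong: "gc z w \<Longrightarrow> leg (gtr z) = leg (gtr w)"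
  unfolding gtr_def by (intro leg_cong cong_mult cong_refl) (simp add: gc_iff)

lemma nsum_cong: "gc c d \<Longrightarrow> nsum c = nsum d"
  unfolding nsum_def by (intro sum.cong refl leg_gtr_cong dcong_mult) auto

lemma nsum_mult_zt: "nsum (c * zt ^ (4 * k)) = nsum c"
proof (induction k)
  case (Suc k)
  have "nsum (c * zt ^ (4 * Suc k)) = (\<Sum>i<nn. leg (gtr (c * zt ^ (4 * k) * zt ^ (4 * Suc i))))"
    unfolding nsum_def mult.assoc power_add[symmetric] by (simp add: algebra_simps)
  also have "\<dots> = (\<Sum>i<nn. leg (gtr (c * zt ^ (4 * k) * zt ^ (4 * i))))"
  proof (rule sum_shift_cyclic)
    have "gc (zt ^ (4 * nn)) (zt ^ (4 * 0))" using zt_power_1_iff[of "4 * nn"] by simp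
    then show "leg (gtr (c * zt ^ (4 * k) * zt ^ (4 * nn))) = leg (gtr (c * zt ^ (4 * k) * zt ^ (4 * 0)))"
      by (intro leg_gtr_cong dcong_mult dcong_refl)
  qed
  finally show ?case using Suc by (simp add: nsum_def)
qed simp

lemma nsum_scale: "nsum (of_int k * c) = leg k * nsum c"
proof -
  have "gtr (of_int k * z) = k * gtr z" for z by (simp add: gtr_def)
  then show ?thesis by (simp add: nsum_def sum_distrib_left mult.assoc leg_mult)
qed

lemma nsum_conj: "nsum (gcnj c) = nsum c"
proof -
  let ?a = "\<lambda>i. leg (gtr (c * zt ^ (4 * i)))"
  have "?a nn = ?a 0"
  proof -
    have "gc (zt ^ (4 * nn)) (zt ^ (4 * 0))" using zt_power_1_iff[of "4 * nn"] by simp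
    then show ?thesis by (intro leg_gtr_cong dcong_mult dcong_refl)
  qed
  then have "nsum c = (\<Sum>i<nn. ?a (Suc i))" unfolding nsum_def by (rule sum_shift_cyclic[symmetric])
  also have "\<dots> = (\<Sum>i<nn. ?a (Suc (nn - Suc i)))" by (rule sum.nat_diff_reindex[symmetric])
  also have "\<dots> = nsum (gcnj c)"
    unfolding nsum_def
  proof (rule sum.cong)
    fix i assume i: "i \<in> {..<nn}"
    have "gc (gcnj zt ^ (4 * i)) (zt ^ (p * (4 * i)))"
      using dcong_power[OF gc_of_p2[OF gcnj_zt], of "4 * i"] by (simp flip: power_mult)
    moreover have "gc (zt ^ (p * (4 * i))) (zt ^ (4 * (Suc (nn - Suc i))))"
    proof -
      have i': "Suc (nn - Suc i) + i = nn" using i by auto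
      let ?x = "zt ^ (p * (4 * i))" and ?y = "zt ^ (4 * i)" and ?w = "zt ^ (4 * Suc (nn - Suc i))"
      have "?x * ?y = zt ^ (nn * (4 * i))" by (simp add: nn_def add_mult_distrib power_add)
      then have A: "gc (?x * ?y) 1" by (simp add: zt_power_1_iff)
      have "?w * ?y = zt ^ (4 * nn)" by (simp only: power_add[symmetric] distrib_left[symmetric] i')
      then have B: "gc (?w * ?y) 1" by (simp add: zt_power_1_iff)
      have "?x * (?w * ?y) = ?w * (?x * ?y)" by (rule mult.left_commute)
      then have "gc (?w * (?x * ?y)) (?x * 1)" using dcong_mult[OF dcong_refl B, of ?x] by (simp only:)
      from dcong_trans[OF dcong_sym[OF this] dcong_mult[OF dcong_refl A]] show ?thesis by (simp only: mult_1_right)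
    qed
    ultimately have "gc (gcnj zt ^ (4 * i)) (zt ^ (4 * (Suc (nn - Suc i))))" by (rule dcong_trans)
    then have "gc (c * gcnj (zt ^ (4 * i))) (c * zt ^ (4 * (Suc (nn - Suc i))))"
      unfolding gcnj_power by (intro dcong_mult dcong_refl)
    then have "leg (gtr (c * gcnj (zt ^ (4 * i)))) = ?a (Suc (nn - Suc i))" by (rule leg_gtr_cong)
    moreover have "gtr (c * gcnj (zt ^ (4 * i))) = gtr (gcnj c * zt ^ (4 * i))" by (simp add: gtr_def)
    ultimately show "?a (Suc (nn - Suc i)) = leg (gtr (gcnj c * zt ^ (4 * i)))" by simp
  qed simp
  finally show ?thesis by simp
qed

lemma bij_mult_GF:
  assumes f: "\<And>z w. gc z w \<Longrightarrow> f z = f w" and u: "\<not> of_nat p dvd u"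
  shows "(\<Sum>c\<in>carrier GF. f (c * u)) = (\<Sum>c\<in>carrier GF. (f c :: int))"
proof -
  obtain w where w: "gc (u * w) 1" using gauss_inverse[OF u] .
  have inj: "inj_on (\<lambda>c. gred (c * u)) (carrier GF)"
  proof (rule inj_onI)
    fix x y assume xy: "x \<in> carrier GF" "y \<in> carrier GF" "gred (x * u) = gred (y * u)"
    have c: "gc (z * u * w) z" for z
      using dcong_mult[OF dcong_refl w, of z] by (simp add: mult.assoc)
    have "gc (x * u * w) (y * u * w)" using dcong_mult[OF xy(3)[unfolded gred_eq_iff] dcong_refl] .
    then have "gc x y" using c by (metis dcong_sym dcong_trans)
    then show "x = y" unfolding gred_eq_iff[symmetric] using xy gred_id by simp
  qed
  have "(\<lambda>c. gred (c * u)) ` carrier GF = carrier GF"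
    using inj finite_GF by (intro card_subset_eq) (auto simp: card_image GF_simps)
  then have "(\<Sum>c\<in>carrier GF. f c) = (\<Sum>c\<in>carrier GF. f (gred (c * u)))"
    using sum.reindex[OF inj, of f] by simp
  also have "\<dots> = (\<Sum>c\<in>carrier GF. f (c * u))" by (intro sum.cong refl f gc_gred)
  finally show ?thesis by simp
qed

lemma sum_GF: "(\<Sum>c\<in>carrier GF. f c) = (\<Sum>x\<in>{0..<int p}. \<Sum>y\<in>{0..<int p}. (f (Gauss x y) :: int))"
proof -
  have inj: "inj_on (\<lambda>(x, y). Gauss x y) ({0..<int p} \<times> {0..<int p})" by (auto simp: inj_on_def)
  show ?thesis unfolding carrier_GF sum.reindex[OF inj] sum.cartesian_product by (simp add: case_prod_unfold)
qed

lemma leg_2_square: "leg 2 * leg 2 = 1"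
proof (rule leg_square)
  show "\<not> int p dvd 2" using p_gt_2 by (auto dest: zdvd_imp_le)
qed

lemma sum_leg_trace_1: "(\<Sum>c\<in>carrier GF. leg (gtr c) * leg (gtr c)) = int p * (int p - 1)"
proof -
  have "(\<Sum>x\<in>{0..<int p}. leg (2 * x) * leg (2 * x)) = (\<Sum>x\<in>{1..<int p}. 1)"
  proof -
    have "leg (2 * x) * leg (2 * x) = 1" if "x \<in> {1..<int p}" for x
      using leg_square[OF not_dvd_unit[OF that]] leg_2_square by (simp add: leg_mult algebra_simps)
    then show ?thesis by (simp add: residues_split)
  qed
  then show ?thesis unfolding sum_GF using p_gt_2
    by (simp add: gtr_def of_nat_diff flip: sum_distrib_left)
qed

lemma sum_leg_trace_0: assumes "\<not> int p dvd gim u" shows "(\<Sum>c\<in>carrier GF. leg (gtr c) * leg (gtr (c * u))) = 0"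
proof -
  have n2: "\<not> int p dvd 2" using p_gt_2 by (auto dest: zdvd_imp_le)
  have "(\<Sum>y\<in>{0..<int p}. leg (gtr (Gauss x y)) * leg (gtr (Gauss x y * u))) = 0" for x
  proof -
    have "(\<Sum>y\<in>{0..<int p}. leg (- 2 * gim u * y + 2 * x * gre u)) = (\<Sum>y\<in>{0..<int p}. leg y)"
    proof (intro sum_affine leg_cong)
      show "\<not> int p dvd - 2 * gim u" using assms n2 prime_p by (auto simp: prime_dvd_mult_iff)
    qed
    then have "(\<Sum>y\<in>{0..<int p}. leg (gtr (Gauss x y * u))) = 0"
      by (simp add: gtr_def sum_leg algebra_simps)
    then show ?thesis by (simp add: gtr_def flip: sum_distrib_left)
  qed
  then show ?thesis unfolding sum_GF by simp
qed

lemma sum_leg_trace: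
  "(\<Sum>c\<in>carrier GF. leg (gtr (c * zt ^ (4 * i))) * leg (gtr (c * zt ^ (4 * j))))
    = (if [i = j] (mod 2 * e + 1) then int p * (int p - 1) else 0)"
proof -
  define d where "d = j + i * p"
  let ?u = "zt ^ (4 * d)"
  have nd: "\<not> of_nat p dvd zt ^ k" for k
    using gg_not_dvd[of "(p - 1) * (p * k)"] by (simp add: zt_def mult.assoc flip: power_mult)
  have "(\<Sum>c\<in>carrier GF. leg (gtr (c * zt ^ (4 * i))) * leg (gtr (c * zt ^ (4 * j))))
    = (\<Sum>c\<in>carrier GF. (\<lambda>c. leg (gtr (c * zt ^ (4 * i))) * leg (gtr (c * zt ^ (4 * j)))) (c * zt ^ (4 * i * p)))"
  proof (rule bij_mult_GF[symmetric])
    fix z w assume zw: "gc z w"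
    have "leg (gtr (z * zt ^ k)) = leg (gtr (w * zt ^ k))" for k
      using zw by (intro leg_gtr_cong dcong_mult) simp_all
    then show "leg (gtr (z * zt ^ (4 * i))) * leg (gtr (z * zt ^ (4 * j))) = leg (gtr (w * zt ^ (4 * i))) * leg (gtr (w * zt ^ (4 * j)))"
      by simp
  qed (rule nd)
  also have "\<dots> = (\<Sum>c\<in>carrier GF. leg (gtr c) * leg (gtr (c * ?u)))"
  proof (rule sum.cong)
    fix c
    have "gc (zt ^ (4 * i * nn)) 1" unfolding zt_power_1_iff by simp
    then have "gc (c * (zt ^ (4 * i * nn))) (c * 1)" by (intro dcong_mult) simp_all
    moreover have "zt ^ (4 * i * p) * zt ^ (4 * i) = zt ^ (4 * i * nn)" by (simp add: nn_def algebra_simps flip: power_add)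
    ultimately have "gc (c * zt ^ (4 * i * p) * zt ^ (4 * i)) c" by (simp add: mult.assoc)
    then have "leg (gtr (c * zt ^ (4 * i * p) * zt ^ (4 * i))) = leg (gtr c)" by (rule leg_gtr_cong)
    moreover have "c * zt ^ (4 * i * p) * zt ^ (4 * j) = c * ?u"
      by (simp add: d_def mult.assoc algebra_simps flip: power_add)
    ultimately show "leg (gtr (c * zt ^ (4 * i * p) * zt ^ (4 * i))) * leg (gtr (c * zt ^ (4 * i * p) * zt ^ (4 * j)))
      = leg (gtr c) * leg (gtr (c * ?u))" by simp
  qed simp
  also have "\<dots> = (if (2 * e + 1) dvd d then int p * (int p - 1) else 0)"
  proof (cases "(2 * e + 1) dvd d")
    case True
    then have "gc ?u 1" unfolding zt_power_1_iff nn_form by (intro mult_dvd_mono dvd_refl)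
    then have "leg (gtr (c * ?u)) = leg (gtr c)" for c
      using leg_gtr_cong[of "c * ?u" "c * 1"] dcong_mult[of _ c c ?u 1] by simp
    then show ?thesis using True sum_leg_trace_1 by simp
  next
    case False
    have "\<not> int p dvd gim ?u"
    proof
      assume "int p dvd gim ?u"
      then have "gc ?u (gcnj ?u)" by (simp add: gc_iff cong_iff_dvd_diff)
      then have "gc (?u * ?u) (?u * gcnj ?u)" by (intro dcong_mult) simp_all
      moreover have "gc ((zt * gcnj zt) ^ (4 * d)) (1 ^ (4 * d))" by (intro dcong_power gc_of_p2 zt_conj)
      ultimately have "gc (?u * ?u) 1" by (simp add: gcnj_power power_mult_distrib) (metis dcong_trans)
      then have "gc (zt ^ (8 * d)) 1" by (simp flip: power_add)
      then have "4 * (2 * e + 1) dvd 4 * (2 * d)" unfolding zt_power_1_iff nn_form by simp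
      then have "2 * e + 1 dvd 2 * d" by (simp only: nat_mult_dvd_cancel_disj) simp
      moreover have "coprime (2 * e + 1) 2" by simp
      ultimately show False using False by (simp add: coprime_dvd_mult_right_iff)
    qed
    then show ?thesis using False sum_leg_trace_0 by simp
  qed
  also have "(2 * e + 1) dvd d \<longleftrightarrow> [i = j] (mod 2 * e + 1)"
  proof -
    have "int d = (int j - int i) + int (2 * e + 1) * (4 * int i)" by (simp add: d_def p_form algebra_simps)
    then have "int (2 * e + 1) dvd int d \<longleftrightarrow> int (2 * e + 1) dvd int j - int i"
      by (metis dvd_add_left_iff dvd_triv_left)
    then show ?thesis by (metis cong_iff_dvd_diff cong_int_iff cong_sym_eq int_dvd_int_iff)
  qed
  finally show ?thesis .
qed

lemma nsum_square_sum: "(\<Sum>c\<in>carrier GF. nsum c ^ 2) = 4 * (int nn) * (int p * (int p - 1))"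
proof -
  define M where "M = 2 * e + 1"
  have M: "nn = 4 * M" "M > 0" by (simp_all add: M_def nn_form)
  have "(\<Sum>c\<in>carrier GF. nsum c ^ 2) = (\<Sum>c\<in>carrier GF. \<Sum>i<nn. \<Sum>j<nn. leg (gtr (c * zt ^ (4 * i))) * leg (gtr (c * zt ^ (4 * j))))"
    unfolding nsum_def power2_eq_square sum_product ..
  also have "\<dots> = (\<Sum>i<nn. \<Sum>j<nn. \<Sum>c\<in>carrier GF. leg (gtr (c * zt ^ (4 * i))) * leg (gtr (c * zt ^ (4 * j))))"
    by (subst sum.swap, rule sum.cong[OF refl], rule sum.swap)
  also have "\<dots> = (\<Sum>i<nn. \<Sum>j<nn. if [i = j] (mod M) then int p * (int p - 1) else 0)"
    unfolding sum_leg_trace M_def ..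
  also have "\<dots> = (\<Sum>i<nn. 4 * (int p * (int p - 1)))"
  proof (rule sum.cong)
    fix i :: nat
    have "(\<Sum>j<4 * M. if [i = j] (mod M) then int p * (int p - 1) else 0) = int 4 * (\<Sum>j<M. if [i = j] (mod M) then int p * (int p - 1) else 0)"
      by (rule sum_periodic) (simp add: cong_def)
    also have "(\<Sum>j<M. if [i = j] (mod M) then int p * (int p - 1) else 0) = (\<Sum>j<M. if j = i mod M then int p * (int p - 1) else 0)"
      using M(2) by (intro sum.cong) (auto simp: cong_def)
    also have "\<dots> = int p * (int p - 1)" using M(2) by (simp add: sum.delta)
    finally show "(\<Sum>j<nn. if [i = j] (mod M) then int p * (int p - 1) else 0) = 4 * (int p * (int p - 1))"
      unfolding M(1) by simp
  qed simp
  finally show ?thesis by (simp add: int_nn algebra_simps)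
qed

lemma generator_norm:
  obtains k where "gc (gg ^ nn) (of_int k)" "leg k = -1"
proof -
  let ?k = "gnrm gg"
  have "gc (gg * gg ^ p) (gg * gcnj gg)" by (intro dcong_mult power_p_conj) simp
  then have k: "gc (gg ^ nn) (of_int ?k)" by (simp add: nn_def mult_gcnj)
  have "leg ?k \<noteq> 1"
  proof
    assume "leg ?k = 1"
    then have "[?k ^ h = 1] (mod int p)" using leg_euler[of ?k] by (simp add: cong_sym)
    then have "gc (of_int ?k ^ h) 1" by (simp add: gc_iff flip: of_int_power)
    with dcong_power[OF k, of h] have "gc ((gg ^ nn) ^ h) 1" by (rule dcong_trans)
    then have "nn * (p - 1) dvd nn * h" unfolding power_mult[symmetric] gg_power_1_iff p_sq_nn .
    then have "p - 1 dvd h" by (simp add: nn_form)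
    then have "p - 1 \<le> h" using h_pos by (rule dvd_imp_le)
    then show False using p_eq h_pos by linarith
  qed
  moreover have "leg ?k \<noteq> 0" using gg_not_dvd[of 1] gnrm_dvd unfolding leg_eq_0_iff by auto
  ultimately show ?thesis using that k leg_cases by blast
qed

lemma nsum_gg_shift: "nsum (gg ^ (j + nn * m)) = (-1) ^ m * nsum (gg ^ j)"
proof (induction m)
  case (Suc m)
  obtain k where k: "gc (gg ^ nn) (of_int k)" "leg k = -1" by (rule generator_norm)
  have "gc (gg ^ nn * gg ^ (j + nn * m)) (of_int k * gg ^ (j + nn * m))" using k(1) by (intro dcong_mult) simp_all
  then have "nsum (gg ^ nn * gg ^ (j + nn * m)) = - nsum (gg ^ (j + nn * m))"
    using nsum_cong nsum_scale[of k] k(2) by simp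
  moreover have "gg ^ nn * gg ^ (j + nn * m) = gg ^ (j + nn * Suc m)" by (simp add: algebra_simps flip: power_add)
  ultimately show ?case using Suc by simp
qed simp

lemma nsum_gg_4: "nsum (gg ^ (j + 4)) = - nsum (gg ^ j)"
proof -
  have "nsum (gg ^ (j + 4)) = nsum (gg ^ (j + 4) * zt ^ (4 * e))" by (rule nsum_mult_zt[symmetric])
  also have "gg ^ (j + 4) * zt ^ (4 * e) = gg ^ (j + 4 + (p - 1) * (p * (4 * e)))"
    by (simp add: zt_def power_add power_mult)
  also have "j + 4 + (p - 1) * (p * (4 * e)) = j + nn * (1 + 2 * (2 * e * (8 * e + 1)))"
  proof -
    have "(p - 1) * (p * (4 * e)) = (8 * e + 2) * ((8 * e + 3) * (4 * e))" using p_form by simp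
    then show ?thesis unfolding nn_form by (simp add: algebra_simps)
  qed
  also have "nsum (gg ^ \<dots>) = - nsum (gg ^ j)" unfolding nsum_gg_shift by simp
  finally show ?thesis .
qed

lemma nsum_gg_8: "nsum (gg ^ (j + 8 * k)) = nsum (gg ^ j)"
proof (induction k)
  case (Suc k)
  have eq: "j + 8 * Suc k = (j + 8 * k) + 4 + 4" by simp
  show ?case unfolding eq nsum_gg_4 using Suc by simp
qed simp

lemma nsum_gg_p: "nsum (gg ^ (p * j)) = nsum (gg ^ j)"
proof -
  have "gc (gg ^ (p * j)) (gcnj (gg ^ j))"
    using dcong_power[OF power_p_conj, of gg j] by (simp add: power_mult gcnj_power)
  then show ?thesis using nsum_cong nsum_conj by metis
qed

lemma sum_GF_units:
  assumes f: "\<And>z w. gc z w \<Longrightarrow> f z = (f w :: int)"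
  shows "(\<Sum>c\<in>carrier GF - {0}. f c) = (\<Sum>i<p ^ 2 - 1. f (gg ^ i))"
proof -
  let ?g = "\<lambda>i. gred (gg ^ i)"
  have g0: "?g i \<noteq> 0" for i
  proof
    assume "?g i = 0"
    then have "gc (gg ^ i) 0" by (simp flip: gred_eq_iff)
    then show False using gg_not_dvd[of i] by (simp add: dcong_def)
  qed
  have z: "0 \<in> carrier GF" unfolding GF_simps by (rule range_eqI[of _ _ 0]) simp
  have q: "0 < p ^ 2 - 1" unfolding p_sq_nn nn_def using p_gt_2 by simp
  have img: "?g ` {..<p ^ 2 - 1} = carrier GF - {0}"
  proof (rule subset_antisym)
    show "?g ` {..<p ^ 2 - 1} \<subseteq> carrier GF - {0}" using g0 by (auto simp: GF_simps)
    show "carrier GF - {0} \<subseteq> ?g ` {..<p ^ 2 - 1}"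
    proof
      fix c assume c: "c \<in> carrier GF - {0}"
      have "\<not> of_nat p dvd c"
      proof
        assume "of_nat p dvd c"
        then have "gred c = gred 0" unfolding gred_eq_iff dcong_def by simp
        then show False using c gred_id[of c] by simp
      qed
      then obtain i where i: "gc c (gg ^ i)" using gg unfolding generator_def by blast
      let ?r = "i mod (p ^ 2 - 1)"
      have "gc (gg ^ ((p ^ 2 - 1) * (i div (p ^ 2 - 1)))) 1" by (simp only: gg_power_1_iff dvd_triv_left)
      then have "gc (gg ^ ((p ^ 2 - 1) * (i div (p ^ 2 - 1))) * gg ^ ?r) (1 * gg ^ ?r)" by (intro dcong_mult) simp_all
      then have "gc (gg ^ i) (gg ^ ?r)" by (simp only: power_add[symmetric] mult_div_mod_eq mult_1)
      with i have "gc c (gg ^ ?r)" by (rule dcong_trans)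
      then have "c = ?g ?r" unfolding gred_eq_iff[symmetric] using c gred_id by simp
      moreover have "?r < p ^ 2 - 1" using q by simp
      ultimately show "c \<in> ?g ` {..<p ^ 2 - 1}" by blast
    qed
  qed
  have "inj_on ?g {..<p ^ 2 - 1}"
    using z finite_GF card_GF by (intro eq_card_imp_inj_on) (simp_all only: img finite_lessThan card_lessThan card_Diff_singleton)
  then have "(\<Sum>c\<in>carrier GF - {0}. f c) = (\<Sum>i<p ^ 2 - 1. f (?g i))"
    unfolding img[symmetric] by (simp add: sum.reindex)
  also have "\<dots> = (\<Sum>i<p ^ 2 - 1. f (gg ^ i))" by (intro sum.cong refl f gc_gred)
  finally show ?thesis .
qed

lemma nsum_1:
  obtains t w where "nsum 1 = 4 * t" "int p = t ^ 2 + 2 * w ^ 2"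
proof -
  let ?f = "\<lambda>j. nsum (gg ^ j)"
  have z: "0 \<in> carrier GF" unfolding GF_simps by (rule range_eqI[of _ _ 0]) simp
  have n0: "nsum 0 = 0" by (simp add: nsum_def gtr_def)
  have "4 * (int p + 1) * (int p * (int p - 1)) = (\<Sum>c\<in>carrier GF - {0}. nsum c ^ 2)"
    using nsum_square_sum sum.remove[OF finite_GF z, of "\<lambda>c. nsum c ^ 2"] n0 by (simp add: int_nn)
  also have "\<dots> = (\<Sum>i<p ^ 2 - 1. ?f i ^ 2)"
    by (intro sum_GF_units arg_cong[of _ _ "\<lambda>x. x ^ 2"] nsum_cong)
  also have "p ^ 2 - 1 = ((2 * e + 1) * (p - 1)) * 4" unfolding p_sq_nn nn_form by (simp only: mult_ac)
  also have "(\<Sum>i<((2 * e + 1) * (p - 1)) * 4. ?f i ^ 2) = int ((2 * e + 1) * (p - 1)) * (\<Sum>i<4. ?f i ^ 2)"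
    by (rule sum_periodic) (simp only: nsum_gg_4 power2_minus)
  also have "int ((2 * e + 1) * (p - 1)) = int (2 * e + 1) * (int p - 1)"
    unfolding of_nat_mult using p_gt_2 by (simp add: of_nat_diff)
  finally have eq: "4 * (int p + 1) * (int p * (int p - 1)) = int (2 * e + 1) * (int p - 1) * (\<Sum>i<4. ?f i ^ 2)" .
  have i4: "int p + 1 = 4 * int (2 * e + 1)" using nn_form int_nn by simp
  have "(int (2 * e + 1) * (int p - 1)) * (16 * int p) = (int (2 * e + 1) * (int p - 1)) * (\<Sum>i<4. ?f i ^ 2)"
    using eq unfolding i4 by (simp only: mult_ac)
  moreover have "int (2 * e + 1) * (int p - 1) \<noteq> 0" using p_gt_2 by simp
  ultimately have "16 * int p = (\<Sum>i<4. ?f i ^ 2)" by (metis mult_left_cancel)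
  then have sq: "?f 0 ^ 2 + ?f 1 ^ 2 + ?f 2 ^ 2 + ?f 3 ^ 2 = 16 * int p" by (simp add: eval_nat_numeral)
  have "?f 1 = ?f (3 + 8 * e)" using nsum_gg_p[of 1] by (simp add: p_form add.commute)
  then have f13: "?f 1 = ?f 3" unfolding nsum_gg_8 .
  have "?f 2 = ?f (2 + 4 + 8 * (2 * e))" using nsum_gg_p[of 2] by (simp add: p_form add.commute)
  then have "?f 2 = - ?f 2" unfolding nsum_gg_8 nsum_gg_4 .
  then have "nsum 1 ^ 2 + 2 * ?f 1 ^ 2 = 16 * int p" using sq f13 by simp
  then obtain t w where "nsum 1 = 4 * t" "int p = t ^ 2 + 2 * w ^ 2" by (rule sixteen_p)
  then show ?thesis by (rule that)
qed

lemma nsum_1_cong_aux: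
  "int (p ^ 2) dvd nsum 1 - int (nn * ((\<Sum>l\<le>h. if nn dvd 4 * p * (p * h) + 8 * (p * l) then h choose l else 0)
     + p * h * (\<Sum>K<h. \<Sum>R\<in>{1..<p}. if nn dvd 4 * p * (p * h) + 8 * (p * K + R) then ((h - 1) choose K) * qbin R else 0)))"
proof -
  let ?m = "of_nat (p ^ 2) :: gauss"
  have trm: "dcong ?m (of_int (leg (gtr (zt ^ (4 * i))))) (zt ^ (4 * p * (p * h) * i) * (1 + zt ^ (8 * i)) ^ (p * h))" for i
  proof -
    let ?v = "gtr (zt ^ (4 * i))"
    have "int (p ^ 2) dvd leg ?v - ?v ^ (p * h)" using leg_mod_p2[of ?v] by (simp add: cong_iff_dvd_diff)
    then have 1: "dcong ?m (of_int (leg ?v)) (of_int ?v ^ (p * h))"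
      unfolding dcong_def of_nat_dvd_gauss_iff by (simp flip: of_int_power)
    have "dcong ?m (zt ^ (4 * i * nn)) 1"
      using dcong_power[OF zt_power_N, of "4 * i"] by (simp add: mult.commute flip: power_mult)
    then have "dcong ?m (zt ^ (4 * i) * zt ^ (4 * i * nn)) (zt ^ (4 * i) * 1)" by (intro dcong_mult) simp_all
    moreover have "zt ^ (4 * i) * zt ^ (4 * i * nn) = zt ^ (4 * p * i) * zt ^ (8 * i)"
      by (simp add: nn_def algebra_simps flip: power_add)
    ultimately have a: "dcong ?m (zt ^ (4 * i)) (zt ^ (4 * p * i) * zt ^ (8 * i))" by (simp add: dcong_sym)
    have b: "dcong ?m (gcnj (zt ^ (4 * i))) (zt ^ (4 * p * i))"
      using dcong_power[OF gcnj_zt, of "4 * i"] by (simp add: gcnj_power mult_ac flip: power_mult)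
    have "dcong ?m (of_int ?v) (zt ^ (4 * p * i) * zt ^ (8 * i) + zt ^ (4 * p * i))"
      unfolding gtr_conv using a b by (rule dcong_add)
    then have "dcong ?m (of_int ?v) (zt ^ (4 * p * i) * (1 + zt ^ (8 * i)))" by (simp add: algebra_simps)
    from dcong_power[OF this, of "p * h"]
    have "dcong ?m (of_int ?v ^ (p * h)) (zt ^ (4 * p * (p * h) * i) * (1 + zt ^ (8 * i)) ^ (p * h))"
      by (simp add: power_mult_distrib mult_ac flip: power_mult)
    with 1 show ?thesis by (rule dcong_trans)
  qed
  have "dcong ?m (\<Sum>i<nn. of_int (leg (gtr (zt ^ (4 * i))))) (\<Sum>i<nn. zt ^ (4 * p * (p * h) * i) * (1 + zt ^ (8 * i)) ^ (p * h))"
    by (intro dcong_sum trm)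
  then have "dcong ?m (of_int (nsum 1)) (\<Sum>i<nn. zt ^ (4 * p * (p * h) * i) * (1 + zt ^ (8 * i)) ^ (p * h))"
    by (simp add: nsum_def)
  from dcong_trans[OF this] torus_sum[where N = nn and \<zeta> = zt and b = "4 * p * (p * h)" and n = 8, OF zt_sum]
  have "?m dvd of_int (nsum 1) - of_nat (nn * ((\<Sum>l\<le>h. if nn dvd 4 * p * (p * h) + 8 * (p * l) then h choose l else 0)
     + p * h * (\<Sum>K<h. \<Sum>R\<in>{1..<p}. if nn dvd 4 * p * (p * h) + 8 * (p * K + R) then ((h - 1) choose K) * qbin R else 0)))"
    unfolding dcong_def by blast
  then show ?thesis unfolding of_nat_dvd_gauss_iff by (simp only: gauss_simps gauss_of_int gauss_of_nat)
qed

lemma nn_dvd_iff: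
  assumes "int x = 4 * (int (2 * e + 1) * q + c)"
  shows "nn dvd x \<longleftrightarrow> int (2 * e + 1) dvd c"
proof -
  have "nn dvd x \<longleftrightarrow> int nn dvd int x" by (simp only: int_dvd_int_iff)
  also have "\<dots> \<longleftrightarrow> 4 * int (2 * e + 1) dvd 4 * (int (2 * e + 1) * q + c)"
    unfolding assms nn_form by (simp only: of_nat_mult of_nat_numeral)
  also have "\<dots> \<longleftrightarrow> int (2 * e + 1) dvd int (2 * e + 1) * q + c"
    by (rule dvd_times_left_cancel_iff) simp
  also have "\<dots> \<longleftrightarrow> int (2 * e + 1) dvd c" by (rule dvd_add_right_iff) simp
  finally show ?thesis .
qed

lemma exponent_cond_main: "nn dvd 4 * p * (p * h) + 8 * (p * l) \<longleftrightarrow> (2 * e + 1) dvd 2 * l + 1"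
proof -
  define M where "M = int (2 * e + 1)"
  have ph: "int p = 4 * M - 1" "int h = 2 * M - 1" using p_form h_form by (simp_all add: M_def)
  have "4 * (4 * m - 1) * ((4 * m - 1) * (2 * m - 1)) + 8 * ((4 * m - 1) * k)
      = 4 * (m * ((2 * m - 1) * (16 * m - 8) + 2 + 8 * k) + - (2 * k + 1))" for m k :: int
    by (simp add: algebra_simps)
  from this[of M "int l"]
  have "int (4 * p * (p * h) + 8 * (p * l)) = 4 * (M * ((2 * M - 1) * (16 * M - 8) + 2 + 8 * int l) + - int (2 * l + 1))"
    by (simp add: ph)
  from nn_dvd_iff[OF this[unfolded M_def]] show ?thesis
    by (simp only: dvd_minus_iff int_dvd_int_iff)
qed

lemma exponent_cond_rest:
  assumes "K < h"
  shows "nn dvd 4 * p * (p * h) + 8 * (p * (h - Suc K) + R) \<longleftrightarrow> (2 * e + 1) dvd 2 * (K + R) + 3"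
proof -
  define M where "M = int (2 * e + 1)"
  have ph: "int p = 4 * M - 1" "int h = 2 * M - 1" using p_form h_form by (simp_all add: M_def)
  have hK: "int (h - Suc K) = 2 * M - 2 - int K" using assms ph(2) by (simp add: of_nat_diff)
  have "4 * (4 * m - 1) * ((4 * m - 1) * (2 * m - 1)) + 8 * ((4 * m - 1) * (2 * m - 2 - k) + r)
      = 4 * (m * ((2 * m - 1) * (16 * m - 8) + 8 * (2 * m - 2 - k) - 2) + (2 * (k + r) + 3))" for m k r :: int
    by (simp add: algebra_simps)
  from this[of M "int K" "int R"]
  have "int (4 * p * (p * h) + 8 * (p * (h - Suc K) + R)) = 4 * (M * ((2 * M - 1) * (16 * M - 8) + 8 * (2 * M - 2 - int K) - 2) + int (2 * (K + R) + 3))"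
    by (simp add: ph hK)
  from nn_dvd_iff[OF this[unfolded M_def]] show ?thesis
    by (simp only: int_dvd_int_iff)
qed

lemma nsum_1_cg:
  "cg 2 (of_int (nsum 1)) ((P + 1) * (of_nat (\<Sum>l | l \<le> h \<and> (2 * e + 1) dvd 2 * l + 1. h choose l)
     + P * (of_nat h * of_nat (\<Sum>k | k < h + p \<and> (2 * e + 1) dvd 2 * k + 3. conv k))))"
proof -
  let ?a = "\<Sum>l | l \<le> h \<and> (2 * e + 1) dvd 2 * l + 1. h choose l"
  let ?b = "\<Sum>k | k < h + p \<and> (2 * e + 1) dvd 2 * k + 3. conv k"
  have a: "(\<Sum>l\<le>h. if nn dvd 4 * p * (p * h) + 8 * (p * l) then h choose l else 0) = ?a"
    unfolding exponent_cond_main by (subst sum.inter_filter[symmetric]) (auto intro: sum.cong)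
  let ?g = "\<lambda>K. \<Sum>R\<in>{1..<p}. if nn dvd 4 * p * (p * h) + 8 * (p * K + R) then ((h - 1) choose K) * qbin R else 0"
  have "(\<Sum>K<h. ?g K) = (\<Sum>K<h. ?g (h - Suc K))" by (rule sum.nat_diff_reindex[symmetric])
  also have "\<dots> = (\<Sum>K<h. \<Sum>R\<in>{1..<p}. if (2 * e + 1) dvd 2 * (K + R) + 3 then ((h - 1) choose K) * qbin R else 0)"
  proof (rule sum.cong)
    fix K assume "K \<in> {..<h}"
    then have K: "K < h" "K \<le> h - 1" by auto
    have c: "(h - 1) choose (h - Suc K) = (h - 1) choose K" using binomial_symmetric[OF K(2)] by simp
    show "?g (h - Suc K) = (\<Sum>R\<in>{1..<p}. if (2 * e + 1) dvd 2 * (K + R) + 3 then ((h - 1) choose K) * qbin R else 0)"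
      unfolding exponent_cond_rest[OF K(1)] c ..
  qed simp
  also have "\<dots> = ?b" by (rule conv_total)
  finally have b: "(\<Sum>K<h. ?g K) = ?b" .
  have "[nsum 1 = int (nn * (?a + p * h * ?b))] (mod int p ^ 2)"
    using nsum_1_cong_aux unfolding a b by (simp only: cong_iff_dvd_diff of_nat_power)
  then have "cg 2 (of_int (nsum 1)) (of_int (int (nn * (?a + p * h * ?b))))" by (rule cg_of_int)
  moreover have "of_int (int (nn * (x + p * h * y))) = (P + 1) * (of_nat x + P * (of_nat h * of_nat y))" for x y
    by (simp add: nn_def algebra_simps)
  ultimately show ?thesis by (simp only:)
qed

lemma nonsplit_alpha_sum:
  assumes e: "e > 0" and T: "nsum 1 = 2 * t"
  shows "cg 2 (of_int t) ((P + 1) * (of_nat (h choose e) + P * (of_nat h * of_nat (conv (e - 1) + conv (h - e - 1) + conv (h + e)))))"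
proof -
  have hp: "h = 4 * e + 1" "p = 8 * e + 3" by (rule h_form, rule p_form)
  let ?M = "2 * e + 1"
  have bd: "i \<le> c" if "i * ?M < (c + 1) * ?M" for i c
    using that unfolding mult_less_cancel2 by simp
  have L: "{l. l \<le> h \<and> ?M dvd 2 * l + 1} = {e, 3 * e + 1}"
  proof (rule subset_antisym; rule subsetI)
    fix l assume "l \<in> {l. l \<le> h \<and> ?M dvd 2 * l + 1}"
    then obtain j where l: "l \<le> h" "2 * l + 1 = ?M * j" by (auto elim: dvdE)
    then have "odd (?M * j)" by (metis odd_two_times_div_two_succ odd_Suc_minus_one even_Suc dvd_triv_left Suc_eq_plus1)
    then have "odd j" by simp
    then obtain i where i: "j = 2 * i + 1" by (rule oddE)
    then have li: "l = i * ?M + e" using l(2) by (simp add: algebra_simps)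
    then have "i * ?M < (1 + 1) * ?M" using l(1) hp(1) by simp
    then have "i = 0 \<or> i = 1" using bd[of i 1] by auto
    then show "l \<in> {e, 3 * e + 1}" using li by auto
  next
    fix l assume l: "l \<in> {e, 3 * e + 1}"
    then have "2 * l + 1 = ?M * 1 \<or> 2 * l + 1 = ?M * 3" by auto
    then have "?M dvd 2 * l + 1" by (metis dvd_triv_left)
    moreover have "l \<le> h" using l hp(1) by auto
    ultimately show "l \<in> {l. l \<le> h \<and> ?M dvd 2 * l + 1}" by simp
  qed
  have K: "{k. k < h + p \<and> ?M dvd 2 * k + 3} = {e - 1, 3 * e, 5 * e + 1, 7 * e + 2, 9 * e + 3, 11 * e + 4}"
  proof (rule subset_antisym; rule subsetI)
    fix k assume "k \<in> {k. k < h + p \<and> ?M dvd 2 * k + 3}"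
    then obtain j where k: "k < h + p" "2 * k + 3 = ?M * j" by (auto elim: dvdE)
    have "odd (2 * k + 3)" by simp
    then have "odd j" unfolding k(2) by simp
    then obtain i where i: "j = 2 * i + 1" by (rule oddE)
    then have ki: "k + 1 = i * ?M + e" using k(2) by (simp add: algebra_simps)
    moreover have "k < 12 * e + 4" using k(1) hp by linarith
    ultimately have "i * ?M < (5 + 1) * ?M" by simp
    then have "i \<le> 5" by (rule bd)
    then have "i = 0 \<or> i = 1 \<or> i = 2 \<or> i = 3 \<or> i = 4 \<or> i = 5" by auto
    then show "k \<in> {e - 1, 3 * e, 5 * e + 1, 7 * e + 2, 9 * e + 3, 11 * e + 4}" using ki by auto
  next
    fix k assume k: "k \<in> {e - 1, 3 * e, 5 * e + 1, 7 * e + 2, 9 * e + 3, 11 * e + 4}"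
    then have "2 * k + 3 = ?M * 1 \<or> 2 * k + 3 = ?M * 3 \<or> 2 * k + 3 = ?M * 5 \<or> 2 * k + 3 = ?M * 7
      \<or> 2 * k + 3 = ?M * 9 \<or> 2 * k + 3 = ?M * 11" using e by auto
    then have "?M dvd 2 * k + 3" by (metis dvd_triv_left)
    moreover have "k \<le> 11 * e + 4" using k by auto
    then have "k < h + p" using hp e by linarith
    ultimately show "k \<in> {k. k < h + p \<and> ?M dvd 2 * k + 3}" by simp
  qed
  have c: "h choose (3 * e + 1) = h choose e" using binomial_symmetric[of e h] hp(1) by simp
  have m: "h - 1 + p = 12 * e + 3" using hp by linarith
  have cs: "conv (11 * e + 4) = conv (e - 1)" "conv (9 * e + 3) = conv (3 * e)" "conv (7 * e + 2) = conv (5 * e + 1)"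
    using conv_sym[of "e - 1"] conv_sym[of "3 * e"] conv_sym[of "5 * e + 1"] e unfolding m
    by (simp_all add: Suc_diff_le)
  have hs: "h - e - 1 = 3 * e" "h + e = 5 * e + 1" using hp(1) by simp_all
  have six: "(\<Sum>k\<in>{a, b, c, d, f, g}. conv k) = conv a + conv b + conv c + conv d + conv f + conv g"
    if "a < b" "b < c" "c < d" "d < f" "f < g" for a b c d f g
  proof -
    have "a \<notin> {b, c, d, f, g}" "b \<notin> {c, d, f, g}" "c \<notin> {d, f, g}" "d \<notin> {f, g}" "f \<noteq> g"
      using that by auto
    then show ?thesis by simp
  qed
  have sm: "(\<Sum>k\<in>{e - 1, 3 * e, 5 * e + 1, 7 * e + 2, 9 * e + 3, 11 * e + 4}. conv k)
      = conv (e - 1) + conv (3 * e) + conv (5 * e + 1) + conv (7 * e + 2) + conv (9 * e + 3) + conv (11 * e + 4)"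
    by (rule six) (use e in linarith)+
  have Ks: "(\<Sum>k\<in>{e - 1, 3 * e, 5 * e + 1, 7 * e + 2, 9 * e + 3, 11 * e + 4}. conv k)
      = 2 * (conv (e - 1) + conv (h - e - 1) + conv (h + e))"
    unfolding sm cs hs by simp
  have Ls: "(\<Sum>l\<in>{e, 3 * e + 1}. h choose l) = 2 * (h choose e)" using c by simp
  have "cg 2 (of_int (2 * t)) ((P + 1) * (of_nat (2 * (h choose e)) + P * (of_nat h * of_nat (2 * (conv (e - 1) + conv (h - e - 1) + conv (h + e))))))"
    using nsum_1_cg unfolding L K Ks Ls T .
  moreover have "(P + 1) * (of_nat (2 * c) + P * (of_nat h * of_nat (2 * a)))
      = 2 * ((P + 1) * (of_nat c + P * (of_nat h * of_nat a)))" for a c :: nat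
    by (simp add: algebra_simps)
  ultimately have D: "cg 2 (2 * of_int t) (2 * ((P + 1) * (of_nat (h choose e) + P * (of_nat h * of_nat (conv (e - 1) + conv (h - e - 1) + conv (h + e))))))"
    by (simp only: of_int_mult of_int_numeral)
  have "\<not> p dvd 2" using p_gt_2 by (auto dest: dvd_imp_le)
  then have "unit (of_nat 2)" by (rule unit_nat)
  then have "unit 2" by simp
  then show ?thesis by (rule cg_unit_cancel[OF _ D]) (intro Zp_rules Zp_of_int Zp_of_nat Zp_1)+
qed

lemma G4_nonsplit:
  assumes "e > 0" "int p = u ^ 2 + 2 * v ^ 2"
  shows "cg 2 (G h (-1 / 4)) (4 * of_int u ^ 2 - 2 * P)"
proof -
  obtain t w where t: "nsum 1 = 4 * t" "int p = t ^ 2 + 2 * w ^ 2" by (rule nsum_1)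
  have "t ^ 2 = u ^ 2"
    by (rule representation_unique[OF _ _ t(2) assms(2)]) (use prime_p in auto)
  then have "(of_int t :: rat) ^ 2 = of_int u ^ 2" by (metis of_int_power)
  then have tu: "(of_int (2 * t) :: rat) ^ 2 = 4 * of_int u ^ 2" by (simp add: power_mult_distrib)
  have eh: "e < h" "2 * e < p" using h_form p_form by simp_all
  have "nsum 1 = 2 * (2 * t)" using t(1) by simp
  from nonsplit_alpha[OF assms(1) eh(1) nonsplit_alpha_sum[OF assms(1) this]]
  have a: "cg 2 (of_nat (h choose e) ^ 2 * (1 + 2 * P * (of_nat h * H h - of_nat e * H (h - e) - of_nat (h - e) * H e))) (4 * of_int u ^ 2 - 2 * P)"
    unfolding tu .
  have Hz: "H h \<in> Zp p" "H e \<in> Zp p" "H (h - e) \<in> Zp p" using eh h_less_p by (auto intro!: H_Zp)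
  have q: "x / 4 \<in> Zp p" if "x \<in> Zp p" for x using Zp_divide_pow4[OF that, of 1] by simp
  have "-1 / 4 \<in> Zp p" using q[of "-1"] Zp_minus[of 1] by simp
  then have "cg 2 (G h (of_nat (2 * e) + P * (-1 / 4))) (4 * of_int u ^ 2 - 2 * P)"
  proof (rule G_CM_log[OF eh(2) _ _ _ a])
    show "H h - H (h - e) / 4 - 3 * (H e / 4) \<in> Zp p" by (intro Zp_diff Zp_mult q Hz Zp_numeral)
    have Pe: "P = 8 * of_nat e + 3" by (subst p_form) simp
    have he: "of_nat h = 4 * of_nat e + (1 :: rat)" by (subst h_form) simp
    have hd: "of_nat (h - e) = 3 * of_nat e + (1 :: rat)" using eh he by (simp add: of_nat_diff)
    show "2 * (of_nat h * H h - of_nat e * H (h - e) - of_nat (h - e) * H e) = (1 + - 1 / 4) * H (h - e) - - 1 / 4 * H e - H h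
        + P * (H h - H (h - e) / 4 - 3 * (H e / 4))"
      unfolding Pe he hd by (simp add: field_simps)
  qed
  moreover have "of_nat (2 * e) + P * (-1 / 4) = - 1 - (-1 / 4 :: rat)" by (subst p_form) (simp add: field_simps)
  ultimately show ?thesis using G_reflect[of h "-1 / 4"] by simp
qed

end

section \<open>Triplication modulo \<open>p\<^sup>2\<close>\<close>

lemma prod_by_thirds:
  fixes g :: "nat \<Rightarrow> 'a::comm_monoid_mult"
  shows "(\<Prod>i=1..3 * n. g i) = (\<Prod>j=1..n. g (3 * j)) * (\<Prod>j=1..n. g (3 * j - 1)) * (\<Prod>j=1..n. g (3 * j - 2))"
    (is "?L (3 * n) = _")
proof (induction n)
  case (Suc n)
  have "3 * Suc n = Suc (Suc (Suc (3 * n)))" by simp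
  then have "(\<Prod>i=1..3 * Suc n. g i) = (\<Prod>i=1..Suc (Suc (Suc (3 * n))). g i)" by (simp only:)
  also have "\<dots> = (\<Prod>i=1..3 * n. g i) * g (3 * n + 1) * g (3 * n + 2) * g (3 * n + 3)"
    by (simp add: mult.assoc numeral_3_eq_3)
  finally have *: "?L (3 * Suc n) = \<dots>" .
  have i: "3 * n + 1 = 3 * Suc n - 2" "3 * n + 2 = 3 * Suc n - 1" "3 * n + 3 = 3 * Suc n" by auto
  show ?case unfolding * Suc i by (simp add: mult_ac)
qed simp

lemma sum_by_thirds:
  fixes g :: "nat \<Rightarrow> 'a::comm_monoid_add"
  shows "(\<Sum>i=1..3 * n. g i) = (\<Sum>j=1..n. g (3 * j)) + (\<Sum>j=1..n. g (3 * j - 1)) + (\<Sum>j=1..n. g (3 * j - 2))"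
    (is "?L (3 * n) = _")
proof (induction n)
  case (Suc n)
  have "3 * Suc n = Suc (Suc (Suc (3 * n)))" by simp
  then have "(\<Sum>i=1..3 * Suc n. g i) = (\<Sum>i=1..Suc (Suc (Suc (3 * n))). g i)" by (simp only:)
  also have "\<dots> = (\<Sum>i=1..3 * n. g i) + g (3 * n + 1) + g (3 * n + 2) + g (3 * n + 3)"
    by (simp add: add.assoc numeral_3_eq_3)
  finally have *: "?L (3 * Suc n) = \<dots>" .
  have i: "3 * n + 1 = 3 * Suc n - 2" "3 * n + 2 = 3 * Suc n - 1" "3 * n + 3 = 3 * Suc n" by auto
  show ?case unfolding * Suc i by (simp add: add_ac)
qed simp

text \<open>Splitting \<open>1, \<dots>, r\<close> into residue classes modulo 3 and writing each element as three times an integer minus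
  a multiple of \<open>p\<close>.\<close>
definition thirds :: "nat \<Rightarrow> nat \<Rightarrow> nat \<Rightarrow> nat \<Rightarrow> nat \<Rightarrow> bool" where
  "thirds p F r e n \<longleftrightarrow> (p = 3 * F + 1 \<and> r = 3 * e \<and> n = e) \<or> (p = 3 * F + 2 \<and> r = 3 * e + 1 \<and> n = e + 1)"

lemma thirds_prod:
  fixes g :: "rat \<Rightarrow> rat"
  assumes "thirds p F r e n"
  shows "(\<Prod>i=1..r. g (of_nat i)) = (\<Prod>j=1..e. g (3 * of_nat j))
    * (\<Prod>j=1..n. g (3 * (of_nat j + of_nat F) - of_nat p)) * (\<Prod>j=1..e. g (3 * (of_nat j + of_nat (p - 1 - F)) - 2 * of_nat p))"
proof -
  have 1: "of_nat (3 * j - 1) = (3 * of_nat j - 1 :: rat)" "of_nat (3 * j - 2) = (3 * of_nat j - 2 :: rat)" if "j \<ge> 1" for j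
    using that by (simp_all add: of_nat_diff)
  consider (a) "p = 3 * F + 1" "r = 3 * e" "n = e" | (b) "p = 3 * F + 2" "r = 3 * e + 1" "n = e + 1"
    using assms unfolding thirds_def by blast
  then show ?thesis
  proof cases
    case a
    have "(\<Prod>i=1..r. g (of_nat i)) = (\<Prod>j=1..e. g (of_nat (3 * j))) * (\<Prod>j=1..e. g (of_nat (3 * j - 1))) * (\<Prod>j=1..e. g (of_nat (3 * j - 2)))"
      unfolding a by (rule prod_by_thirds)
    also have "(\<Prod>j=1..e. g (of_nat (3 * j - 1))) = (\<Prod>j=1..e. g (3 * (of_nat j + of_nat F) - of_nat p))"
      by (rule prod.cong) (auto simp: 1 a algebra_simps)
    also have "(\<Prod>j=1..e. g (of_nat (3 * j - 2))) = (\<Prod>j=1..e. g (3 * (of_nat j + of_nat (p - 1 - F)) - 2 * of_nat p))"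
      by (rule prod.cong) (auto simp: 1 a algebra_simps)
    finally show ?thesis using a by simp
  next
    case b
    have "(\<Prod>i=1..r. g (of_nat i)) = (\<Prod>i=1..3 * e. g (of_nat i)) * g (of_nat (3 * (e + 1) - 2))"
      unfolding b by simp
    also have "(\<Prod>i=1..3 * e. g (of_nat i)) = (\<Prod>j=1..e. g (of_nat (3 * j))) * (\<Prod>j=1..e. g (of_nat (3 * j - 1))) * (\<Prod>j=1..e. g (of_nat (3 * j - 2)))"
      by (rule prod_by_thirds)
    also have "(\<Prod>j=1..e. g (of_nat (3 * j))) * (\<Prod>j=1..e. g (of_nat (3 * j - 1))) * (\<Prod>j=1..e. g (of_nat (3 * j - 2))) * g (of_nat (3 * (e + 1) - 2))
        = (\<Prod>j=1..e. g (of_nat (3 * j))) * (\<Prod>j=1..n. g (of_nat (3 * j - 2))) * (\<Prod>j=1..e. g (of_nat (3 * j - 1)))"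
      unfolding b by (simp add: mult_ac)
    also have "(\<Prod>j=1..n. g (of_nat (3 * j - 2))) = (\<Prod>j=1..n. g (3 * (of_nat j + of_nat F) - of_nat p))"
      by (rule prod.cong) (auto simp: 1 b algebra_simps)
    also have "(\<Prod>j=1..e. g (of_nat (3 * j - 1))) = (\<Prod>j=1..e. g (3 * (of_nat j + of_nat (p - 1 - F)) - 2 * of_nat p))"
      by (rule prod.cong) (auto simp: 1 b algebra_simps)
    finally show ?thesis by simp
  qed
qed

lemma thirds_sum:
  fixes g :: "rat \<Rightarrow> rat"
  assumes "thirds p F r e n"
  shows "(\<Sum>i=1..r. g (of_nat i)) = (\<Sum>j=1..e. g (3 * of_nat j))
    + (\<Sum>j=1..n. g (3 * (of_nat j + of_nat F) - of_nat p)) + (\<Sum>j=1..e. g (3 * (of_nat j + of_nat (p - 1 - F)) - 2 * of_nat p))"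
proof -
  have 1: "of_nat (3 * j - 1) = (3 * of_nat j - 1 :: rat)" "of_nat (3 * j - 2) = (3 * of_nat j - 2 :: rat)" if "j \<ge> 1" for j
    using that by (simp_all add: of_nat_diff)
  consider (a) "p = 3 * F + 1" "r = 3 * e" "n = e" | (b) "p = 3 * F + 2" "r = 3 * e + 1" "n = e + 1"
    using assms unfolding thirds_def by blast
  then show ?thesis
  proof cases
    case a
    have "(\<Sum>i=1..r. g (of_nat i)) = (\<Sum>j=1..e. g (of_nat (3 * j))) + (\<Sum>j=1..e. g (of_nat (3 * j - 1))) + (\<Sum>j=1..e. g (of_nat (3 * j - 2)))"
      unfolding a by (rule sum_by_thirds)
    also have "(\<Sum>j=1..e. g (of_nat (3 * j - 1))) = (\<Sum>j=1..e. g (3 * (of_nat j + of_nat F) - of_nat p))"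
      by (rule sum.cong) (auto simp: 1 a algebra_simps)
    also have "(\<Sum>j=1..e. g (of_nat (3 * j - 2))) = (\<Sum>j=1..e. g (3 * (of_nat j + of_nat (p - 1 - F)) - 2 * of_nat p))"
      by (rule sum.cong) (auto simp: 1 a algebra_simps)
    finally show ?thesis using a by simp
  next
    case b
    have "(\<Sum>i=1..r. g (of_nat i)) = (\<Sum>i=1..3 * e. g (of_nat i)) + g (of_nat (3 * (e + 1) - 2))"
      unfolding b by simp
    also have "(\<Sum>i=1..3 * e. g (of_nat i)) = (\<Sum>j=1..e. g (of_nat (3 * j))) + (\<Sum>j=1..e. g (of_nat (3 * j - 1))) + (\<Sum>j=1..e. g (of_nat (3 * j - 2)))"
      by (rule sum_by_thirds)
    also have "(\<Sum>j=1..e. g (of_nat (3 * j))) + (\<Sum>j=1..e. g (of_nat (3 * j - 1))) + (\<Sum>j=1..e. g (of_nat (3 * j - 2))) + g (of_nat (3 * (e + 1) - 2))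
        = (\<Sum>j=1..e. g (of_nat (3 * j))) + (\<Sum>j=1..n. g (of_nat (3 * j - 2))) + (\<Sum>j=1..e. g (of_nat (3 * j - 1)))"
      unfolding b by (simp add: add_ac)
    also have "(\<Sum>j=1..n. g (of_nat (3 * j - 2))) = (\<Sum>j=1..n. g (3 * (of_nat j + of_nat F) - of_nat p))"
      by (rule sum.cong) (auto simp: 1 b algebra_simps)
    also have "(\<Sum>j=1..e. g (of_nat (3 * j - 1))) = (\<Sum>j=1..e. g (3 * (of_nat j + of_nat (p - 1 - F)) - 2 * of_nat p))"
      by (rule sum.cong) (auto simp: 1 b algebra_simps)
    finally show ?thesis by simp
  qed
qed

context odd_prime
begin

lemma unit_shift: assumes "unit u" "z \<in> Zp p" shows "unit (u - P * z)"
proof (rule unit_cg[OF assms(1)])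
  show "cg 1 u (u - P * z)" using assms by (intro cgI[of _ z]) (auto intro: unit_Zp)
qed

lemma unit_small: "0 < k \<Longrightarrow> k < p \<Longrightarrow> unit (of_nat k)"
  by (intro unit_nat) (auto dest: dvd_imp_le)

lemma cg_P_cancel: assumes "cg 2 (P * x) (P * y)" "x \<in> Zp p" "y \<in> Zp p" shows "cg 1 x y"
proof -
  obtain z where "z \<in> Zp p" "P * x = P * y + P ^ 2 * z" using assms(1) by (rule cgE)
  then have "P * x = P * (y + P ^ 1 * z)" by (simp add: power2_eq_square algebra_simps)
  then have "x = y + P ^ 1 * z" by simp
  then show ?thesis using assms \<open>z \<in> Zp p\<close> by (intro cgI[of y z])
qed

lemma cg_one_plus_mult:
  assumes "x \<in> Zp p" "y \<in> Zp p" shows "cg 2 ((1 + P * x) * (1 + P * y)) (1 + P * (x + y))"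
  using assms by (intro cgI[of _ "x * y"] Zp_rules Zp_1 Zp_of_nat) (simp_all add: power2_eq_square algebra_simps)

lemma shifted_fact:
  assumes "y \<in> Zp p" "a + n < p"
  shows "cg 2 (fact a * (\<Prod>j=1..n. of_nat j + of_nat a - P * y)) (fact (a + n) * (1 + P * (- y * (H (a + n) - H a))))"
  using assms(2)
proof (induction n)
  case 0
  have "fact a \<in> Zp p" using 0 by (intro unit_Zp unit_fact) simp
  from cg_refl[OF this] show ?case by simp
next
  case (Suc n)
  let ?k = "of_nat (a + n) + 1 :: rat"
  have u: "unit ?k" using unit_small[of "a + n + 1"] Suc.prems by (simp add: add_ac)
  then have k: "?k \<noteq> 0" "?k \<in> Zp p" "1 / ?k \<in> Zp p" by (auto simp: unit_def)
  have f: "fact (a + n) \<in> Zp p" using Suc.prems by (intro unit_Zp unit_fact) simp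
  have Hz: "H (a + n) \<in> Zp p" "H a \<in> Zp p" using Suc.prems by (auto intro!: H_Zp)
  have "(\<Prod>j=1..Suc n. of_nat j + of_nat a - P * y) = (\<Prod>j=1..n. of_nat j + of_nat a - P * y) * (?k - P * y)"
    by (simp add: algebra_simps)
  then have "fact a * (\<Prod>j=1..Suc n. of_nat j + of_nat a - P * y) = (fact a * (\<Prod>j=1..n. of_nat j + of_nat a - P * y)) * (?k - P * y)"
    by (simp only: mult.assoc)
  also have "cg 2 \<dots> ((fact (a + n) * (1 + P * (- y * (H (a + n) - H a)))) * (?k - P * y))"
    using Suc by (intro cg_mult[OF _ cg_refl] Zp_diff[OF k(2)] Zp_mult[OF Zp_of_nat assms(1)]) simp
  also have "(fact (a + n) * (1 + P * (- y * (H (a + n) - H a)))) * (?k - P * y)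
      = fact (a + Suc n) * ((1 + P * (- y * (H (a + n) - H a))) * (1 + P * (- y * (1 / ?k))))"
    using k(1) by (simp add: field_simps)
  also have "cg 2 \<dots> (fact (a + Suc n) * (1 + P * (- y * (H (a + n) - H a) + - y * (1 / ?k))))"
    using Suc.prems by (intro cg_mult_left cg_one_plus_mult Zp_rules assms(1) Hz k unit_Zp[OF unit_fact])
  also have "- y * (H (a + n) - H a) + - y * (1 / ?k) = - y * (H (a + Suc n) - H a)"
    by (simp add: H_Suc algebra_simps)
  finally show ?case .
qed

lemma shifted_H:
  assumes "y \<in> Zp p" "a + n < p"
  shows "cg 1 (\<Sum>j=1..n. 1 / (of_nat j + of_nat a - P * y)) (H (a + n) - H a)"
  using assms(2)
proof (induction n)
  case 0
  show ?case by auto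
next
  case (Suc n)
  let ?k = "of_nat (a + n) + 1 :: rat"
  have u: "unit ?k" using unit_small[of "a + n + 1"] Suc.prems by (simp add: add_ac)
  then have v: "unit (?k - P * y)" using assms(1) by (rule unit_shift)
  have uv: "?k \<noteq> 0" "1 / ?k \<in> Zp p" "?k - P * y \<noteq> 0" "1 / (?k - P * y) \<in> Zp p" using u v by (auto simp: unit_def)
  have "cg 1 (1 / (?k - P * y)) (1 / ?k)"
  proof (rule cgI)
    show "1 / ?k \<in> Zp p" by (rule uv)
    show "y * (1 / ?k) * (1 / (?k - P * y)) \<in> Zp p" by (intro Zp_rules uv assms(1))
    show "1 / (?k - P * y) = 1 / ?k + P ^ 1 * (y * (1 / ?k) * (1 / (?k - P * y)))"
      using uv(1,3) by (simp add: divide_simps)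
  qed
  with Suc have "cg 1 ((\<Sum>j=1..n. 1 / (of_nat j + of_nat a - P * y)) + 1 / (?k - P * y)) ((H (a + n) - H a) + 1 / ?k)"
    by (intro cg_add) auto
  then show ?case by (simp add: H_Suc algebra_simps)
qed

lemma fact_reflect:
  assumes "m < p"
  shows "cg 2 (fact (p - 1 - m) * ((-1) ^ m * (fact m * (1 + P * (- H m))))) (fact (p - 1))"
proof -
  have f: "fact (p - 1) = fact (p - 1 - m) * ((-1) ^ m * (\<Prod>j=1..m. of_nat j + of_nat 0 - P * 1))"
    using assms
  proof (induction m)
    case (Suc m)
    then have "fact (p - 1 - m) = of_nat (p - 1 - m) * (fact (p - 1 - Suc m) :: rat)"
      by (subst fact_reduce) auto
    also have "of_nat (p - 1 - m) = - (of_nat (Suc m) + of_nat 0 - P * 1 :: rat)"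
      using Suc.prems by (simp add: of_nat_diff)
    finally have *: "fact (p - 1 - m) = - (of_nat (Suc m) + of_nat 0 - P * 1) * (fact (p - 1 - Suc m) :: rat)" .
    have "fact (p - 1) = fact (p - 1 - m) * ((-1) ^ m * (\<Prod>j=1..m. of_nat j + of_nat 0 - P * 1))"
      using Suc by simp
    then show ?case unfolding * by (simp add: algebra_simps)
  qed simp
  have "cg 2 (fact 0 * (\<Prod>j=1..m. of_nat j + of_nat 0 - P * 1)) (fact (0 + m) * (1 + P * (- 1 * (H (0 + m) - H 0))))"
    using assms by (intro shifted_fact) auto
  then have "cg 2 (\<Prod>j=1..m. of_nat j + of_nat 0 - P * 1) (fact m * (1 + P * (- H m)))"
    by (simp only: fact_0 mult_1 add_0 H_0 diff_zero mult_minus_left)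
  then have "cg 2 (fact (p - 1 - m) * ((-1) ^ m * (\<Prod>j=1..m. of_nat j + of_nat 0 - P * 1))) (fact (p - 1 - m) * ((-1) ^ m * (fact m * (1 + P * (- H m)))))"
    using p_gt_2 by (intro cg_mult_left Zp_power unit_Zp[OF unit_fact] Zp_minus Zp_1) auto
  then show ?thesis unfolding f by (rule cg_sym)
qed

lemma H_reflect: assumes "m < p" shows "cg 1 (H (p - 1 - m)) (H m)"
proof -
  have top: "cg 1 (H (p - 1) - H (p - 1 - m)) (- H m)" if "m < p" for m
    using that
  proof (induction m)
    case 0
    then show ?case by auto
  next
    case (Suc m)
    let ?k = "of_nat m + 1 :: rat"
    have u: "unit ?k" using unit_small[of "m + 1"] Suc.prems by (simp add: add_ac)
    have v: "unit (of_nat (p - 1 - m))" using Suc.prems by (intro unit_small) auto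
    have pm: "of_nat (p - 1 - m) = P - ?k" using Suc.prems by (simp add: of_nat_diff)
    have uv: "?k \<noteq> 0" "1 / ?k \<in> Zp p" "P - ?k \<noteq> 0" "1 / (P - ?k) \<in> Zp p" using u v unfolding pm by (auto simp: unit_def)
    have "cg 1 (1 / (P - ?k)) (- (1 / ?k))"
    proof (rule cgI)
      show "- (1 / ?k) \<in> Zp p" by (intro Zp_minus uv)
      show "(1 / ?k) * (1 / (P - ?k)) \<in> Zp p" by (intro Zp_rules uv)
      show "1 / (P - ?k) = - (1 / ?k) + P ^ 1 * ((1 / ?k) * (1 / (P - ?k)))"
        using uv(1,3) by (simp add: divide_simps)
    qed
    with Suc have c: "cg 1 ((H (p - 1) - H (p - 1 - m)) + 1 / (P - ?k)) (- H m + - (1 / ?k))"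
      by (intro cg_add) auto
    have "H (p - 1 - Suc m) = H (p - 1 - m) - 1 / (P - ?k)"
      using H_pred[of "p - 1 - m"] Suc.prems unfolding pm by simp
    then have e: "H (p - 1) - H (p - 1 - Suc m) = (H (p - 1) - H (p - 1 - m)) + 1 / (P - ?k)" by linarith
    have "- H (Suc m) = - H m + - (1 / ?k)" by (simp add: H_Suc add_ac)
    with c e show ?case by (simp only:)
  qed
  have hz: "H (p - 1) \<in> Zp p" "H m \<in> Zp p" "H (p - 1 - m) \<in> Zp p" using assms p_gt_2 by (auto intro!: H_Zp)
  have "cg 1 (H (p - 1)) (- H (p - 1))" using top[of "p - 1"] p_gt_2 by simp
  then have "cg 1 (H (p - 1) + H (p - 1)) (- H (p - 1) + H (p - 1))" using hz by (intro cg_add cg_refl)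
  then have "cg 1 (2 * H (p - 1)) (2 * 0)" by simp
  moreover have "unit 2" using unit_small[of 2] p_gt_2 by simp
  ultimately have z: "cg 1 (H (p - 1)) 0" using cg_unit_cancel hz Zp_0 by blast
  have "cg 1 (H (p - 1) - (H (p - 1) - H (p - 1 - m))) (0 - - H m)" using z top[OF assms] by (rule cg_diff)
  then show ?thesis by simp
qed

lemma unit_3: "p \<noteq> 3 \<Longrightarrow> unit 3"
  using unit_small[of 3] p_gt_2 by simp

lemma third_Zp: assumes "p \<noteq> 3" shows "1 / 3 \<in> Zp p" "2 / 3 \<in> Zp p"
proof -
  show z: "1 / 3 \<in> Zp p" using unit_3[OF assms] by (simp add: unit_def)
  show "2 / 3 \<in> Zp p" using Zp_mult[OF Zp_numeral z, of "num.Bit0 num.One"] by simp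
qed

lemma thirds_fact:
  assumes t: "thirds p F r e n" and p3: "p \<noteq> 3" and le: "e \<le> F" and n: "F + n < p"
  shows "cg 2 (fact F * fact (p - 1 - F) * fact r)
    (3 ^ r * fact e * fact (F + n) * fact (p - 1 - F + e) * (1 + P * (- (1 / 3) * (H (F + n) - H F) - 2 / 3 * (H (p - 1 - F + e) - H (p - 1 - F)))))"
proof -
  have F: "F < p - 1" using t p_gt_2 unfolding thirds_def by auto
  have un: "p - 1 - F + e < p" using F le by linarith
  have r: "r = e + n + e" using t unfolding thirds_def by auto
  have u3: "1 / 3 \<in> Zp p" "2 * (1 / 3) \<in> Zp p" using third_Zp[OF p3] by simp_all
  let ?A = "\<Prod>j=1..n. of_nat j + of_nat F - P * (1 / 3) :: rat"
  let ?B = "\<Prod>j=1..e. of_nat j + of_nat (p - 1 - F) - P * (2 * (1 / 3)) :: rat"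
  have "fact r = (\<Prod>i=1..r. of_nat i :: rat)" by (simp add: fact_prod)
  also have "\<dots> = (\<Prod>j=1..e. 3 * of_nat j) * (\<Prod>j=1..n. 3 * (of_nat j + of_nat F) - P) * (\<Prod>j=1..e. 3 * (of_nat j + of_nat (p - 1 - F)) - 2 * P)"
    by (rule thirds_prod[OF t, of "\<lambda>x. x"])
  also have "(\<Prod>j=1..e. 3 * of_nat j :: rat) = 3 ^ e * fact e" by (simp add: prod.distrib fact_prod)
  also have "(\<Prod>j=1..n. 3 * (of_nat j + of_nat F) - P) = (\<Prod>j=1..n. 3 * (of_nat j + of_nat F - P * (1 / 3)))"
    by (simp add: algebra_simps)
  also have "\<dots> = 3 ^ n * ?A" by (simp only: prod.distrib prod_constant card_atLeastAtMost diff_Suc_1)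
  also have "(\<Prod>j=1..e. 3 * (of_nat j + of_nat (p - 1 - F)) - 2 * P) = (\<Prod>j=1..e. 3 * (of_nat j + of_nat (p - 1 - F) - P * (2 * (1 / 3))))"
    by (simp add: algebra_simps)
  also have "\<dots> = 3 ^ e * ?B" by (simp only: prod.distrib prod_constant card_atLeastAtMost diff_Suc_1)
  also have "3 ^ e * fact e * (3 ^ n * ?A) * (3 ^ e * ?B) = 3 ^ r * fact e * ?A * ?B"
    unfolding r power_add by (simp only: mult_ac)
  finally have f: "fact r = 3 ^ r * fact e * ?A * ?B" .
  have "fact F * fact (p - 1 - F) * fact r = 3 ^ r * fact e * ((fact F * ?A) * (fact (p - 1 - F) * ?B))"
    unfolding f by (simp only: mult_ac)
  also have "cg 2 \<dots> (3 ^ r * fact e * ((fact (F + n) * (1 + P * (- (1 / 3) * (H (F + n) - H F))))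
      * (fact (p - 1 - F + e) * (1 + P * (- (2 * (1 / 3)) * (H (p - 1 - F + e) - H (p - 1 - F)))))))"
    using F le un n by (intro cg_mult_left cg_mult shifted_fact u3 Zp_mult Zp_power Zp_numeral unit_Zp[OF unit_fact]) auto
  also have "\<dots> = (3 ^ r * fact e * fact (F + n) * fact (p - 1 - F + e)) *
     ((1 + P * (- (1 / 3) * (H (F + n) - H F))) * (1 + P * (- (2 * (1 / 3)) * (H (p - 1 - F + e) - H (p - 1 - F)))))"
    by (simp only: mult_ac)
  also have "cg 2 \<dots> ((3 ^ r * fact e * fact (F + n) * fact (p - 1 - F + e)) *
     (1 + P * (- (1 / 3) * (H (F + n) - H F) + - (2 * (1 / 3)) * (H (p - 1 - F + e) - H (p - 1 - F)))))"
    using F le un n by (intro cg_mult_left cg_one_plus_mult Zp_mult Zp_power Zp_numeral unit_Zp[OF unit_fact] Zp_minus Zp_diff H_Zp u3) auto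
  also have "- (1 / 3) * (H (F + n) - H F) + - (2 * (1 / 3)) * (H (p - 1 - F + e) - H (p - 1 - F))
     = - (1 / 3) * (H (F + n) - H F) - 2 / 3 * (H (p - 1 - F + e) - H (p - 1 - F))" by simp
  finally show ?thesis .
qed

lemma thirds_H:
  assumes t: "thirds p F r e n" and p3: "p \<noteq> 3" and le: "e \<le> F" and n: "F + n < p"
  shows "cg 1 (H r) (1 / 3 * (H e + (H (F + n) - H F) + (H (p - 1 - F + e) - H (p - 1 - F))))"
proof -
  have F: "F < p - 1" using t p_gt_2 unfolding thirds_def by auto
  have un: "p - 1 - F + e < p" using F le by linarith
  have u3: "1 / 3 \<in> Zp p" "2 * (1 / 3) \<in> Zp p" using third_Zp[OF p3] by simp_all
  let ?A = "\<Sum>j=1..n. 1 / (of_nat j + of_nat F - P * (1 / 3)) :: rat"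
  let ?B = "\<Sum>j=1..e. 1 / (of_nat j + of_nat (p - 1 - F) - P * (2 * (1 / 3))) :: rat"
  have "H r = (\<Sum>j=1..e. 1 / (3 * of_nat j)) + (\<Sum>j=1..n. 1 / (3 * (of_nat j + of_nat F) - P)) + (\<Sum>j=1..e. 1 / (3 * (of_nat j + of_nat (p - 1 - F)) - 2 * P))"
    unfolding H_def by (rule thirds_sum[OF t, of "\<lambda>x. 1 / x"])
  also have "(\<Sum>j=1..e. 1 / (3 * of_nat j) :: rat) = 1 / 3 * H e" unfolding H_def sum_distrib_left by simp
  also have "(\<Sum>j=1..n. 1 / (3 * (of_nat j + of_nat F) - P)) = 1 / 3 * ?A"
    unfolding sum_distrib_left
  proof (rule sum.cong)
    fix j
    have "3 * (of_nat j + of_nat F) - P = 3 * (of_nat j + of_nat F - P * (1 / 3))" by simp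
    then show "1 / (3 * (of_nat j + of_nat F) - P) = 1 / 3 * (1 / (of_nat j + of_nat F - P * (1 / 3)))"
      by (simp only: times_divide_times_eq mult_1)
  qed simp
  also have "(\<Sum>j=1..e. 1 / (3 * (of_nat j + of_nat (p - 1 - F)) - 2 * P)) = 1 / 3 * ?B"
    unfolding sum_distrib_left
  proof (rule sum.cong)
    fix j
    have "3 * (of_nat j + of_nat (p - 1 - F)) - 2 * P = 3 * (of_nat j + of_nat (p - 1 - F) - P * (2 * (1 / 3)))" by simp
    then show "1 / (3 * (of_nat j + of_nat (p - 1 - F)) - 2 * P) = 1 / 3 * (1 / (of_nat j + of_nat (p - 1 - F) - P * (2 * (1 / 3))))"
      by (simp only: times_divide_times_eq mult_1)
  qed simp
  also have "1 / 3 * H e + 1 / 3 * ?A + 1 / 3 * ?B = 1 / 3 * (H e + ?A + ?B)" by (simp only: distrib_left)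
  also have "cg 1 \<dots> (1 / 3 * (H e + (H (F + n) - H F) + (H (p - 1 - F + e) - H (p - 1 - F))))"
    using F le un n by (intro cg_mult_left cg_add shifted_H u3 cg_refl H_Zp) auto
  finally show ?thesis .
qed

lemma three_power:
  assumes "p = 3 * F + 1 \<or> p = 3 * F + 2" "p \<noteq> 3"
  shows "cg 2 (3 ^ (p - 1) * (1 + P * (2 / 3 * H F))) 1"
proof -
  obtain n where t: "thirds p F (p - 1) F n" "F + n = p - 1 - F"
    using assms p_gt_2 by (auto simp: thirds_def)
  have F: "F < p - 1" using assms p_gt_2 by auto
  have hz: "H (p - 1) \<in> Zp p" "H F \<in> Zp p" "H (p - 1 - F) \<in> Zp p" using F by (auto intro!: H_Zp)
  note u3 = third_Zp[OF assms(2)]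
  have e: "p - 1 - F + F = p - 1" using F by simp
  have z: "cg 1 (H (p - 1)) 0" using H_reflect[of 0] p_gt_2 by simp
  have r: "cg 1 (H (p - 1 - F)) (H F)" using F by (intro H_reflect) simp
  let ?f = "fact F * fact (p - 1 - F) * fact (p - 1) :: rat"
  have uf: "unit ?f" using F by (intro unit_mult unit_fact) auto
  have le: "F \<le> F" "F + n < p" using F unfolding t(2) by auto
  let ?y = "- (1 / 3) * (H (p - 1 - F) - H F) - 2 / 3 * (H (p - 1) - H (p - 1 - F))"
  have "cg 2 ?f (3 ^ (p - 1) * fact F * fact (p - 1 - F) * fact (p - 1) * (1 + P * ?y))"
    using thirds_fact[OF t(1) assms(2) le] unfolding t(2) e .
  then have "cg 2 (?f * 1) (?f * (3 ^ (p - 1) * (1 + P * ?y)))"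
    by (simp only: mult_ac mult_1)
  then have 1: "cg 2 1 (3 ^ (p - 1) * (1 + P * ?y))"
    by (rule cg_unit_cancel[OF uf]) (intro Zp_rules Zp_1 Zp_of_nat Zp_numeral u3 hz)+
  have "cg 1 ?y (- (1 / 3) * (H F - H F) - 2 / 3 * (0 - H F))"
    by (intro cg_diff cg_mult_left r z cg_refl Zp_minus u3 hz)
  then have "cg 1 ?y (2 / 3 * H F)" by simp
  then have "cg 2 (P * ?y) (P * (2 / 3 * H F))" by (rule cg_P_mult2)
  then have "cg 2 (1 + P * ?y) (1 + P * (2 / 3 * H F))" by (rule cg_add[OF cg_refl[OF Zp_1]])
  then have "cg 2 (3 ^ (p - 1) * (1 + P * ?y)) (3 ^ (p - 1) * (1 + P * (2 / 3 * H F)))"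
    by (rule cg_mult_left) (intro Zp_power Zp_numeral)
  from cg_trans[OF 1 this] show ?thesis by (rule cg_sym)
qed

lemma three_power_h:
  assumes "p = 3 * F + 1 \<or> p = 3 * F + 2" "p \<noteq> 3"
  shows "cg 2 (3 ^ h) (of_int (leg 3) * (1 + P * (- (1 / 3) * H F)))"
proof -
  let ?s = "of_int (leg 3) :: rat"
  have "\<not> int p dvd 3"
  proof
    assume "int p dvd 3"
    then have "p dvd 3" by (metis int_dvd_int_iff of_nat_numeral)
    then show False using assms(2) p_gt_2 by (auto dest: dvd_imp_le)
  qed
  then have "leg 3 * leg 3 = 1" by (rule leg_square)
  then have s: "?s * ?s = 1" by (metis of_int_1 of_int_mult)
  have F: "F < p" using assms p_gt_2 by auto
  have hz: "H F \<in> Zp p" using F by (rule H_Zp)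
  note u3 = third_Zp[OF assms(2)]
  have sz: "?s \<in> Zp p" by simp
  have "[3 ^ h = leg 3] (mod int p ^ 1)" using leg_euler[of 3] by (simp add: cong_sym)
  then have "cg 1 (of_int (3 ^ h)) ?s" unfolding cg_of_int_iff .
  then have "cg 1 (3 ^ h) ?s" by simp
  then obtain x where x: "x \<in> Zp p" "3 ^ h = ?s + P * x" by (rule cgE) simp
  have "3 ^ (p - 1) = (3 ^ h :: rat) * 3 ^ h" using p_eq by (simp flip: power_add mult_2)
  also have "\<dots> = 1 + 2 * P * (?s * x) + P ^ 2 * x ^ 2"
    unfolding x(2) using s by (simp add: power2_eq_square algebra_simps)
  finally have q: "3 ^ (p - 1) = 1 + 2 * P * (?s * x) + P ^ 2 * x ^ 2" .
  have "cg 2 (1 + P * (2 * (?s * x) + 2 / 3 * H F)) (3 ^ (p - 1) * (1 + P * (2 / 3 * H F)))"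
  proof (rule cg_sym, rule cgI)
    show "1 + P * (2 * (?s * x) + 2 / 3 * H F) \<in> Zp p" by (intro Zp_rules Zp_1 Zp_of_nat Zp_numeral sz x u3 hz)
    show "x ^ 2 + (2 * (?s * x) + P * x ^ 2) * (2 / 3 * H F) \<in> Zp p" by (intro Zp_rules Zp_1 Zp_of_nat Zp_numeral sz x u3 hz)
    show "3 ^ (p - 1) * (1 + P * (2 / 3 * H F)) = 1 + P * (2 * (?s * x) + 2 / 3 * H F)
      + P ^ 2 * (x ^ 2 + (2 * (?s * x) + P * x ^ 2) * (2 / 3 * H F))"
      unfolding q by (simp add: power2_eq_square algebra_simps)
  qed
  from cg_trans[OF this three_power[OF assms]] have "cg 2 (1 + P * (2 * (?s * x) + 2 / 3 * H F)) 1" .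
  then have "cg 2 ((1 + P * (2 * (?s * x) + 2 / 3 * H F)) - 1) (1 - 1)" by (rule cg_diff) (rule cg_refl[OF Zp_1])
  then have "cg 2 (P * (2 * (?s * x) + 2 / 3 * H F)) (P * 0)" by (simp only: add_diff_cancel_left' diff_self mult_zero_right)
  then have "cg 1 (2 * (?s * x) + 2 / 3 * H F) 0"
    by (rule cg_P_cancel) (intro Zp_rules Zp_0 Zp_numeral sz x u3 hz)+
  then have "cg 1 (2 * (?s * x + 1 / 3 * H F)) (2 * 0)" by (simp add: distrib_left)
  moreover have "unit 2" using unit_small[of 2] p_gt_2 by simp
  ultimately have "cg 1 (?s * x + 1 / 3 * H F) 0"
    using cg_unit_cancel[of 2 1 "?s * x + 1 / 3 * H F" 0] Zp_add[OF Zp_mult[OF sz x(1)] Zp_mult[OF u3(1) hz]] Zp_0 by simp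
  then have "cg 1 (?s * (?s * x + 1 / 3 * H F)) (?s * 0)" by (rule cg_mult_left) (rule sz)
  then have "cg 1 (x + ?s * (1 / 3 * H F)) 0" using s by (simp add: distrib_left flip: mult.assoc)
  then have "cg 1 ((x + ?s * (1 / 3 * H F)) - ?s * (1 / 3 * H F)) (0 - ?s * (1 / 3 * H F))"
    by (rule cg_diff) (intro cg_refl Zp_rules sz u3 hz)
  then have "cg 1 x (?s * (- (1 / 3) * H F))" by (simp add: algebra_simps)
  then have "cg 2 (P * x) (P * (?s * (- (1 / 3) * H F)))" by (rule cg_P_mult2)
  then have "cg 2 (?s + P * x) (?s + P * (?s * (- (1 / 3) * H F)))" by (intro cg_add cg_refl sz)
  then show ?thesis unfolding x(2)[symmetric] by (simp add: algebra_simps)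
qed

end

section \<open>The parameter \<open>-1/6\<close>\<close>

context odd_prime
begin

lemma cg_one_plus: "cg 1 x y \<Longrightarrow> cg 2 (1 + P * x) (1 + P * y)"
  by (rule cg_add[OF cg_refl[OF Zp_1] cg_P_mult2])

lemma fact_reflect_mult:
  assumes "m < p"
  shows "cg 2 (fact m * fact (p - 1 - m)) ((-1) ^ m * fact (p - 1) * (1 + P * H m))"
proof -
  let ?z = "(-1) ^ m * (1 + P * H m) :: rat"
  have hz: "H m \<in> Zp p" "- H m \<in> Zp p" using assms by (auto intro!: H_Zp)
  have z: "?z \<in> Zp p" by (intro Zp_rules Zp_1 Zp_of_nat hz)
  have f: "fact m * fact (p - 1 - m) \<in> Zp p" using assms p_gt_2 by (intro Zp_mult unit_Zp[OF unit_fact]) auto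
  have s: "(-1) ^ m * (-1) ^ m = (1::rat)" by (simp flip: power_mult_distrib)
  have e: "?z * (fact (p - 1 - m) * ((-1) ^ m * (fact m * (1 + P * (- H m)))))
      = (fact m * fact (p - 1 - m)) * ((1 + P * H m) * (1 + P * (- H m)))"
  proof -
    have "?z * (fact (p - 1 - m) * ((-1) ^ m * (fact m * (1 + P * (- H m)))))
      = ((-1) ^ m * (-1) ^ m) * ((fact m * fact (p - 1 - m)) * ((1 + P * H m) * (1 + P * (- H m))))"
      by (simp only: mult_ac)
    then show ?thesis unfolding s by simp
  qed
  have "cg 2 (?z * (fact (p - 1 - m) * ((-1) ^ m * (fact m * (1 + P * (- H m)))))) (?z * fact (p - 1))"
    using fact_reflect[OF assms] z by (rule cg_mult_left)
  then have 1: "cg 2 ((fact m * fact (p - 1 - m)) * ((1 + P * H m) * (1 + P * (- H m)))) (?z * fact (p - 1))"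
    unfolding e .
  have "cg 2 ((fact m * fact (p - 1 - m)) * ((1 + P * H m) * (1 + P * (- H m)))) ((fact m * fact (p - 1 - m)) * (1 + P * (H m + - H m)))"
    by (rule cg_mult_left[OF cg_one_plus_mult[OF hz] f])
  then have "cg 2 ((fact m * fact (p - 1 - m)) * ((1 + P * H m) * (1 + P * (- H m)))) (fact m * fact (p - 1 - m))"
    by simp
  from cg_trans[OF cg_sym[OF this] 1] have "cg 2 (fact m * fact (p - 1 - m)) (?z * fact (p - 1))" .
  then show ?thesis by (simp only: mult_ac)
qed

lemma thirds_binomial:
  assumes t: "thirds p F r e n" and p3: "p \<noteq> 3" and eF: "e \<le> F" and hr: "h = 2 * r"
    and Fn: "F + n = h - e" and Fe: "p - 1 - F + e = p - 1 - r"
  shows "cg 2 (of_nat (h choose e) ^ 2) (3 ^ h * of_nat (h choose r) ^ 2 * (1 + P * (2 / 3 * (H r - H (h - e)))))"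
    and "cg 1 (1 / 6 * (H e + H (h - e) - 2 * H F)) (1 / 3 * H r)"
proof -
  have F: "F < p" using t unfolding thirds_def by auto
  have bounds: "r < p" "h - e < p" "h < p" "e < p" "p - 1 - r < p" "p - 1 - F < p" "F + n < p" "e \<le> h" "r \<le> h"
    using hr p_eq F eF Fe Fn p_gt_2 by auto
  note third = third_Zp[OF p3]
  have hz: "H r \<in> Zp p" "H (h - e) \<in> Zp p" "H h \<in> Zp p" "H e \<in> Zp p" "H F \<in> Zp p" "H (p - 1 - r) \<in> Zp p" "H (p - 1 - F) \<in> Zp p"
    using bounds F by (auto intro!: H_Zp)
  have rr: "cg 1 (H (p - 1 - r)) (H r)" and rF: "cg 1 (H (p - 1 - F)) (H F)"
    using bounds F by (intro H_reflect; simp)+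
  let ?y = "- (1 / 3) * (H (h - e) - H F) - 2 / 3 * (H (p - 1 - r) - H (p - 1 - F))"
  let ?y' = "- (1 / 3) * (H (h - e) - H F) - 2 / 3 * (H r - H F)"
  let ?w = "fact (p - 1) :: rat" and ?b = "3 ^ r * fact e * fact (h - e) :: rat"
  have yz: "?y' \<in> Zp p" by (intro Zp_rules Zp_minus third hz)
  have bz: "?b \<in> Zp p" using bounds by (intro Zp_mult Zp_power Zp_numeral unit_Zp[OF unit_fact])
  have fz: "fact r \<in> Zp p" "fact (p - 1 - r) \<in> Zp p" using bounds by (auto intro!: unit_Zp[OF unit_fact])
  have sz: "(-1) ^ k \<in> Zp p" for k :: nat by (intro Zp_power Zp_minus Zp_1)
  have wz: "?w \<in> Zp p" using p_gt_2 by (intro unit_Zp unit_fact) simp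
  have 1: "cg 2 (fact F * fact (p - 1 - F) * fact r) (3 ^ r * fact e * fact (h - e) * fact (p - 1 - r) * (1 + P * ?y))"
    using thirds_fact[OF t p3 eF bounds(7)] unfolding Fn Fe .
  have "cg 1 ?y ?y'" by (intro cg_diff cg_mult_left rr rF cg_refl Zp_rules Zp_minus third hz)
  then have "cg 2 (1 + P * ?y) (1 + P * ?y')" by (rule cg_one_plus)
  then have "cg 2 (3 ^ r * fact e * fact (h - e) * fact (p - 1 - r) * (1 + P * ?y)) (3 ^ r * fact e * fact (h - e) * fact (p - 1 - r) * (1 + P * ?y'))"
    by (rule cg_mult_left) (intro Zp_mult[OF bz fz(2)])
  from cg_mult_left[OF cg_trans[OF 1 this] fz(1)]
  have 2: "cg 2 (fact r ^ 2 * (fact F * fact (p - 1 - F))) (?b * (1 + P * ?y') * (fact r * fact (p - 1 - r)))"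
    by (simp only: power2_eq_square mult_ac)
  have 3: "cg 2 (fact r ^ 2 * (fact F * fact (p - 1 - F))) (fact r ^ 2 * ((-1) ^ F * ?w * (1 + P * H F)))"
    using F fz by (intro cg_mult_left fact_reflect_mult Zp_power)
  have 4: "cg 2 (?b * (1 + P * ?y') * (fact r * fact (p - 1 - r))) (?b * (1 + P * ?y') * ((-1) ^ r * ?w * (1 + P * H r)))"
    by (rule cg_mult_left[OF fact_reflect_mult[OF bounds(1)]]) (intro Zp_mult bz Zp_add Zp_1 Zp_of_nat yz)
  from cg_trans[OF cg_trans[OF cg_sym[OF 3] 2] 4]
  have "cg 2 (fact r ^ 2 * ((-1) ^ F * ?w * (1 + P * H F))) (?b * (1 + P * ?y') * ((-1) ^ r * ?w * (1 + P * H r)))" .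
  then have 5: "cg 2 (?w * (fact r ^ 2 * ((-1) ^ F * (1 + P * H F)))) (?w * (?b * ((-1) ^ r * ((1 + P * ?y') * (1 + P * H r)))))"
    by (simp only: mult_ac)
  have uw: "unit ?w" using p_gt_2 by (intro unit_fact) simp
  have 6: "cg 2 (fact r ^ 2 * ((-1) ^ F * (1 + P * H F))) (?b * ((-1) ^ r * ((1 + P * ?y') * (1 + P * H r))))"
    by (rule cg_unit_cancel[OF uw 5]) (intro Zp_mult Zp_add Zp_power[OF fz(1)] bz sz Zp_1 Zp_of_nat yz hz)+
  have 7: "cg 2 (?b * ((-1) ^ r * ((1 + P * ?y') * (1 + P * H r)))) (?b * ((-1) ^ r * (1 + P * (?y' + H r))))"
    by (rule cg_mult_left[OF cg_mult_left[OF cg_one_plus_mult[OF yz hz(1)] sz] bz])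
  let ?s = "(-1) ^ F * (-1) ^ r :: rat"
  have s: "?s ^ 2 = 1" by (simp add: power_mult_distrib flip: power_mult mult.commute[of 2])
  have s': "(-1) ^ F * (-1) ^ F = (1::rat)" by (simp flip: power_mult_distrib)
  let ?m = "1 + P * (- H F)"
  have mz: "?m \<in> Zp p" by (intro Zp_add Zp_1 Zp_mult Zp_of_nat Zp_minus hz)
  have "cg 2 (((-1) ^ F * ?m) * (fact r ^ 2 * ((-1) ^ F * (1 + P * H F)))) (((-1) ^ F * ?m) * (?b * ((-1) ^ r * (1 + P * (?y' + H r)))))"
    by (rule cg_mult_left[OF cg_trans[OF 6 7] Zp_mult[OF sz mz]])
  then have "cg 2 (((-1) ^ F * (-1) ^ F) * (fact r ^ 2 * (?m * (1 + P * H F)))) (?s * ?b * (?m * (1 + P * (?y' + H r))))"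
    by (simp only: mult_ac)
  then have 8: "cg 2 (fact r ^ 2 * (?m * (1 + P * H F))) (?s * ?b * (?m * (1 + P * (?y' + H r))))"
    unfolding s' by simp
  have "cg 2 (fact r ^ 2 * (?m * (1 + P * H F))) (fact r ^ 2 * (1 + P * (- H F + H F)))"
    by (rule cg_mult_left[OF cg_one_plus_mult[OF Zp_minus[OF hz(5)] hz(5)] Zp_power[OF fz(1)]])
  then have 9: "cg 2 (fact r ^ 2 * (?m * (1 + P * H F))) (fact r ^ 2)" by simp
  have "cg 2 (?s * ?b * (?m * (1 + P * (?y' + H r)))) (?s * ?b * (1 + P * (- H F + (?y' + H r))))"
    by (rule cg_mult_left[OF cg_one_plus_mult[OF Zp_minus[OF hz(5)] Zp_add[OF yz hz(1)]] Zp_mult[OF Zp_mult[OF sz sz] bz]])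
  moreover have "- H F + (?y' + H r) = 1 / 3 * (H r - H (h - e))" by (simp add: field_simps)
  ultimately have 10: "cg 2 (?s * ?b * (?m * (1 + P * (?y' + H r)))) (?s * ?b * (1 + P * (1 / 3 * (H r - H (h - e)))))"
    by (simp only:)
  let ?z = "1 / 3 * (H r - H (h - e))"
  have zz: "?z \<in> Zp p" by (intro Zp_mult Zp_diff third hz)
  have 11: "cg 2 (fact r ^ 2) (?s * ?b * (1 + P * ?z))"
    by (rule cg_trans[OF cg_sym[OF 9] cg_trans[OF 8 10]])
  have c1: "fact e * fact (h - e) * of_nat (h choose e) = (fact h :: rat)"
    using binomial_fact[OF bounds(8), where 'a=rat] by simp
  have "h - r = r" using hr by simp
  then have c2: "fact r ^ 2 * of_nat (h choose r) = (fact h :: rat)"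
    using binomial_fact[OF bounds(9), where 'a=rat] by (simp add: power2_eq_square)
  have "cg 2 (of_nat (h choose e) * fact r ^ 2) (of_nat (h choose e) * (?s * ?b * (1 + P * ?z)))"
    by (rule cg_mult_left[OF 11 Zp_of_nat])
  moreover have "of_nat (h choose e) * (?s * ?b * (1 + P * ?z)) = (fact e * fact (h - e) * of_nat (h choose e)) * (?s * 3 ^ r * (1 + P * ?z))"
    by (simp only: mult_ac)
  moreover have "\<dots> = fact r ^ 2 * (?s * 3 ^ r * of_nat (h choose r) * (1 + P * ?z))"
    unfolding c1 c2[symmetric] by (simp only: mult_ac)
  ultimately have 12: "cg 2 (fact r ^ 2 * of_nat (h choose e)) (fact r ^ 2 * (?s * 3 ^ r * of_nat (h choose r) * (1 + P * ?z)))"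
    by (simp only: mult_ac)
  have ur: "unit (fact r ^ 2)" unfolding power2_eq_square using bounds by (intro unit_mult unit_fact)
  have qz: "?s * 3 ^ r * of_nat (h choose r) \<in> Zp p" by (intro Zp_mult sz Zp_power Zp_numeral Zp_of_nat)
  have 13: "cg 2 (of_nat (h choose e)) (?s * 3 ^ r * of_nat (h choose r) * (1 + P * ?z))"
    by (rule cg_unit_cancel[OF ur 12 Zp_of_nat]) (intro Zp_mult[OF qz] Zp_add Zp_1 Zp_mult[OF Zp_of_nat zz])
  from cg_power[OF this, of 2]
  have 14: "cg 2 (of_nat (h choose e) ^ 2) ((?s * 3 ^ r * of_nat (h choose r) * (1 + P * ?z)) ^ 2)" .
  have sq: "(a * b * c * d) ^ 2 = a ^ 2 * b ^ 2 * c ^ 2 * (d * d)" for a b c d :: rat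
    by (simp add: power2_eq_square)
  have "(?s * 3 ^ r * of_nat (h choose r) * (1 + P * ?z)) ^ 2 = ?s ^ 2 * (3 ^ r) ^ 2 * of_nat (h choose r) ^ 2 * ((1 + P * ?z) * (1 + P * ?z))"
    by (rule sq)
  also have "\<dots> = 3 ^ h * of_nat (h choose r) ^ 2 * ((1 + P * ?z) * (1 + P * ?z))"
    unfolding s hr by (simp add: mult.commute flip: power_mult)
  finally have 15: "(?s * 3 ^ r * of_nat (h choose r) * (1 + P * ?z)) ^ 2 = 3 ^ h * of_nat (h choose r) ^ 2 * ((1 + P * ?z) * (1 + P * ?z))" .
  have 16: "cg 2 (3 ^ h * of_nat (h choose r) ^ 2 * ((1 + P * ?z) * (1 + P * ?z))) (3 ^ h * of_nat (h choose r) ^ 2 * (1 + P * (?z + ?z)))"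
    by (rule cg_mult_left[OF cg_one_plus_mult[OF zz zz]]) (intro Zp_mult Zp_power Zp_numeral Zp_of_nat)
  have zz2: "?z + ?z = 2 / 3 * (H r - H (h - e))" by simp
  show "cg 2 (of_nat (h choose e) ^ 2) (3 ^ h * of_nat (h choose r) ^ 2 * (1 + P * (2 / 3 * (H r - H (h - e)))))"
    by (rule cg_trans[OF 14[unfolded 15] 16[unfolded zz2]])
  have "cg 1 (H r) (1 / 3 * (H e + (H (h - e) - H F) + (H (p - 1 - r) - H (p - 1 - F))))"
    using thirds_H[OF t p3 eF bounds(7)] unfolding Fn Fe .
  moreover have "cg 1 (1 / 3 * (H e + (H (h - e) - H F) + (H (p - 1 - r) - H (p - 1 - F)))) (1 / 3 * (H e + (H (h - e) - H F) + (H r - H F)))"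
    by (rule cg_mult_left[OF cg_add[OF cg_refl cg_diff[OF rr rF]] third(1)]) (intro Zp_add Zp_diff hz)
  ultimately have "cg 1 (H r) (1 / 3 * (H e + (H (h - e) - H F) + (H r - H F)))" by (rule cg_trans)
  then have "cg 1 (H r - 1 / 3 * H r) (1 / 3 * (H e + (H (h - e) - H F) + (H r - H F)) - 1 / 3 * H r)"
    by (rule cg_diff[OF _ cg_refl[OF Zp_mult[OF third(1) hz(1)]]])
  then have "cg 1 (1 / 2 * (H r - 1 / 3 * H r)) (1 / 2 * (1 / 3 * (H e + (H (h - e) - H F) + (H r - H F)) - 1 / 3 * H r))"
    by (rule cg_mult_left) (intro Zp_divide_2 Zp_1)
  moreover have "1 / 2 * (H r - 1 / 3 * H r) = 1 / 3 * H r" by simp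
  moreover have "1 / 2 * (1 / 3 * (H e + (H (h - e) - H F) + (H r - H F)) - 1 / 3 * H r) = 1 / 6 * (H e + H (h - e) - 2 * H F)"
    by (simp add: algebra_simps)
  ultimately show "cg 1 (1 / 6 * (H e + H (h - e) - 2 * H F)) (1 / 3 * H r)" using cg_sym by (simp only:)
qed

lemma sixth_Zp: assumes "p \<noteq> 3" shows "1 / 6 \<in> Zp p"
proof -
  have "1 / 3 / 2 \<in> Zp p" by (rule Zp_divide_2[OF third_Zp(1)[OF assms]])
  then show ?thesis by simp
qed

lemma G6_thirds:
  assumes t: "thirds p F r e n" and p3: "p \<noteq> 3" and eF: "e \<le> F" and hr: "h = 2 * r"
    and Fn: "F + n = h - e" and Fe: "p - 1 - F + e = p - 1 - r" and uv: "int p = u ^ 2 + 4 * v ^ 2"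
  shows "cg 2 (G h (of_nat (2 * e) + P * (- (1 / 6)))) (of_int (leg 3) * (4 * of_int u ^ 2 - 2 * P))"
proof -
  have F: "F < p" "p = 3 * F + 1 \<or> p = 3 * F + 2" using t unfolding thirds_def by auto
  have b: "r < p" "h - e < p" "h < p" "e < p" "2 * e < p"
    using hr p_eq F eF Fe Fn p_gt_2 by auto
  have hz: "H r \<in> Zp p" "H (h - e) \<in> Zp p" "H h \<in> Zp p" "H e \<in> Zp p" "H F \<in> Zp p"
    using b F by (auto intro!: H_Zp)
  note third = third_Zp[OF p3] sixth_Zp[OF p3]
  have tz: "- (1 / 6) \<in> Zp p" by (rule Zp_minus[OF third(3)])
  let ?C = "of_nat (h choose e) ^ 2 :: rat" and ?D = "of_nat (h choose r) ^ 2 :: rat" and ?s = "of_int (leg 3) :: rat"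
  let ?g = "(1 + - (1 / 6)) * H (h - e) - - (1 / 6) * H e - H h"
  let ?z = "2 / 3 * (H r - H (h - e))" and ?w = "- (1 / 3) * H F"
  have z: "?g \<in> Zp p" "?z \<in> Zp p" "?w \<in> Zp p" by (intro Zp_mult Zp_diff Zp_add Zp_1 tz third Zp_minus hz)+
  have Dz: "?D \<in> Zp p" "?s \<in> Zp p" by (auto intro: Zp_power)
  have Ez: "1 + P * x \<in> Zp p" if "x \<in> Zp p" for x by (intro Zp_add Zp_1 Zp_mult Zp_of_nat that)
  have 1: "cg 2 (G h (of_nat (2 * e) + P * (- (1 / 6)))) (?C * (1 + P * ?g))"
    by (rule G_CM[OF b(5) tz])
  have 2: "cg 2 (?C * (1 + P * ?g)) (3 ^ h * ?D * (1 + P * ?z) * (1 + P * ?g))"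
    by (rule cg_mult[OF thirds_binomial(1)[OF t p3 eF hr Fn Fe] cg_refl[OF Ez[OF z(1)]]])
  have 3: "cg 2 (3 ^ h * (?D * (1 + P * ?z) * (1 + P * ?g))) (?s * (1 + P * ?w) * (?D * (1 + P * ?z) * (1 + P * ?g)))"
    by (rule cg_mult[OF three_power_h[OF F(2) p3] cg_refl[OF Zp_mult[OF Zp_mult[OF Dz(1) Ez[OF z(2)]] Ez[OF z(1)]]]])
  have 4: "cg 2 (?s * ?D * ((1 + P * ?w) * ((1 + P * ?z) * (1 + P * ?g)))) (?s * ?D * ((1 + P * ?w) * (1 + P * (?z + ?g))))"
    by (rule cg_mult_left[OF cg_mult_left[OF cg_one_plus_mult[OF z(2,1)] Ez[OF z(3)]] Zp_mult[OF Dz(2,1)]])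
  have 5: "cg 2 (?s * ?D * ((1 + P * ?w) * (1 + P * (?z + ?g)))) (?s * ?D * (1 + P * (?w + (?z + ?g))))"
    by (rule cg_mult_left[OF cg_one_plus_mult[OF z(3) Zp_add[OF z(2,1)]] Zp_mult[OF Dz(2,1)]])
  have e: "?w + (?z + ?g) = 1 / 6 * (H e + H (h - e) - 2 * H F) + (2 / 3 * H r - H h)"
    by (simp add: field_simps)
  have "cg 1 (?w + (?z + ?g)) (1 / 3 * H r + (2 / 3 * H r - H h))"
    unfolding e by (rule cg_add[OF thirds_binomial(2)[OF t p3 eF hr Fn Fe] cg_refl[OF Zp_diff[OF Zp_mult[OF third(2) hz(1)] hz(3)]]])
  then have 6: "cg 2 (?s * ?D * (1 + P * (?w + (?z + ?g)))) (?s * ?D * (1 + P * (1 / 3 * H r + (2 / 3 * H r - H h))))"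
    by (intro cg_mult_left[OF cg_one_plus Zp_mult[OF Dz(2,1)]])
  have e: "1 + P * (1 / 3 * H r + (2 / 3 * H r - H h)) = 1 - P * (H h - H r)" by (simp add: field_simps)
  have pr: "p = 4 * r + 1" using hr p_eq by simp
  have 7: "cg 2 (?s * (?D * (1 - P * (H h - H r)))) (?s * (4 * of_int u ^ 2 - 2 * P))"
    by (rule cg_mult_left[OF quartic_binomial[OF pr uv] Dz(2)])
  have 8: "cg 2 (?s * ?D * ((1 + P * ?w) * ((1 + P * ?z) * (1 + P * ?g)))) (?s * (4 * of_int u ^ 2 - 2 * P))"
    by (rule cg_trans[OF 4 cg_trans[OF 5 cg_trans[OF 6 7[folded e mult.assoc]]]])
  have "?s * ?D * ((1 + P * ?w) * ((1 + P * ?z) * (1 + P * ?g))) = ?s * (1 + P * ?w) * (?D * (1 + P * ?z) * (1 + P * ?g))"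
    by (simp only: mult_ac)
  from cg_trans[OF 3 8[unfolded this]]
  have "cg 2 (3 ^ h * (?D * (1 + P * ?z) * (1 + P * ?g))) (?s * (4 * of_int u ^ 2 - 2 * P))" .
  then show ?thesis by (intro cg_trans[OF 1 cg_trans[OF 2]]) (simp only: mult.assoc)
qed

theorem G6_split:
  assumes p: "p mod 4 = 1" "p > 3" and uv: "int p = u ^ 2 + 4 * v ^ 2"
  shows "cg 2 (G h (- (1 / 6))) (of_int (leg 3) * (4 * of_int u ^ 2 - 2 * P))"
proof -
  have "p mod 3 \<noteq> 0"
  proof
    assume "p mod 3 = 0"
    then have "3 dvd p" by presburger
    then have "3 = p" using prime_p primes_dvd_imp_eq[of 3 p] by simp
    then show False using p(2) by simp
  qed
  then have "p mod 12 = 1 \<or> p mod 12 = 5" using p by presburger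
  then consider (a) "p mod 12 = 1" | (b) "p mod 12 = 5" by blast
  then show ?thesis
  proof cases
    case a
    then obtain e where e: "p = 12 * e + 1" by (metis mod_mult_div_eq add.commute)
    have he: "h = 6 * e" using e unfolding h_def by simp
    have "cg 2 (G h (of_nat (2 * e) + P * (- (1 / 6)))) (of_int (leg 3) * (4 * of_int u ^ 2 - 2 * P))"
      by (rule G6_thirds[of "4 * e" "3 * e" e e, OF _ _ _ _ _ _ uv]) (use e he in \<open>auto simp: thirds_def\<close>)
    moreover have "of_nat (2 * e) + P * (- (1 / 6)) = - (1 / 6 :: rat)" unfolding e by (simp add: field_simps)
    ultimately show ?thesis by (simp only:)
  next
    case b
    then obtain e where e: "p = 12 * e + 5" by (metis mod_mult_div_eq add.commute)
    have he: "h = 6 * e + 2" using e unfolding h_def by simp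
    have "cg 2 (G h (of_nat (2 * e) + P * (- (1 / 6)))) (of_int (leg 3) * (4 * of_int u ^ 2 - 2 * P))"
      by (rule G6_thirds[of "4 * e + 1" "3 * e + 1" e "e + 1", OF _ _ _ _ _ _ uv]) (use e he in \<open>auto simp: thirds_def\<close>)
    moreover have "of_nat (2 * e) + P * (- (1 / 6)) = -1 - - (1 / 6 :: rat)" unfolding e by (simp add: field_simps)
    ultimately show ?thesis using G_reflect[of h "- (1 / 6) :: rat"] by (simp only:)
  qed
qed

end

section \<open>Assembling the cases\<close>

context odd_prime
begin

lemma G3_inert: assumes "[p = 2] (mod 3)" shows "cg 1 (G h (- (1 / 3))) 0"
proof -
  have "p mod 3 = 2" using assms by (simp add: cong_def)
  then obtain k where k: "p = 3 * k + 2" by (metis mod_mult_div_eq add.commute)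
  then have "cg 1 (G h (of_nat (2 * k + 1) + P * (- (2 / 3)))) 0"
    by (intro G_odd_mod_p Zp_minus third_Zp) auto
  moreover have "of_nat (2 * k + 1) + P * (- (2 / 3)) = - (1 / 3 :: rat)" unfolding k by (simp add: field_simps)
  ultimately show ?thesis by (simp only:)
qed

lemma G4_inert: assumes "[p = 5] (mod 8) \<or> [p = 7] (mod 8)" shows "cg 1 (G h (- (1 / 4))) 0"
proof -
  have q: "1 / 4 \<in> Zp p" using Zp_divide_pow4[of 1 1] by simp
  have q3: "3 / 4 \<in> Zp p" using Zp_divide_pow4[of 3 1] by simp
  consider (a) "p mod 8 = 5" | (b) "p mod 8 = 7" using assms by (auto simp: cong_def)
  then show ?thesis
  proof cases
    case a
    then obtain k where k: "p = 8 * k + 5" by (metis mod_mult_div_eq add.commute)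
    then have "cg 1 (G h (of_nat (2 * k + 1) + P * (- (1 / 4)))) 0"
      by (intro G_odd_mod_p Zp_minus q) auto
    moreover have "of_nat (2 * k + 1) + P * (- (1 / 4)) = - (1 / 4 :: rat)" unfolding k by (simp add: field_simps)
    ultimately show ?thesis by (simp only:)
  next
    case b
    then obtain k where k: "p = 8 * k + 7" by (metis mod_mult_div_eq add.commute)
    then have "cg 1 (G h (of_nat (6 * k + 5) + P * (- (3 / 4)))) 0"
      by (intro G_odd_mod_p Zp_minus q3) auto
    moreover have "of_nat (6 * k + 5) + P * (- (3 / 4)) = - (1 / 4 :: rat)" unfolding k by (simp add: field_simps)
    ultimately show ?thesis by (simp only:)
  qed
qed

lemma G6_inert: assumes "[p = 3] (mod 4)" "p > 3" shows "cg 1 (G h (- (1 / 6))) 0"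
proof -
  have q: "1 / 6 \<in> Zp p" using assms(2) by (intro sixth_Zp) simp
  have q5: "5 / 6 \<in> Zp p" using Zp_mult[OF Zp_of_nat[of 5] q] by simp
  have "p mod 4 = 3" using assms by (simp add: cong_def)
  moreover have "p mod 3 \<noteq> 0" using prime_p primes_dvd_imp_eq[of 3 p] assms(2) by (auto simp: mod_eq_0_iff_dvd)
  ultimately have "p mod 12 = 7 \<or> p mod 12 = 11" by presburger
  then consider (a) "p mod 12 = 7" | (b) "p mod 12 = 11" by blast
  then show ?thesis
  proof cases
    case a
    then obtain k where k: "p = 12 * k + 7" by (metis mod_mult_div_eq add.commute)
    then have "cg 1 (G h (of_nat (2 * k + 1) + P * (- (1 / 6)))) 0"
      by (intro G_odd_mod_p Zp_minus q) auto
    moreover have "of_nat (2 * k + 1) + P * (- (1 / 6)) = - (1 / 6 :: rat)" unfolding k by (simp add: field_simps)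
    ultimately show ?thesis by (simp only:)
  next
    case b
    then obtain k where k: "p = 12 * k + 11" by (metis mod_mult_div_eq add.commute)
    then have "cg 1 (G h (of_nat (10 * k + 9) + P * (- (5 / 6)))) 0"
      by (intro G_odd_mod_p Zp_minus q5) auto
    moreover have "of_nat (10 * k + 9) + P * (- (5 / 6)) = - (1 / 6 :: rat)" unfolding k by (simp add: field_simps)
    ultimately show ?thesis by (simp only:)
  qed
qed

lemma cg_absorb_unit:
  assumes "cg 2 g (x - 2 * P)" "cg 1 c 1" "x \<in> Zp p"
  shows "cg 2 (c * g) (c * x - 2 * P)"
proof -
  have c: "c \<in> Zp p" using assms(2) by (rule cg_Zp)
  have "cg 2 (P * c) (P * 1)" by (rule cg_P_mult2[OF assms(2)])
  from cg_mult_left[OF this, of 2] have "cg 2 (2 * (P * c)) (2 * (P * 1))" by simp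
  then have "cg 2 (c * x - 2 * (P * c)) (c * x - 2 * (P * 1))"
    by (rule cg_diff[OF cg_refl[OF Zp_mult[OF c assms(3)]]])
  then have "cg 2 (c * (x - 2 * P)) (c * x - 2 * P)" by (simp add: right_diff_distrib mult_ac)
  with cg_mult_left[OF assms(1) c] show ?thesis by (rule cg_trans)
qed

lemma leg_432: assumes "p > 3" shows "leg 432 = leg 3" "leg 3 * leg 3 = 1"
proof -
  have nd: "\<not> p dvd n" if "0 < n" "n < p" for n using that by (auto dest: dvd_imp_le)
  have "\<not> p dvd 3 * (2 * 2)" unfolding prime_dvd_mult_iff[OF prime_p] using nd[of 3] nd[of 2] assms by simp
  then have "\<not> p dvd 12" by simp
  then have "\<not> int p dvd 12" using int_dvd_int_iff[of p 12] by simp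
  then have "leg 12 * leg 12 = 1" by (rule leg_square)
  moreover have "leg (3 * (12 * 12)) = leg 3 * (leg 12 * leg 12)" unfolding leg_mult ..
  ultimately show "leg 432 = leg 3" by simp
  have "\<not> int p dvd 3" using nd[of 3] assms int_dvd_int_iff[of p 3] by simp
  then show "leg 3 * leg 3 = 1" by (rule leg_square)
qed

lemma leg_3_reciprocity: assumes "p mod 4 = 1" "p > 3" shows "leg 3 = Legendre (int p) 3"
proof -
  have "even h" using assms(1) unfolding h_def by presburger
  have "Legendre (int 3) (int p) * Legendre (int p) (int 3) = (-1) ^ ((3 - 1) div 2 * ((p - 1) div 2))"
    using assms(2) prime_p by (intro Quadratic_Reciprocity) auto
  also have "\<dots> = (1 :: int)" using \<open>even h\<close> unfolding h_def by simp
  finally have 1: "leg 3 * Legendre (int p) 3 = 1" unfolding leg_def by simp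
  have "leg 3 * leg 3 * Legendre (int p) 3 = leg 3 * (leg 3 * Legendre (int p) 3)" by (rule mult.assoc)
  then show ?thesis unfolding 1 leg_432(2)[OF assms(2)] by simp
qed

lemma G3_case:
  assumes "[p = 1] (mod 3)" "int p = u ^ 2 + 3 * v ^ 2"
  shows "cg 2 (G3 h) (27 ^ h * (4 * of_int u ^ 2 - 2 * P))"
proof -
  have "p mod 3 = 1" using assms(1) by (simp add: cong_def)
  then have "p mod 6 = 1" using odd_p by presburger
  then obtain e where "p = 6 * e + 1" by (metis mod_mult_div_eq add.commute)
  from cg_mult_left[OF G3_split[OF this assms(2)] Zp_power[OF Zp_numeral]] show ?thesis
    unfolding G3_def by simp
qed

lemma G4_case:
  assumes "[p = 1] (mod 8) \<or> [p = 3] (mod 8)" "p > 3" "int p = u ^ 2 + 2 * v ^ 2"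
  shows "cg 2 (G4 h) (8 ^ (p - 1) * (4 * of_int u ^ 2) - 2 * P)"
proof -
  have g: "cg 2 (G h (-1 / 4)) (4 * of_int u ^ 2 - 2 * P)"
  proof -
    consider (a) "p mod 8 = 1" | (b) "p mod 8 = 3" using assms(1) by (auto simp: cong_def)
    then show ?thesis
    proof cases
      case a
      then obtain e where "p = 8 * e + 1" by (metis mod_mult_div_eq add.commute)
      then show ?thesis using assms(3) by (rule G4_split)
    next
      case b
      then obtain e where e: "p = 8 * e + 3" by (metis mod_mult_div_eq add.commute)
      then interpret prime_3_mod_8 p e by unfold_locales
      show ?thesis using e assms(2,3) by (intro G4_nonsplit) auto
    qed
  qed
  have "\<not> p dvd 2 ^ 3" by (rule not_dvd_pow2)
  then have "[8 ^ (p - 1) = 1] (mod p)" using fermat_theorem[OF prime_p] by simp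
  then have "[int (8 ^ (p - 1)) = int 1] (mod int p ^ 1)" by (simp only: cong_int_iff power_one_right)
  then have "cg 1 (of_int (int (8 ^ (p - 1)))) (of_int (int 1))" by (simp only: cg_of_int_iff)
  then have c: "cg 1 (8 ^ (p - 1)) 1" by simp
  have "p - 1 = 2 * h" using p_eq by simp
  then have "8 ^ (p - 1) = (64 ^ h :: rat)" by (simp only: power_mult) simp
  then have "G4 h = 8 ^ (p - 1) * G h (-1 / 4)" unfolding G4_def by simp
  then show ?thesis using cg_absorb_unit[OF g c Zp_mult[OF Zp_numeral Zp_power[OF Zp_of_int]]] by (simp only:)
qed

lemma G6_case:
  assumes "[p = 1] (mod 4)" "p > 3" "int p = u ^ 2 + 4 * v ^ 2"
  shows "cg 2 (G6 h) (432 ^ h * of_int (Legendre (int p) 3) * (4 * of_int u ^ 2) - 2 * P)"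
proof -
  let ?s = "of_int (leg 3) :: rat" and ?x = "4 * of_int u ^ 2 :: rat"
  have p4: "p mod 4 = 1" using assms(1) by (simp add: cong_def)
  have x: "?x \<in> Zp p" "?s \<in> Zp p" by (auto intro: Zp_mult Zp_power)
  have "leg 3 * leg 3 = 1" by (rule leg_432(2)[OF assms(2)])
  then have s: "?s * ?s = 1" by (metis of_int_1 of_int_mult)
  have "cg 2 (?s * G h (- (1 / 6))) (?s * (?s * (?x - 2 * P)))"
    by (rule cg_mult_left[OF G6_split[OF p4 assms(2,3)] x(2)])
  then have g: "cg 2 (?s * G h (- (1 / 6))) (?x - 2 * P)" using s by (simp flip: mult.assoc)
  have "[leg 432 = 432 ^ h] (mod int p ^ 1)" using leg_euler[of 432] by simp
  then have "cg 1 (of_int (432 ^ h)) (of_int (leg 432))" unfolding cg_of_int_iff by (rule cong_sym)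
  then have "cg 1 (432 ^ h) ?s" unfolding leg_432(1)[OF assms(2)] by simp
  from cg_mult[OF this cg_refl[OF x(2)]] have "cg 1 (432 ^ h * ?s) 1" unfolding s .
  from cg_absorb_unit[OF g this x(1)] have "cg 2 (432 ^ h * (?s * ?s) * G h (- (1 / 6))) (432 ^ h * ?s * ?x - 2 * P)"
    by (simp only: mult_ac)
  then have "cg 2 (432 ^ h * G h (- (1 / 6))) (432 ^ h * ?s * ?x - 2 * P)" unfolding s mult_1_right .
  then show ?thesis unfolding G6_def leg_3_reciprocity[OF p4 assms(2)] .
qed

lemma G_residue:
  assumes "x \<in> Zp p"
  defines "a \<equiv> zp_residue p x"
  shows "even a \<Longrightarrow> cg 1 (G h x) (of_nat (a choose (a div 2)) ^ 2 * (1 / 4 ^ a))"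
    and "odd a \<Longrightarrow> cg 1 (G h x) 0"
    and "even a \<Longrightarrow> cg 2 (G h x) (\<Sum>k=0..h. (x gchoose k) * ((-1 - x) gchoose k) * (of_nat ((2 * k) choose k) / 4 ^ k))"
    and "odd a \<Longrightarrow> cg 2 (G h x)
      (- (\<Sum>k=(p + 1) div 2..a. of_nat (a choose k) * of_nat ((a + k) choose k) * (of_nat ((2 * k) choose k) / (-4) ^ k))
       - P * (\<Sum>k=0..a. of_nat (a choose k) * of_nat ((a + k) choose k) * (of_nat ((2 * k) choose k) / (-4) ^ k) * H k))"
proof -
  obtain t where t: "t \<in> Zp p" "x = of_nat a + P * t" "a < p"
    using zp_residue_props[OF assms(1)] unfolding a_def .
  show "cg 1 (G h x) (of_nat (a choose (a div 2)) ^ 2 * (1 / 4 ^ a))" if "even a"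
    using G_even_mod_p[OF t(1,3) that] t(2) by simp
  show "cg 1 (G h x) 0" if "odd a"
    using G_odd_mod_p[OF t(1,3) that] t(2) by simp
  show "cg 2 (G h x) (\<Sum>k=0..h. (x gchoose k) * ((-1 - x) gchoose k) * (of_nat ((2 * k) choose k) / 4 ^ k))" if "even a"
    using G_even_ssum[OF t(1,3) that] unfolding t(2)[symmetric] ssum_def gprod_def cbin_def .
  show "cg 2 (G h x)
      (- (\<Sum>k=(p + 1) div 2..a. of_nat (a choose k) * of_nat ((a + k) choose k) * (of_nat ((2 * k) choose k) / (-4) ^ k))
       - P * (\<Sum>k=0..a. of_nat (a choose k) * of_nat ((a + k) choose k) * (of_nat ((2 * k) choose k) / (-4) ^ k) * H k))" if "odd a"
    using G_odd_mod_p2[OF t(1,3) that] unfolding t(2)[symmetric] .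
qed

end

theorem theorem3p6:
  shows
    "(\<forall>(p::nat) (x::rat). prime p \<and> odd p \<and> x \<in> Zp p \<and> \<not> zp_cong p 1 x 0 \<longrightarrow>
        (let a = zp_residue p x; h = (p - 1) div 2 in
          (even a \<longrightarrow> zp_cong p 1 (G h x) (of_nat (a choose (a div 2)) ^ 2 * (1 / 4 ^ a))) \<and>
          (odd a \<longrightarrow> zp_cong p 1 (G h x) 0) \<and>
          (even a \<longrightarrow> zp_cong p 2 (G h x)
             (\<Sum>k=0..h. (x gchoose k) * ((-1 - x) gchoose k) * (of_nat ((2 * k) choose k) / 4 ^ k))) \<and>
          (odd a \<longrightarrow> zp_cong p 2 (G h x)
             (- (\<Sum>k=(p + 1) div 2..a.
                   of_nat (a choose k) * of_nat ((a + k) choose k) * (of_nat ((2 * k) choose k) / (-4) ^ k))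
              - of_nat p * (\<Sum>k=0..a.
                   of_nat (a choose k) * of_nat ((a + k) choose k) * (of_nat ((2 * k) choose k) / (-4) ^ k) * H k)))))
   \<and> (\<forall>p::nat. prime p \<and> p > 3 \<longrightarrow>
        (let h = (p - 1) div 2 in
          (\<forall>u v::int. [p = 1] (mod 3) \<and> int p = u ^ 2 + 3 * v ^ 2 \<longrightarrow>
             zp_cong p 2 (G3 h) (27 ^ h * (4 * of_int u ^ 2 - 2 * of_nat p))) \<and>
          ([p = 2] (mod 3) \<longrightarrow> zp_cong p 1 (G3 h) 0) \<and>
          (\<forall>u v::int. ([p = 1] (mod 8) \<or> [p = 3] (mod 8)) \<and> int p = u ^ 2 + 2 * v ^ 2 \<longrightarrow>
             zp_cong p 2 (G4 h) (8 ^ (p - 1) * (4 * of_int u ^ 2) - 2 * of_nat p)) \<and>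
          ([p = 5] (mod 8) \<or> [p = 7] (mod 8) \<longrightarrow> zp_cong p 1 (G4 h) 0) \<and>
          (\<forall>u v::int. [p = 1] (mod 4) \<and> int p = u ^ 2 + 4 * v ^ 2 \<longrightarrow>
             zp_cong p 2 (G6 h) (432 ^ h * of_int (Legendre (int p) 3) * (4 * of_int u ^ 2) - 2 * of_nat p)) \<and>
          ([p = 3] (mod 4) \<longrightarrow> zp_cong p 1 (G6 h) 0)))"
proof (rule conjI; intro allI impI)
  fix p :: nat and x :: rat
  assume *: "prime p \<and> odd p \<and> x \<in> Zp p \<and> \<not> zp_cong p 1 x 0"
  then interpret odd_prime p by unfold_locales auto
  have "x \<in> Zp p" using * by blast
  note r = G_residue[OF this, unfolded h_def]
  show "let a = zp_residue p x; h = (p - 1) div 2 in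
          (even a \<longrightarrow> zp_cong p 1 (G h x) (of_nat (a choose (a div 2)) ^ 2 * (1 / 4 ^ a))) \<and>
          (odd a \<longrightarrow> zp_cong p 1 (G h x) 0) \<and>
          (even a \<longrightarrow> zp_cong p 2 (G h x)
             (\<Sum>k=0..h. (x gchoose k) * ((-1 - x) gchoose k) * (of_nat ((2 * k) choose k) / 4 ^ k))) \<and>
          (odd a \<longrightarrow> zp_cong p 2 (G h x)
             (- (\<Sum>k=(p + 1) div 2..a.
                   of_nat (a choose k) * of_nat ((a + k) choose k) * (of_nat ((2 * k) choose k) / (-4) ^ k))
              - of_nat p * (\<Sum>k=0..a.
                   of_nat (a choose k) * of_nat ((a + k) choose k) * (of_nat ((2 * k) choose k) / (-4) ^ k) * H k)))"
    unfolding Let_def by (intro conjI impI r)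
next
  fix p :: nat
  assume *: "prime p \<and> p > 3"
  then interpret odd_prime p using prime_odd_nat[of p] by unfold_locales auto
  have p3: "p > 3" using * by blast
  have z: "cg 1 (c * g) 0" if "cg 1 g 0" "c \<in> Zp p" for c g using cg_mult_left[OF that] by simp
  have z3: "cg 1 (G3 h) 0" if "[p = 2] (mod 3)"
    unfolding G3_def by (intro z G3_inert that Zp_power Zp_numeral)
  have z4: "cg 1 (G4 h) 0" if "[p = 5] (mod 8) \<or> [p = 7] (mod 8)"
    unfolding G4_def by (intro z G4_inert that Zp_power Zp_numeral)
  have z6: "cg 1 (G6 h) 0" if "[p = 3] (mod 4)"
    unfolding G6_def by (intro z G6_inert that p3 Zp_power Zp_numeral)
  note r = z3 z4 z6 G3_case G4_case[OF _ p3] G6_case[OF _ p3]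
  show "let h = (p - 1) div 2 in
          (\<forall>u v::int. [p = 1] (mod 3) \<and> int p = u ^ 2 + 3 * v ^ 2 \<longrightarrow>
             zp_cong p 2 (G3 h) (27 ^ h * (4 * of_int u ^ 2 - 2 * of_nat p))) \<and>
          ([p = 2] (mod 3) \<longrightarrow> zp_cong p 1 (G3 h) 0) \<and>
          (\<forall>u v::int. ([p = 1] (mod 8) \<or> [p = 3] (mod 8)) \<and> int p = u ^ 2 + 2 * v ^ 2 \<longrightarrow>
             zp_cong p 2 (G4 h) (8 ^ (p - 1) * (4 * of_int u ^ 2) - 2 * of_nat p)) \<and>
          ([p = 5] (mod 8) \<or> [p = 7] (mod 8) \<longrightarrow> zp_cong p 1 (G4 h) 0) \<and>
          (\<forall>u v::int. [p = 1] (mod 4) \<and> int p = u ^ 2 + 4 * v ^ 2 \<longrightarrow>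
             zp_cong p 2 (G6 h) (432 ^ h * of_int (Legendre (int p) 3) * (4 * of_int u ^ 2) - 2 * of_nat p)) \<and>
          ([p = 3] (mod 4) \<longrightarrow> zp_cong p 1 (G6 h) 0)"
    unfolding Let_def using r[unfolded h_def] by blast
qed

end
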